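(* Let $0\le\delta<1$. The strong martingale problem with respect to $\mathcal D_{L^\delta}(\mathbb R_+)$ and a Brownian motion $W$ admits pathwise uniqueness: if $W$ is a Brownian motion on a probability space $(\Omega,\mathcal F,\mathbb P)$ and $X^1,X^2$ are ($\mathbb R_+$-valued) solutions to the strong martingale problem with respect to $\mathcal D_{L^\delta}(\mathbb R_+)$ and $W$ with $\mathbb P[X^1_0=X^2_0]=1$, then $X^1$ and $X^2$ are indistinguishable.
   Context: Processes are indexed by $t\in[0,T]$ with $T>0$ fixed. $\mathbb R_+=[0,\infty)$, $\mathbb R_-=(-\infty,0]$; $C^k(I)$ is the space of real functions on the interval $I$ with continuous derivatives up to order $k$. Domain and operator ($0\le\delta<1$): $\mathcal D_{L^\delta}$ is the set of continuous $f:\mathbb R\to\mathbb R$ whose restrictions to $\mathbb R_+$ and to $\mathbb R_-$ are of class $C^2$ and such that (a) there is a continuous $g:\mathbb R\to\mathbb R$ extending $x\mapsto f'(x)|x|^{\delta-1}$, $x\neq0$; (b) there is a continuous $G:\mathbb R\to\mathbb R$ extending $x\mapsto g'(x)|x|^{1-\delta}$, $x\ne0$. One sets $L^\delta f:=G/2$; thus $L^\delta f(x)=\frac{f''(x)}2+\frac{(\delta-1)f'(x)}{2x}$ for $x\neq0$. (Such $f$ are $C^1$ with $f'(0)=0$.) $\mathcal D_{L^\delta}(\mathbb R_+)$ is the set of restrictions to $\mathbb R_+$ of functions $\hat f\in\mathcal D_{L^\delta}$, and for such a restriction $f$, $L^\delta f$ is the restriction of $L^\delta\hat f$ to $\mathbb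 R_+$. Strong martingale problem with respect to $\mathcal D_{L^\delta}(\mathbb R_+)$ and $W$ ($\sigma=1$, no path-dependent drift): a continuous $\mathbb R_+$-valued process $X$ with $X_0=x_0\in\mathbb R_+$, adapted to the canonical filtration of $W$ (satisfying the usual conditions), is a solution if $f(X_t)-f(X_0)-\int_0^tL^\delta f(X_s)ds=\int_0^tf'(X_s)dW_s$ for all $f\in\mathcal D_{L^\delta}(\mathbb R_+)$ and $t\in[0,T]$. *)

theory Defs
  imports "HOL-Probability.Probability"
begin

section \<open>The operator\<close>

text \<open>Class \<open>C\<^sup>k\<close> on an interval \<open>I\<close>; derivatives at end points contained in \<open>I\<close> are one-sided.\<close>

definition C_class_on :: "nat \<Rightarrow> (real \<Rightarrow> real) \<Rightarrow> real set \<Rightarrow> bool" where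
  "C_class_on k f I \<longleftrightarrow>
     (\<exists>d :: nat \<Rightarrow> real \<Rightarrow> real.
        (\<forall>x\<in>I. d 0 x = f x) \<and>
        (\<forall>j<k. \<forall>x\<in>I. (d j has_real_derivative d (Suc j) x) (at x within I)) \<and>
        (\<forall>j\<le>k. continuous_on I (d j)))"

definition continuous_extension :: "(real \<Rightarrow> real) \<Rightarrow> (real \<Rightarrow> real) \<Rightarrow> bool" where
  "continuous_extension h g \<longleftrightarrow> continuous_on UNIV g \<and> (\<forall>x. x \<noteq> 0 \<longrightarrow> g x = h x)"

text \<open>The pair \<open>(g, G)\<close> of conditions (a) and (b). For \<open>f\<close> of class \<open>C\<^sup>2\<close> on both half-lines,
  \<open>f\<close> and \<open>g\<close> are differentiable off \<open>0\<close>, so \<^const>\<open>deriv\<close> is only used where the derivative exists.\<close>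

definition L_witness ::
    "real \<Rightarrow> (real \<Rightarrow> real) \<Rightarrow> (real \<Rightarrow> real) \<Rightarrow> (real \<Rightarrow> real) \<Rightarrow> bool" where
  "L_witness \<delta> f g G \<longleftrightarrow>
     continuous_extension (\<lambda>x. deriv f x * \<bar>x\<bar> powr (\<delta> - 1)) g \<and>
     continuous_extension (\<lambda>x. deriv g x * \<bar>x\<bar> powr (1 - \<delta>)) G"

definition D_L :: "real \<Rightarrow> (real \<Rightarrow> real) set" where
  "D_L \<delta> = {f. continuous_on UNIV f \<and> C_class_on 2 f {0..} \<and> C_class_on 2 f {..0} \<and>
              (\<exists>g G. L_witness \<delta> f g G)}"

definition L_op :: "real \<Rightarrow> (real \<Rightarrow> real) \<Rightarrow> real \<Rightarrow> real" where
  "L_op \<delta> f = (\<lambda>x. (THE G. \<exists>g. L_witness \<delta> f g G) x / 2)"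

text \<open>Functions on \<open>\<real>\<^sub>+\<close> are represented through \<^const>\<open>restrict\<close>. The choice of the extension in
  \<open>L_half\<close> is immaterial; see \<open>L_half_restrict\<close> below.\<close>

definition D_L_half :: "real \<Rightarrow> (real \<Rightarrow> real) set" where
  "D_L_half \<delta> = (\<lambda>fh. restrict fh {0..}) ` D_L \<delta>"

definition L_half :: "real \<Rightarrow> (real \<Rightarrow> real) \<Rightarrow> real \<Rightarrow> real" where
  "L_half \<delta> f = restrict (L_op \<delta> (SOME fh. fh \<in> D_L \<delta> \<and> restrict fh {0..} = f)) {0..}"

text \<open>The derivative of a function on \<open>\<real>\<^sub>+\<close>, one-sided at \<open>0\<close>.\<close>

definition deriv_half :: "(real \<Rightarrow> real) \<Rightarrow> real \<Rightarrow> real" where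
  "deriv_half f x = vector_derivative f (at x within {0..})"

lemma continuous_extension_unique:
  assumes "continuous_extension h g" "continuous_extension h g'"
  shows "g = g'"
proof
  fix x
  have "g 0 = g' 0"
  proof (rule tendsto_unique[of "at (0::real)"])
    show "(g \<longlongrightarrow> g 0) (at 0)"
      using assms(1) by (simp add: continuous_extension_def continuous_on_def)
    have "(g' \<longlongrightarrow> g' 0) (at 0)"
      using assms(2) by (simp add: continuous_extension_def continuous_on_def)
    moreover have "eventually (\<lambda>x. g' x = g x) (at 0)"
      using assms by (auto simp: continuous_extension_def eventually_at_filter)
    ultimately show "(g \<longlongrightarrow> g' 0) (at 0)"
      by (rule Lim_transform_eventually)
  qed simp
  with assms show "g x = g' x"
    by (cases "x = 0") (auto simp: continuous_extension_def)
qed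

lemma L_witness_unique:
  assumes "L_witness \<delta> f g G" "L_witness \<delta> f g' G'"
  shows "g = g'" "G = G'"
proof -
  show "g = g'"
    using assms continuous_extension_unique unfolding L_witness_def by blast
  with assms show "G = G'"
    using continuous_extension_unique unfolding L_witness_def by blast
qed

lemma L_op_eq:
  assumes "L_witness \<delta> f g G"
  shows "L_op \<delta> f x = G x / 2"
proof -
  have "(THE G. \<exists>g. L_witness \<delta> f g G) = G"
    using assms L_witness_unique(2) by (intro the_equality) blast+
  then show ?thesis by (simp add: L_op_def)
qed

lemma L_op_cong_half:
  assumes f: "f1 \<in> D_L \<delta>" "f2 \<in> D_L \<delta>" and eq: "\<And>x. x \<ge> 0 \<Longrightarrow> f1 x = f2 x" and "x \<ge> 0"
  shows "L_op \<delta> f1 x = L_op \<delta> f2 x"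
proof -
  obtain g1 G1 g2 G2 where w: "L_witness \<delta> f1 g1 G1" "L_witness \<delta> f2 g2 G2"
    using f by (auto simp: D_L_def)
  have near: "eventually (\<lambda>y. y > 0) (nhds x)" if "x > 0" for x :: real
    using that by (rule order_tendstoD(1)[OF filterlim_ident])
  have g: "g1 x = g2 x" if "x > 0" for x
  proof -
    have "deriv f1 x = deriv f2 x"
      by (rule deriv_cong_ev[OF eventually_mono[OF near[OF that]]]) (simp_all add: eq)
    with w that show ?thesis by (simp add: L_witness_def continuous_extension_def)
  qed
  then have G: "G1 x = G2 x" if "x > 0" for x
  proof -
    have "deriv g1 x = deriv g2 x"
      by (rule deriv_cong_ev[OF eventually_mono[OF near[OF that]]]) (simp_all add: g)
    with w that show ?thesis by (simp add: L_witness_def continuous_extension_def)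
  qed
  have "G1 0 = G2 0"
  proof (rule tendsto_unique[of "at_right (0::real)"])
    have "(G1 \<longlongrightarrow> G1 0) (at 0)" "(G2 \<longlongrightarrow> G2 0) (at 0)"
      using w by (auto simp: L_witness_def continuous_extension_def continuous_on_def)
    then have l: "(G1 \<longlongrightarrow> G1 0) (at_right 0)" "(G2 \<longlongrightarrow> G2 0) (at_right 0)"
      by (auto intro: filterlim_mono[OF _ order_refl at_le])
    show "(G1 \<longlongrightarrow> G1 0) (at_right 0)" by (fact l(1))
    have "eventually (\<lambda>x. G2 x = G1 x) (at_right 0)"
      using G by (auto simp: eventually_at_filter)
    with l(2) show "(G1 \<longlongrightarrow> G2 0) (at_right 0)"
      by (rule Lim_transform_eventually)
  qed simp
  with G \<open>x \<ge> 0\<close> have "G1 x = G2 x" by (cases "x = 0") auto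
  with w show ?thesis by (simp add: L_op_eq)
qed

lemma L_half_restrict:
  assumes "fh \<in> D_L \<delta>" "x \<ge> 0"
  shows "L_half \<delta> (restrict fh {0..}) x = L_op \<delta> fh x"
proof -
  define k where "k = (SOME k. k \<in> D_L \<delta> \<and> restrict k {0..} = restrict fh {0..})"
  have k: "k \<in> D_L \<delta> \<and> restrict k {0..} = restrict fh {0..}"
    unfolding k_def by (rule someI[of _ fh]) (use assms in auto)
  then have "k y = fh y" if "y \<ge> 0" for y
    using that by (metis atLeast_iff restrict_apply')
  then have "L_op \<delta> k x = L_op \<delta> fh x"
    using k assms by (intro L_op_cong_half) auto
  then show ?thesis
    using assms by (simp add: L_half_def k_def)
qed


section \<open>Brownian motion and its canonical filtration\<close>

text \<open>Processes are functions \<^typ>\<open>real \<Rightarrow> 'a \<Rightarrow> real\<close> of which only the values at times in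
  \<open>{0..T}\<close> matter.\<close>

definition continuous_process :: "'a measure \<Rightarrow> real \<Rightarrow> (real \<Rightarrow> 'a \<Rightarrow> real) \<Rightarrow> bool" where
  "continuous_process M T X \<longleftrightarrow> (\<forall>\<omega>\<in>space M. continuous_on {0..T} (\<lambda>t. X t \<omega>))"

definition past_events :: "'a measure \<Rightarrow> (real \<Rightarrow> 'a \<Rightarrow> real) \<Rightarrow> real \<Rightarrow> 'a set set" where
  "past_events M W t = {W r -` B \<inter> space M | r B. r \<in> {0..t} \<and> B \<in> sets borel}"

definition brownian_motion :: "'a measure \<Rightarrow> real \<Rightarrow> (real \<Rightarrow> 'a \<Rightarrow> real) \<Rightarrow> bool" where
  "brownian_motion M T W \<longleftrightarrow>
     prob_space M \<and>
     (\<forall>t\<in>{0..T}. W t \<in> borel_measurable M) \<and>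
     continuous_process M T W \<and>
     (AE \<omega> in M. W 0 \<omega> = 0) \<and>
     (\<forall>s t. 0 \<le> s \<and> s < t \<and> t \<le> T \<longrightarrow>
        distributed M lborel (\<lambda>\<omega>. W t \<omega> - W s \<omega>) (normal_density 0 (sqrt (t - s))) \<and>
        prob_space.indep_set M
          (sigma_sets (space M) (past_events M W s))
          {(\<lambda>\<omega>. W t \<omega> - W s \<omega>) -` B \<inter> space M | B. B \<in> sets borel})"

text \<open>The canonical filtration of \<open>W\<close> on \<open>{0..T}\<close> made right-continuous and complete. As \<open>M\<close> need
  not be complete, the null sets are those of its completion. Because of the \<^const>\<open>min\<close>, the
  \<open>\<sigma>\<close>-algebra at time \<open>T\<close> involves \<open>W\<close> on \<open>{0..T}\<close> only.\<close>

definition canonical_filtration ::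
    "'a measure \<Rightarrow> real \<Rightarrow> (real \<Rightarrow> 'a \<Rightarrow> real) \<Rightarrow> real \<Rightarrow> 'a measure" where
  "canonical_filtration M T W t =
     sigma (space M)
       (\<Inter>s\<in>{t<..}. sigma_sets (space M)
          (past_events M W (min s T) \<union> null_sets (completion M)))"

definition adapted_process ::
    "(real \<Rightarrow> 'a measure) \<Rightarrow> real \<Rightarrow> (real \<Rightarrow> 'a \<Rightarrow> real) \<Rightarrow> bool" where
  "adapted_process F T X \<longleftrightarrow> (\<forall>t\<in>{0..T}. X t \<in> borel_measurable (F t))"

definition progressive_process ::
    "(real \<Rightarrow> 'a measure) \<Rightarrow> real \<Rightarrow> (real \<Rightarrow> 'a \<Rightarrow> real) \<Rightarrow> bool" where
  "progressive_process F T H \<longleftrightarrow>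
     (\<forall>t\<in>{0..T}. (\<lambda>(s, \<omega>). H s \<omega>) \<in> borel_measurable (restrict_space borel {0..t} \<Otimes>\<^sub>M F t))"


section \<open>The Ito integral\<close>

text \<open>Data \<open>n\<close>, \<open>\<tau>\<close>, \<open>\<xi>\<close> represent the simple process equal to \<open>\<xi> i\<close> on \<open>{\<tau> i<..\<tau> (Suc i)}\<close>,
  \<open>i < n\<close>.\<close>

definition simple_data ::
    "'a measure \<Rightarrow> (real \<Rightarrow> 'a measure) \<Rightarrow> real \<Rightarrow> nat \<Rightarrow> (nat \<Rightarrow> real) \<Rightarrow> (nat \<Rightarrow> 'a \<Rightarrow> real) \<Rightarrow> bool" where
  "simple_data M F T n \<tau> \<xi> \<longleftrightarrow>
     0 \<le> \<tau> 0 \<and> \<tau> n \<le> T \<and> (\<forall>i<n. \<tau> i \<le> \<tau> (Suc i)) \<and>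
     (\<forall>i<n. \<xi> i \<in> borel_measurable (F (\<tau> i)) \<and> (\<exists>c. \<forall>\<omega>\<in>space M. \<bar>\<xi> i \<omega>\<bar> \<le> c))"

definition simple_process ::
    "nat \<Rightarrow> (nat \<Rightarrow> real) \<Rightarrow> (nat \<Rightarrow> 'a \<Rightarrow> real) \<Rightarrow> real \<Rightarrow> 'a \<Rightarrow> real" where
  "simple_process n \<tau> \<xi> s \<omega> = (\<Sum>i<n. \<xi> i \<omega> * indicator {\<tau> i<..\<tau> (Suc i)} s)"

definition simple_integral ::
    "(real \<Rightarrow> 'a \<Rightarrow> real) \<Rightarrow> nat \<Rightarrow> (nat \<Rightarrow> real) \<Rightarrow> (nat \<Rightarrow> 'a \<Rightarrow> real) \<Rightarrow> real \<Rightarrow> 'a \<Rightarrow> real" where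
  "simple_integral W n \<tau> \<xi> t \<omega> =
     (\<Sum>i<n. \<xi> i \<omega> * (W (min (\<tau> (Suc i)) t) \<omega> - W (min (\<tau> i) t) \<omega>))"

text \<open>\<open>I\<close> is (a version of) the integral process \<open>\<integral> H dW\<close>: the integrand satisfies
  \<open>\<integral>\<^sub>0\<^sup>T H\<^sub>s\<^sup>2 ds < \<infinity>\<close> almost surely and is approximated by simple processes \<open>H\<^sub>m\<close> such that
  \<open>\<integral>\<^sub>0\<^sup>T (H\<^sub>m - H)\<^sup>2 ds \<rightarrow> 0\<close> in probability, and \<open>I\<close> is the continuous adapted process that is the
  limit in probability of the elementary integrals. Such an \<open>I\<close> exists, and it is unique up to
  indistinguishability and independent of the approximating sequence. The measurability of the
  events is understood with respect to the completion of \<open>M\<close>.\<close>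

definition ito_integral ::
    "'a measure \<Rightarrow> (real \<Rightarrow> 'a measure) \<Rightarrow> real \<Rightarrow> (real \<Rightarrow> 'a \<Rightarrow> real) \<Rightarrow>
     (real \<Rightarrow> 'a \<Rightarrow> real) \<Rightarrow> (real \<Rightarrow> 'a \<Rightarrow> real) \<Rightarrow> bool" where
  "ito_integral M F T W H I \<longleftrightarrow>
     progressive_process F T H \<and>
     (AE \<omega> in M. (\<integral>\<^sup>+s\<in>{0..T}. ennreal ((H s \<omega>)\<^sup>2) \<partial>lborel) < \<infinity>) \<and>
     continuous_process M T I \<and> adapted_process F T I \<and>
     (\<exists>n \<tau> \<xi>.
        (\<forall>m. simple_data M F T (n m) (\<tau> m) (\<xi> m)) \<and>
        (\<forall>\<epsilon>>0. (\<lambda>m. measure (completion M) {\<omega>\<in>space M. ennreal \<epsilon> <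
             (\<integral>\<^sup>+s\<in>{0..T}. ennreal ((simple_process (n m) (\<tau> m) (\<xi> m) s \<omega> - H s \<omega>)\<^sup>2) \<partial>lborel)})
           \<longlonglongrightarrow> 0) \<and>
        (\<forall>t\<in>{0..T}. \<forall>\<epsilon>>0. (\<lambda>m. measure (completion M) {\<omega>\<in>space M.
             \<epsilon> < \<bar>simple_integral W (n m) (\<tau> m) (\<xi> m) t \<omega> - I t \<omega>\<bar>})
           \<longlonglongrightarrow> 0))"


section \<open>The strong martingale problem\<close>

definition strong_martingale_solution ::
    "'a measure \<Rightarrow> real \<Rightarrow> (real \<Rightarrow> 'a \<Rightarrow> real) \<Rightarrow> real \<Rightarrow> (real \<Rightarrow> 'a \<Rightarrow> real) \<Rightarrow> bool" where
  "strong_martingale_solution M T W \<delta> X \<longleftrightarrow>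
     continuous_process M T X \<and>
     (\<forall>t\<in>{0..T}. \<forall>\<omega>\<in>space M. 0 \<le> X t \<omega>) \<and>
     (\<exists>x0\<ge>0. AE \<omega> in M. X 0 \<omega> = x0) \<and>
     adapted_process (canonical_filtration M T W) T X \<and>
     (\<forall>f\<in>D_L_half \<delta>. \<exists>I.
        ito_integral M (canonical_filtration M T W) T W (\<lambda>s \<omega>. deriv_half f (X s \<omega>)) I \<and>
        (\<forall>t\<in>{0..T}. AE \<omega> in M.
           f (X t \<omega>) - f (X 0 \<omega>) - (LINT s:{0..t}|lborel. L_half \<delta> f (X s \<omega>)) = I t \<omega>))"

definition indistinguishable ::
    "'a measure \<Rightarrow> real \<Rightarrow> (real \<Rightarrow> 'a \<Rightarrow> real) \<Rightarrow> (real \<Rightarrow> 'a \<Rightarrow> real) \<Rightarrow> bool" where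
  "indistinguishable M T X Y \<longleftrightarrow> (AE \<omega> in M. \<forall>t\<in>{0..T}. X t \<omega> = Y t \<omega>)"

end

theory Submission
  imports Defs
begin

text \<open>The function \<open>f x = x\<^sup>2 / (1 + x\<^sup>2)\<close> on \<open>\<real>\<^sub>+\<close> belongs to the domain of \<open>L\<^sup>\<delta>\<close> and is injective, so it
  suffices to compare the processes \<open>Y = f X\<close>. These take values in \<open>[0, 1]\<close> and solve
  \<open>dY = b(Y) dt + s(Y) dW\<close> with bounded coefficients, where \<open>b\<close> is Lipschitz and \<open>s\<close> is Hoelder
  continuous of order \<open>1/2\<close>; because everything is bounded, no localisation is needed. Pathwise
  uniqueness then follows by the method of Yamada and Watanabe, applied on a time grid: for the
  difference \<open>D\<close> of two solutions and \<open>\<phi> x = x arsinh (k x) - (sqrt ((k x)\<^sup>2 + 1) - 1) / k\<close> one has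
  \<open>\<bar>x\<bar> \<phi>'' x \<le> 1\<close> and \<open>\<bar>x \<phi>' x\<bar> \<le> \<phi> x + \<bar>x\<bar>\<close>, so that \<open>E (\<phi> D)\<close> is bounded uniformly in \<open>k\<close>, whereas
  \<open>\<phi> x\<close> tends to infinity with \<open>k\<close> for every \<open>x \<noteq> 0\<close>.\<close>

section \<open>A bounded function in the domain\<close>

text \<open>Squaring removes the singular drift: applied to x^2 the operator gives the constant
  \<delta>, and the derivative 2x is the root of 4x^2, so near 0 the image process resembles a
  squared Bessel process with a diffusion coefficient of order 1/2. Division by 1 + x^2 keeps this
  behaviour at 0 and makes both coefficients bounded. The integral is given as a limit in
  probability of elementary sums, and Ito's formula is replaced by a second-order Taylor expansion
  over each grid step \<Delta>, whose error has to be of smaller order than \<Delta>. A bootstrap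
  provides this: a crude second moment of order \<Delta> for the increments of the integral gives
  E|Y t - Y s| of order sqrt \<Delta>, and the Hoelder condition then gives order \<Delta>^(3/2) for
  the squared error of the Euler step. The constant in front of \<Delta>^(3/2) grows with k, which
  dictates the order of the limits: the mesh tends to 0 while k is fixed, and only then k tends to
  infinity.\<close>

definition comp_fun :: "real \<Rightarrow> real" where
  "comp_fun x = x\<^sup>2 / (1 + x\<^sup>2)"

text \<open>For \<open>\<delta> = 0\<close> the even extension is not in the domain: \<open>f' x / \<bar>x\<bar>\<close> must extend continuously to \<open>0\<close>.\<close>

definition comp_ext :: "real \<Rightarrow> real \<Rightarrow> real" where
  "comp_ext \<delta> x = (if \<delta> = 0 then sgn x * comp_fun x else comp_fun x)"

lemma one_plus_square_pos: "1 + (x::real)\<^sup>2 > 0"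
  by (simp add: add_pos_nonneg)

lemma one_plus_square_nonzero [simp]: "1 + (x::real)\<^sup>2 \<noteq> 0"
  using one_plus_square_pos[of x] by linarith

lemma comp_fun_deriv:
  "(comp_fun has_real_derivative 2 * x / (1 + x\<^sup>2)\<^sup>2) (at x within A)"
proof -
  have "((\<lambda>x. x\<^sup>2 / (1 + x\<^sup>2)) has_real_derivative
      (2 * x * (1 + x\<^sup>2) - x\<^sup>2 * (2 * x)) / ((1 + x\<^sup>2) * (1 + x\<^sup>2))) (at x within A)"
    by (auto intro!: derivative_eq_intros)
  also have "2 * x * (1 + x\<^sup>2) - x\<^sup>2 * (2 * x) = 2 * x"
    by (simp add: algebra_simps)
  finally show ?thesis by (simp add: comp_fun_def [abs_def] power2_eq_square)
qed

lemma comp_fun_deriv2: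
  "((\<lambda>x. 2 * x / (1 + x\<^sup>2)\<^sup>2) has_real_derivative (2 - 6 * x\<^sup>2) / (1 + x\<^sup>2) ^ 3) (at x within A)"
proof -
  have "((\<lambda>x. 2 * x / (1 + x\<^sup>2)\<^sup>2) has_real_derivative
      (2 * (1 + x\<^sup>2)\<^sup>2 - 2 * x * (2 * (1 + x\<^sup>2) * (2 * x))) / ((1 + x\<^sup>2)\<^sup>2 * (1 + x\<^sup>2)\<^sup>2)) (at x within A)"
    by (auto intro!: derivative_eq_intros)
  also have "(2 * (1 + x\<^sup>2)\<^sup>2 - 2 * x * (2 * (1 + x\<^sup>2) * (2 * x))) / ((1 + x\<^sup>2)\<^sup>2 * (1 + x\<^sup>2)\<^sup>2) =
     ((1 + x\<^sup>2) * (2 - 6 * x\<^sup>2)) / ((1 + x\<^sup>2) * (1 + x\<^sup>2) ^ 3)"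
    by (rule arg_cong2[where f="(/)"]) (simp_all add: algebra_simps power2_eq_square power3_eq_cube)
  also have "\<dots> = (2 - 6 * x\<^sup>2) / (1 + x\<^sup>2) ^ 3"
    by (rule mult_divide_mult_cancel_left) simp
  finally show ?thesis .
qed

text \<open>The factor \<open>c\<close> serves the negative half-line, where
  \<open>comp_ext \<delta>\<close> is \<open>- comp_fun\<close> if \<delta> = 0 and
  \<open>comp_fun\<close> otherwise.\<close>

lemma C_class_on_comp_fun:
  fixes c :: real
  assumes "\<And>x. x \<in> I \<Longrightarrow> f x = c * comp_fun x"
  shows "C_class_on 2 f I"
  unfolding C_class_on_def
proof (intro exI[of _ "\<lambda>n. if n = 0 then (\<lambda>x. c * comp_fun x) else if n = 1 then
      (\<lambda>x. c * (2 * x / (1 + x\<^sup>2)\<^sup>2)) else (\<lambda>x. c * ((2 - 6 * x\<^sup>2) / (1 + x\<^sup>2) ^ 3))"] conjI allI impI ballI)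
  fix j x assume "j < (2::nat)" "x \<in> I"
  then consider "j = 0" | "j = 1" by linarith
  then show "((if j = 0 then (\<lambda>x. c * comp_fun x) else if j = 1 then
      (\<lambda>x. c * (2 * x / (1 + x\<^sup>2)\<^sup>2)) else (\<lambda>x. c * ((2 - 6 * x\<^sup>2) / (1 + x\<^sup>2) ^ 3)))
     has_real_derivative (if Suc j = 0 then (\<lambda>x. c * comp_fun x) else if Suc j = 1 then
      (\<lambda>x. c * (2 * x / (1 + x\<^sup>2)\<^sup>2)) else (\<lambda>x. c * ((2 - 6 * x\<^sup>2) / (1 + x\<^sup>2) ^ 3))) x) (at x within I)"
    by cases (auto intro!: DERIV_cmult comp_fun_deriv comp_fun_deriv2 simp del: mult.assoc times_divide_eq_right)
next
  fix j show "continuous_on I (if j = 0 then (\<lambda>x. c * comp_fun x) else if j = 1 then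
      (\<lambda>x. c * (2 * x / (1 + x\<^sup>2)\<^sup>2)) else (\<lambda>x. c * ((2 - 6 * x\<^sup>2) / (1 + x\<^sup>2) ^ 3)))"
    unfolding comp_fun_def by (auto intro!: continuous_intros)
qed (use assms in auto)

text \<open>The sign is constant on the open half-line that contains \<open>x\<close>, so it
  differentiates like a constant factor.\<close>

lemma has_derivative_sgn_mult:
  fixes f :: "real \<Rightarrow> real"
  assumes "(f has_real_derivative D) (at x)" "x \<noteq> 0"
  shows "((\<lambda>x. sgn x * f x) has_real_derivative sgn x * D) (at x)"
proof (rule has_field_derivative_transform_within_open[where S = "if x > 0 then {0<..} else {..<0}" and f = "\<lambda>y. sgn x * f y"])
  show "((\<lambda>y. sgn x * f y) has_real_derivative sgn x * D) (at x)"
    using assms by (auto intro!: derivative_eq_intros)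
qed (use assms in \<open>auto simp: sgn_if split: if_splits\<close>)

lemma L_witness_comp_ext_0:
  "L_witness 0 (comp_ext 0) (\<lambda>x. 2 / (1 + x\<^sup>2)\<^sup>2) (\<lambda>x. - 8 * x * \<bar>x\<bar> / (1 + x\<^sup>2) ^ 3)"
  unfolding L_witness_def continuous_extension_def
proof (intro conjI allI impI)
  fix x :: real assume x: "x \<noteq> 0"
  have "deriv (comp_ext 0) x = sgn x * (2 * x / (1 + x\<^sup>2)\<^sup>2)"
    unfolding comp_ext_def using has_derivative_sgn_mult[OF comp_fun_deriv x]
    by (auto intro!: DERIV_imp_deriv)
  moreover have "\<bar>x\<bar> powr (0 - 1) = 1 / \<bar>x\<bar>"
    using x by (simp add: powr_minus_divide)
  ultimately show "2 / (1 + x\<^sup>2)\<^sup>2 = deriv (comp_ext 0) x * \<bar>x\<bar> powr (0 - 1)"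
    using x by (auto simp: sgn_if)
  have "((\<lambda>x. 2 / (1 + x\<^sup>2)\<^sup>2) has_real_derivative - 8 * x / (1 + x\<^sup>2) ^ 3) (at x)"
  proof -
    have "((\<lambda>x. 2 / (1 + x\<^sup>2)\<^sup>2) has_real_derivative
      (0 * (1 + x\<^sup>2)\<^sup>2 - 2 * (2 * (1 + x\<^sup>2) * (2 * x))) / ((1 + x\<^sup>2)\<^sup>2 * (1 + x\<^sup>2)\<^sup>2)) (at x)"
      by (auto intro!: derivative_eq_intros)
    also have "(0 * (1 + x\<^sup>2)\<^sup>2 - 2 * (2 * (1 + x\<^sup>2) * (2 * x))) / ((1 + x\<^sup>2)\<^sup>2 * (1 + x\<^sup>2)\<^sup>2) =
       ((1 + x\<^sup>2) * (- 8 * x)) / ((1 + x\<^sup>2) * (1 + x\<^sup>2) ^ 3)"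
      by (rule arg_cong2[where f="(/)"]) (simp_all add: algebra_simps power2_eq_square power3_eq_cube)
    also have "\<dots> = - 8 * x / (1 + x\<^sup>2) ^ 3"
      by (rule mult_divide_mult_cancel_left) simp
    finally show ?thesis .
  qed
  then have "deriv (\<lambda>x. 2 / (1 + x\<^sup>2)\<^sup>2) x = - 8 * x / (1 + x\<^sup>2) ^ 3"
    by (rule DERIV_imp_deriv)
  then show "- 8 * x * \<bar>x\<bar> / (1 + x\<^sup>2) ^ 3 = deriv (\<lambda>x. 2 / (1 + x\<^sup>2)\<^sup>2) x * \<bar>x\<bar> powr (1 - 0)"
    using x by simp
qed (auto intro!: continuous_intros)

text \<open>For \<delta> > 0 the weight turns the factor x of the derivative into sgn x *
  |x|^\<delta>, which tends to 0 at 0 from both sides; the even extension is therefore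
  admissible.\<close>

lemma L_witness_comp_ext_pos:
  assumes "0 < \<delta>"
  shows "L_witness \<delta> (comp_ext \<delta>) (\<lambda>x. 2 * (sgn x * \<bar>x\<bar> powr \<delta>) / (1 + x\<^sup>2)\<^sup>2)
    (\<lambda>x. 2 * \<delta> / (1 + x\<^sup>2)\<^sup>2 - 8 * x\<^sup>2 / (1 + x\<^sup>2) ^ 3)"
  unfolding L_witness_def continuous_extension_def
proof (intro conjI allI impI)
  have "continuous_on UNIV (\<lambda>x::real. sgn x * \<bar>x\<bar> powr \<delta>)"
  proof (rule continuous_on_eq)
    \<comment> \<open>Written as a difference of powers of the positive and the negative part, the
      function needs no case distinction at 0; continuity of such a power at base 0 requires the
      exponent to be positive.\<close>
    show "continuous_on UNIV (\<lambda>x::real. max 0 x powr \<delta> - max 0 (-x) powr \<delta>)"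
      using assms by (auto intro!: continuous_intros continuous_on_powr')
  qed (auto simp: sgn_if max_def)
  then show "continuous_on UNIV (\<lambda>x. 2 * (sgn x * \<bar>x\<bar> powr \<delta>) / (1 + x\<^sup>2)\<^sup>2)"
    by (auto intro!: continuous_intros)
  fix x :: real assume x: "x \<noteq> 0"
  have eq: "comp_ext \<delta> = comp_fun" using assms by (auto simp: comp_ext_def)
  have d: "deriv (comp_ext \<delta>) x = 2 * x / (1 + x\<^sup>2)\<^sup>2"
    unfolding eq by (rule DERIV_imp_deriv[OF comp_fun_deriv])
  have p: "\<bar>x\<bar> powr (\<delta> - 1) = \<bar>x\<bar> powr \<delta> / \<bar>x\<bar>"
    using x by (simp add: powr_diff)
  show "2 * (sgn x * \<bar>x\<bar> powr \<delta>) / (1 + x\<^sup>2)\<^sup>2 = deriv (comp_ext \<delta>) x * \<bar>x\<bar> powr (\<delta> - 1)"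
    unfolding d p using x by (simp add: sgn_if)
  have "((\<lambda>x. 2 * (sgn x * \<bar>x\<bar> powr \<delta>) / (1 + x\<^sup>2)\<^sup>2) has_real_derivative
      2 * \<delta> * \<bar>x\<bar> powr (\<delta> - 1) / (1 + x\<^sup>2)\<^sup>2 - 8 * \<bar>x\<bar> * \<bar>x\<bar> powr \<delta> / (1 + x\<^sup>2) ^ 3) (at x)"
  proof -
    have "0 < sgn x * x" using x by (simp add: sgn_if)
    from DERIV_powr[OF has_derivative_sgn_mult[OF DERIV_ident x] this DERIV_const, of \<delta>]
    have "((\<lambda>x. (sgn x * x) powr \<delta>) has_real_derivative
        (sgn x * x) powr \<delta> * (sgn x * \<delta> / (sgn x * x))) (at x)"
      by simp
    also have "(sgn x * x) powr \<delta> * (sgn x * \<delta> / (sgn x * x)) = \<delta> * \<bar>x\<bar> powr (\<delta> - 1) * sgn x"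
      using x by (auto simp: sgn_if powr_diff)
    finally have D1: "((\<lambda>x. \<bar>x\<bar> powr \<delta>) has_real_derivative \<delta> * \<bar>x\<bar> powr (\<delta> - 1) * sgn x) (at x)"
      by (simp add: abs_sgn mult_ac)
    have D2: "((\<lambda>x. sgn x * \<bar>x\<bar> powr \<delta>) has_real_derivative \<delta> * \<bar>x\<bar> powr (\<delta> - 1)) (at x)"
      using has_derivative_sgn_mult[OF D1 x] x by (simp add: sgn_if mult_ac split: if_splits)
    have "((\<lambda>x. 2 * (sgn x * \<bar>x\<bar> powr \<delta>) / (1 + x\<^sup>2)\<^sup>2) has_real_derivative
        ((2 * (\<delta> * \<bar>x\<bar> powr (\<delta> - 1))) * (1 + x\<^sup>2)\<^sup>2 - 2 * (sgn x * \<bar>x\<bar> powr \<delta>) * (2 * (1 + x\<^sup>2) * (2 * x)))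
        / ((1 + x\<^sup>2)\<^sup>2 * (1 + x\<^sup>2)\<^sup>2)) (at x)"
      by (rule DERIV_divide[OF DERIV_cmult[OF D2]]) (auto intro!: derivative_eq_intros)
    also have "((2 * (\<delta> * \<bar>x\<bar> powr (\<delta> - 1))) * (1 + x\<^sup>2)\<^sup>2 - 2 * (sgn x * \<bar>x\<bar> powr \<delta>) * (2 * (1 + x\<^sup>2) * (2 * x)))
        / ((1 + x\<^sup>2)\<^sup>2 * (1 + x\<^sup>2)\<^sup>2) =
       2 * \<delta> * \<bar>x\<bar> powr (\<delta> - 1) / (1 + x\<^sup>2)\<^sup>2 - 8 * \<bar>x\<bar> * \<bar>x\<bar> powr \<delta> / (1 + x\<^sup>2) ^ 3"
    proof -
      define q where "q = 1 + x\<^sup>2"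
      have q: "q > 0" unfolding q_def by (rule one_plus_square_pos)
      have s: "\<bar>x\<bar> = sgn x * x" by (simp add: abs_sgn mult.commute)
      \<comment> \<open>With \<open>A\<close> and \<open>B\<close> for the derivative and the value
        of sgn x * |x|^\<delta>, only an identity of rational functions in \<open>q\<close> is left;
        afterwards x * B becomes |x| * |x|^\<delta>.\<close>
      have "(2 * A * q\<^sup>2 - 2 * B * (2 * q * (2 * x))) / (q\<^sup>2 * q\<^sup>2) = 2 * A / q\<^sup>2 - 8 * (x * B) / q ^ 3" for A B
        using q by (simp add: field_simps power2_eq_square power3_eq_cube)
      from this[of "\<delta> * \<bar>x\<bar> powr (\<delta> - 1)" "sgn x * \<bar>x\<bar> powr \<delta>"]
      show ?thesis unfolding q_def[symmetric] using x
        by (auto simp: mult_ac s sgn_if split: if_splits)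
    qed
    finally show ?thesis .
  qed
  then have d2: "deriv (\<lambda>x. 2 * (sgn x * \<bar>x\<bar> powr \<delta>) / (1 + x\<^sup>2)\<^sup>2) x =
      2 * \<delta> * \<bar>x\<bar> powr (\<delta> - 1) / (1 + x\<^sup>2)\<^sup>2 - 8 * \<bar>x\<bar> * \<bar>x\<bar> powr \<delta> / (1 + x\<^sup>2) ^ 3"
    by (rule DERIV_imp_deriv)
  have p1: "\<bar>x\<bar> powr (\<delta> - 1) * \<bar>x\<bar> powr (1 - \<delta>) = 1" "\<bar>x\<bar> powr \<delta> * \<bar>x\<bar> powr (1 - \<delta>) = \<bar>x\<bar>"
    using x by (simp_all flip: powr_add)
  have "deriv (\<lambda>x. 2 * (sgn x * \<bar>x\<bar> powr \<delta>) / (1 + x\<^sup>2)\<^sup>2) x * \<bar>x\<bar> powr (1 - \<delta>) =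
     2 * \<delta> * (\<bar>x\<bar> powr (\<delta> - 1) * \<bar>x\<bar> powr (1 - \<delta>)) / (1 + x\<^sup>2)\<^sup>2
       - 8 * \<bar>x\<bar> * (\<bar>x\<bar> powr \<delta> * \<bar>x\<bar> powr (1 - \<delta>)) / (1 + x\<^sup>2) ^ 3"
    unfolding d2 by (simp add: algebra_simps diff_divide_distrib)
  also have "\<dots> = 2 * \<delta> / (1 + x\<^sup>2)\<^sup>2 - 8 * x\<^sup>2 / (1 + x\<^sup>2) ^ 3"
    unfolding p1 by (simp add: power2_eq_square)
  finally show "2 * \<delta> / (1 + x\<^sup>2)\<^sup>2 - 8 * x\<^sup>2 / (1 + x\<^sup>2) ^ 3 =
     deriv (\<lambda>x. 2 * (sgn x * \<bar>x\<bar> powr \<delta>) / (1 + x\<^sup>2)\<^sup>2) x * \<bar>x\<bar> powr (1 - \<delta>)" by simp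
qed (auto intro!: continuous_intros)

lemma comp_ext_in_D_L:
  assumes "0 \<le> \<delta>"
  shows "comp_ext \<delta> \<in> D_L \<delta>"
proof -
  have p: "C_class_on 2 (comp_ext \<delta>) {0..}"
    by (rule C_class_on_comp_fun[where c = 1]) (auto simp: comp_ext_def comp_fun_def sgn_if)
  have n: "C_class_on 2 (comp_ext \<delta>) {..0}"
    by (rule C_class_on_comp_fun[where c = "if \<delta> = 0 then -1 else 1"])
       (auto simp: comp_ext_def comp_fun_def sgn_if)
  have c: "continuous_on UNIV (comp_ext \<delta>)"
  proof (rule continuous_on_eq)
    show "continuous_on UNIV (\<lambda>x::real. if \<delta> = 0 then x * \<bar>x\<bar> / (1 + x\<^sup>2) else x\<^sup>2 / (1 + x\<^sup>2))"
      by (cases "\<delta> = 0") (auto intro!: continuous_intros)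
  qed (auto simp: comp_ext_def comp_fun_def sgn_if power2_eq_square)
  have "\<exists>g G. L_witness \<delta> (comp_ext \<delta>) g G"
    using L_witness_comp_ext_0 L_witness_comp_ext_pos[of \<delta>] assms by (cases "\<delta> = 0") auto
  with p n c show ?thesis by (simp add: D_L_def)
qed

text \<open>The coefficients of the equation of \<open>Y = comp_fun X\<close> as functions of \<open>Y\<close>: in terms of
  \<open>1 - y = 1 / (1 + x\<^sup>2)\<close> one has \<open>f' x = 2 * x * (1 - y)\<^sup>2\<close> and \<open>x\<^sup>2 * (1 - y) = y\<close>.\<close>

definition drift :: "real \<Rightarrow> real \<Rightarrow> real" where
  "drift \<delta> y = \<delta> * (1 - y)\<^sup>2 - 4 * y * (1 - y)\<^sup>2"

definition diffusion :: "real \<Rightarrow> real" where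
  "diffusion y = 2 * sqrt (y * (1 - y) ^ 3)"

lemma comp_fun_bounds: "0 \<le> comp_fun x" "comp_fun x < 1"
  using one_plus_square_pos[of x] by (simp_all add: comp_fun_def)

lemma one_minus_comp_fun: "1 - comp_fun x = 1 / (1 + x\<^sup>2)"
  by (simp add: comp_fun_def field_simps)

lemma comp_fun_inj:
  assumes "x \<ge> 0" "y \<ge> 0" "comp_fun x = comp_fun y"
  shows "x = y"
proof -
  have "inverse (1 + x\<^sup>2) = inverse (1 + y\<^sup>2)"
    using one_minus_comp_fun[of x] one_minus_comp_fun[of y] assms(3)
    unfolding inverse_eq_divide by metis
  then have "1 + x\<^sup>2 = 1 + y\<^sup>2" unfolding inverse_eq_iff_eq .
  with assms show ?thesis by (simp add: power2_eq_iff_nonneg)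
qed

lemma L_half_comp_ext:
  assumes "0 \<le> \<delta>" "0 \<le> x"
  shows "L_half \<delta> (restrict (comp_ext \<delta>) {0..}) x = drift \<delta> (comp_fun x)"
proof -
  have "L_half \<delta> (restrict (comp_ext \<delta>) {0..}) x = L_op \<delta> (comp_ext \<delta>) x"
    by (rule L_half_restrict) (use assms comp_ext_in_D_L in auto)
  also have "\<dots> = \<delta> / (1 + x\<^sup>2)\<^sup>2 - 4 * x\<^sup>2 / (1 + x\<^sup>2) ^ 3"
  proof (cases "\<delta> = 0")
    case True
    then show ?thesis
      using L_op_eq[OF L_witness_comp_ext_0] assms by (simp add: power2_eq_square)
  next
    case False
    then show ?thesis
      using L_op_eq[OF L_witness_comp_ext_pos[of \<delta>]] assms by (simp add: diff_divide_distrib)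
  qed
  also have "\<dots> = drift \<delta> (comp_fun x)"
    unfolding drift_def one_minus_comp_fun
    by (simp add: comp_fun_def power_divide power2_eq_square power3_eq_cube)
  finally show ?thesis .
qed

lemma deriv_half_comp_ext:
  assumes "0 \<le> x"
  shows "deriv_half (restrict (comp_ext \<delta>) {0..}) x = diffusion (comp_fun x)"
proof -
  have "((\<lambda>x. comp_fun x) has_vector_derivative 2 * x / (1 + x\<^sup>2)\<^sup>2) (at x within {0..})"
    using comp_fun_deriv[of x "{0..}"] by (simp add: has_real_derivative_iff_has_vector_derivative)
  then have "(restrict (comp_ext \<delta>) {0..} has_vector_derivative 2 * x / (1 + x\<^sup>2)\<^sup>2) (at x within {0..})"
    by (rule has_vector_derivative_transform[rotated 2])
       (use assms in \<open>auto simp: comp_ext_def comp_fun_def sgn_if\<close>)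
  then have "deriv_half (restrict (comp_ext \<delta>) {0..}) x = 2 * x / (1 + x\<^sup>2)\<^sup>2"
    unfolding deriv_half_def
  proof (rule vector_derivative_within[rotated])
    \<comment> \<open>Points of the interval from x to x + 1 accumulate at x, also for x = 0, so the
      one-sided derivative is uniquely determined.\<close>
    have "at x within {0..} \<noteq> bot"
      using islimpt_subset[OF islimpt_greaterThanLessThan1, of x "x + 1" "{0..}"] assms
      by (simp add: trivial_limit_within subset_iff)
    then show "at x within {0..} \<noteq> bot" .
  qed
  also have "\<dots> = diffusion (comp_fun x)"
  proof -
    have e: "x\<^sup>2 / (1 + x\<^sup>2) * (1 / (1 + x\<^sup>2)) ^ 3 = (x / (1 + x\<^sup>2)\<^sup>2)\<^sup>2"
      by (simp add: power_divide power2_eq_square power3_eq_cube)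
    show ?thesis unfolding diffusion_def one_minus_comp_fun unfolding comp_fun_def e
      using assms by simp
  qed
  finally show ?thesis .
qed

section \<open>Regularity of the coefficients on the unit interval\<close>

lemma sqrt_diff_square_le:
  assumes "0 \<le> p" "0 \<le> q"
  shows "(sqrt p - sqrt q)\<^sup>2 \<le> \<bar>p - q\<bar>"
proof -
  have "(sqrt p - sqrt q)\<^sup>2 = \<bar>sqrt p - sqrt q\<bar> * \<bar>sqrt p - sqrt q\<bar>"
    by (simp add: power2_eq_square)
  also have "\<dots> \<le> \<bar>sqrt p - sqrt q\<bar> * (sqrt p + sqrt q)"
    by (intro mult_left_mono) (use real_sqrt_ge_zero[OF assms(1)] real_sqrt_ge_zero[OF assms(2)] in linarith, simp)
  also have "\<dots> = \<bar>(sqrt p - sqrt q) * (sqrt p + sqrt q)\<bar>"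
    using assms by (simp add: abs_mult)
  also have "(sqrt p - sqrt q) * (sqrt p + sqrt q) = p - q"
    using assms by (simp add: algebra_simps)
  finally show ?thesis .
qed

text \<open>The radicand is a polynomial and Lipschitz; the root halves the order, and no better
  order holds at y = 0. The constant 16 is the square of the factor 2 in \<open>diffusion\<close>
  times the Lipschitz constant 4 of the radicand: the second factor below is a number in {0..1}
  minus a number in {0..3}.\<close>

lemma diffusion_holder:
  assumes "x \<in> {0..1}" "y \<in> {0..1}"
  shows "(diffusion x - diffusion y)\<^sup>2 \<le> 16 * \<bar>x - y\<bar>"
proof -
  have "(diffusion x - diffusion y)\<^sup>2 = 4 * (sqrt (x * (1 - x) ^ 3) - sqrt (y * (1 - y) ^ 3))\<^sup>2"
    by (simp add: diffusion_def power2_eq_square algebra_simps)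
  also have "\<dots> \<le> 4 * \<bar>x * (1 - x) ^ 3 - y * (1 - y) ^ 3\<bar>"
    using sqrt_diff_square_le[of "x * (1 - x) ^ 3" "y * (1 - y) ^ 3"] assms by simp
  also have "x * (1 - x) ^ 3 - y * (1 - y) ^ 3 =
      (x - y) * ((1 - x) ^ 3 - y * ((1 - x)\<^sup>2 + (1 - x) * (1 - y) + (1 - y)\<^sup>2))"
    by (simp add: algebra_simps power2_eq_square power3_eq_cube)
  also have "\<bar>\<dots>\<bar> = \<bar>x - y\<bar> * \<bar>(1 - x) ^ 3 - y * ((1 - x)\<^sup>2 + (1 - x) * (1 - y) + (1 - y)\<^sup>2)\<bar>"
    by (simp add: abs_mult)
  also have "\<dots> \<le> \<bar>x - y\<bar> * 4"
  proof (intro mult_left_mono)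
    have 1: "0 \<le> (1 - x) ^ 3" "(1 - x) ^ 3 \<le> 1" "(1 - x)\<^sup>2 \<le> 1" "(1 - y)\<^sup>2 \<le> 1" "(1 - x) * (1 - y) \<le> 1"
      using assms by (auto intro!: power_le_one mult_le_one)
    have 2: "0 \<le> (1 - x)\<^sup>2 + (1 - x) * (1 - y) + (1 - y)\<^sup>2"
      using assms by auto
    have "y * ((1 - x)\<^sup>2 + (1 - x) * (1 - y) + (1 - y)\<^sup>2) \<le> 1 * 3"
      using assms 1 2 by (intro mult_mono) auto
    moreover have "0 \<le> y * ((1 - x)\<^sup>2 + (1 - x) * (1 - y) + (1 - y)\<^sup>2)"
      using assms 2 by auto
    ultimately show "\<bar>(1 - x) ^ 3 - y * ((1 - x)\<^sup>2 + (1 - x) * (1 - y) + (1 - y)\<^sup>2)\<bar> \<le> 4"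
      using 1 by linarith
  qed simp
  finally show ?thesis by simp
qed

text \<open>The difference quotient is an explicit polynomial with three terms of size at most 8, 2
  and 4, which add up to 14.\<close>

lemma drift_lipschitz:
  assumes "x \<in> {0..1}" "y \<in> {0..1}" "0 \<le> \<delta>" "\<delta> \<le> 1"
  shows "\<bar>drift \<delta> x - drift \<delta> y\<bar> \<le> 14 * \<bar>x - y\<bar>"
proof -
  have "drift \<delta> x - drift \<delta> y = (x - y) * (4 * y * ((1 - x) + (1 - y)) - \<delta> * ((1 - x) + (1 - y)) - 4 * (1 - x)\<^sup>2)"
    by (simp add: drift_def algebra_simps power2_eq_square)
  also have "\<bar>\<dots>\<bar> = \<bar>x - y\<bar> * \<bar>4 * y * ((1 - x) + (1 - y)) - \<delta> * ((1 - x) + (1 - y)) - 4 * (1 - x)\<^sup>2\<bar>"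
    by (simp add: abs_mult)
  also have "\<dots> \<le> \<bar>x - y\<bar> * 14"
  proof (intro mult_left_mono)
    have "0 \<le> y * ((1 - x) + (1 - y))"
      using assms by simp
    moreover have "y * ((1 - x) + (1 - y)) \<le> 1 * 2"
      by (rule mult_mono) (use assms in auto)
    moreover have "0 \<le> \<delta> * ((1 - x) + (1 - y))"
      using assms by simp
    moreover have "\<delta> * ((1 - x) + (1 - y)) \<le> 1 * 2"
      by (rule mult_mono) (use assms in auto)
    moreover have "0 \<le> (1 - x)\<^sup>2" "(1 - x)\<^sup>2 \<le> 1" using assms by (auto intro!: power_le_one)
    ultimately show "\<bar>4 * y * ((1 - x) + (1 - y)) - \<delta> * ((1 - x) + (1 - y)) - 4 * (1 - x)\<^sup>2\<bar> \<le> 14"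
      by linarith
  qed simp
  finally show ?thesis by simp
qed

section \<open>Brownian motion relative to its canonical filtration\<close>

text \<open>This lets \<open>q\<close> tend to 0 in an estimate. In the witness, the denominator c +
  1 also covers c = 0.\<close>

lemma nonpos_if_le_small_multiple:
  fixes x c q0 :: real
  assumes "q0 > 0" "c \<ge> 0" and le: "\<And>q. 0 < q \<Longrightarrow> q < q0 \<Longrightarrow> x \<le> c * q"
  shows "x \<le> 0"
proof (rule ccontr)
  assume x: "\<not> x \<le> 0"
  define q where "q = min (q0 / 2) (x / (2 * (c + 1)))"
  have q: "0 < q" "q < q0" using x assms by (auto simp: q_def)
  have "x \<le> c * q" by (rule le[OF q])
  also have "\<dots> \<le> c * (x / (2 * (c + 1)))"
    using assms by (intro mult_left_mono) (auto simp: q_def)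
  also have "\<dots> < x" using x assms by (simp add: field_simps add_nonneg_pos)
  finally show False by simp
qed

lemma has_bochner_integral_completion:
  fixes f :: "'a \<Rightarrow> 'b::{banach, second_countable_topology}"
  assumes "f \<in> borel_measurable M" "has_bochner_integral M f x"
  shows "has_bochner_integral (completion M) f x"
  using assms integrable_completion[OF assms(1)] integral_completion[OF assms(1)]
  by (simp add: has_bochner_integral_iff)

text \<open>Independence of an increment from the past is recorded only through its first two
  conditional moments, tested on events. The fourth moment controls the third-order remainder of the
  Taylor expansion. In the application \<open>N\<close> is the completion of the given space, since
  the augmented filtration contains its null sets.\<close>

locale brownian_filtration = prob_space N for N :: "'a measure" +
  fixes F :: "real \<Rightarrow> 'a measure" and T :: real and W :: "real \<Rightarrow> 'a \<Rightarrow> real"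
  assumes subalg: "0 \<le> t \<Longrightarrow> t \<le> T \<Longrightarrow> subalgebra N (F t)"
    and F_mono: "0 \<le> s \<Longrightarrow> s \<le> t \<Longrightarrow> t \<le> T \<Longrightarrow> sets (F s) \<subseteq> sets (F t)"
    and W_adapted: "0 \<le> t \<Longrightarrow> t \<le> T \<Longrightarrow> W t \<in> borel_measurable (F t)"
    and W_fourth: "0 \<le> s \<Longrightarrow> s < t \<Longrightarrow> t \<le> T \<Longrightarrow>
          has_bochner_integral N (\<lambda>\<omega>. (W t \<omega> - W s \<omega>) ^ 4) (3 * (t - s)\<^sup>2)"
    and W_first: "0 \<le> s \<Longrightarrow> s < t \<Longrightarrow> t \<le> T \<Longrightarrow> A \<in> sets (F s) \<Longrightarrow>
          (\<integral>\<omega>. indicator A \<omega> * (W t \<omega> - W s \<omega>) \<partial>N) = 0"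
    and W_second: "0 \<le> s \<Longrightarrow> s < t \<Longrightarrow> t \<le> T \<Longrightarrow> A \<in> sets (F s) \<Longrightarrow>
          (\<integral>\<omega>. indicator A \<omega> * (W t \<omega> - W s \<omega>)\<^sup>2 \<partial>N) = (t - s) * measure N A"

context
  fixes M :: "'a measure" and T :: real and W :: "real \<Rightarrow> 'a \<Rightarrow> real"
  assumes bm: "brownian_motion M T W"
begin

interpretation M: prob_space M using bm by (simp add: brownian_motion_def)
interpretation N: prob_space "completion M" by (rule M.prob_space_completion)

lemma W_measurable: "0 \<le> t \<Longrightarrow> t \<le> T \<Longrightarrow> W t \<in> borel_measurable M"
  using bm by (simp add: brownian_motion_def)

lemma past_events_subset: "t \<le> T \<Longrightarrow> past_events M W t \<subseteq> sets M"
  unfolding past_events_def using W_measurable by (fastforce intro: measurable_sets)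

lemma past_events_Pow: "past_events M W t \<subseteq> Pow (space M)"
  unfolding past_events_def by auto

lemma augmented_past_Pow: "past_events M W t \<union> null_sets (completion M) \<subseteq> Pow (space M)"
  using past_events_Pow sets.sets_into_space[of _ "completion M"] by fastforce

lemma sets_canonical_filtration:
  "sets (canonical_filtration M T W t) = sigma_sets (space M)
     (\<Inter>s\<in>{t<..}. sigma_sets (space M) (past_events M W (min s T) \<union> null_sets (completion M)))"
  unfolding canonical_filtration_def
proof (rule sets_measure_of)
  have "(\<Inter>s\<in>{t<..}. sigma_sets (space M) (past_events M W (min s T) \<union> null_sets (completion M)))
     \<subseteq> sigma_sets (space M) (past_events M W (min (t + 1) T) \<union> null_sets (completion M))"
    by (rule INT_lower) simp
  also have "\<dots> \<subseteq> Pow (space M)"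
    using sigma_sets_into_sp[OF augmented_past_Pow] by blast
  finally show "(\<Inter>s\<in>{t<..}. sigma_sets (space M) (past_events M W (min s T) \<union> null_sets (completion M)))
     \<subseteq> Pow (space M)" .
qed

lemma space_canonical_filtration: "space (canonical_filtration M T W t) = space M"
  unfolding canonical_filtration_def by (rule space_measure_of_conv)

lemma sets_canonical_filtration_subset:
  assumes "t < s"
  shows "sets (canonical_filtration M T W t) \<subseteq>
    sigma_sets (space M) (past_events M W (min s T) \<union> null_sets (completion M))"
  unfolding sets_canonical_filtration
  by (rule sigma_sets_mono) (use assms in auto)

lemma subalgebra_canonical_filtration: "subalgebra (completion M) (canonical_filtration M T W t)"
  unfolding subalgebra_def
proof
  have "sigma_sets (space (completion M)) (past_events M W (min (t + 1) T) \<union> null_sets (completion M))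
      \<subseteq> sets (completion M)"
    using past_events_subset[of "min (t + 1) T"] by (intro sets.sigma_sets_subset) auto
  with sets_canonical_filtration_subset[of t "t + 1"]
  show "sets (canonical_filtration M T W t) \<subseteq> sets (completion M)" by simp
qed (simp add: space_canonical_filtration)

lemma canonical_filtration_mono:
  "s \<le> t \<Longrightarrow> sets (canonical_filtration M T W s) \<subseteq> sets (canonical_filtration M T W t)"
  unfolding sets_canonical_filtration by (intro sigma_sets_subseteq INT_anti_mono) auto

lemma W_adapted_canonical:
  assumes "0 \<le> t" "t \<le> T"
  shows "W t \<in> borel_measurable (canonical_filtration M T W t)"
proof (rule measurableI)
  fix B :: "real set" assume B: "B \<in> sets borel"
  have "W t -` B \<inter> space M \<in> past_events M W (min s T)" if "t < s" for s
    unfolding past_events_def using assms that B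
    by (intro CollectI exI[of _ t] exI[of _ B]) auto
  then show "W t -` B \<inter> space (canonical_filtration M T W t) \<in> sets (canonical_filtration M T W t)"
    unfolding sets_canonical_filtration space_canonical_filtration
    by (intro sigma_sets.Basic INT_I) (auto intro: sigma_sets.Basic)
qed simp

text \<open>The sets that agree almost surely with an event of the raw past form a sigma-algebra
  containing both kinds of generators, a null set being matched with the empty set. This carries
  independence from the raw past over to the augmented one.\<close>

lemma augmented_past_AE:
  assumes "A \<in> sigma_sets (space M) (past_events M W u \<union> null_sets (completion M))"
  shows "\<exists>A'\<in>sigma_sets (space M) (past_events M W u). AE \<omega> in M. \<omega> \<in> A \<longleftrightarrow> \<omega> \<in> A'"
  using assms
proof induction
  case (Basic A)
  then show ?case
  proof
    assume "A \<in> null_sets (completion M)"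
    then have "AE \<omega> in completion M. \<omega> \<notin> A" by (rule AE_not_in)
    then have "AE \<omega> in M. \<omega> \<notin> A" by (simp add: AE_completion_iff)
    then show ?thesis by (intro bexI[of _ "{}"] sigma_sets.Empty) auto
  qed (auto intro: sigma_sets.Basic)
next
  case Empty
  show ?case by (intro bexI[of _ "{}"] sigma_sets.Empty) auto
next
  case (Compl A)
  then obtain A' where A': "A' \<in> sigma_sets (space M) (past_events M W u)" "AE \<omega> in M. \<omega> \<in> A \<longleftrightarrow> \<omega> \<in> A'"
    by blast
  then show ?case by (intro bexI[of _ "space M - A'"] sigma_sets.Compl) auto
next
  case (Union A)
  then have "\<exists>A'. \<forall>i. A' i \<in> sigma_sets (space M) (past_events M W u) \<and> (AE \<omega> in M. \<omega> \<in> A i \<longleftrightarrow> \<omega> \<in> A' i)"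
    by (intro choice) blast
  then obtain A' where A': "\<And>i. A' i \<in> sigma_sets (space M) (past_events M W u)"
      "\<And>i. AE \<omega> in M. \<omega> \<in> A i \<longleftrightarrow> \<omega> \<in> A' i" by blast
  have "AE \<omega> in M. \<forall>i::nat. \<omega> \<in> A i \<longleftrightarrow> \<omega> \<in> A' i"
    using A'(2) by (simp add: AE_all_countable)
  then have "AE \<omega> in M. \<omega> \<in> \<Union>(range A) \<longleftrightarrow> \<omega> \<in> \<Union>(range A')"
    by eventually_elim auto
  then show ?case using A'(1) by (intro bexI[of _ "\<Union>(range A')"] sigma_sets.Union) auto
qed

lemma W_increment_moments:
  assumes "0 \<le> s" "s < t" "t \<le> T"
  shows "has_bochner_integral M (\<lambda>\<omega>. W t \<omega> - W s \<omega>) 0"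
    and "has_bochner_integral M (\<lambda>\<omega>. (W t \<omega> - W s \<omega>)\<^sup>2) (t - s)"
    and "has_bochner_integral M (\<lambda>\<omega>. (W t \<omega> - W s \<omega>) ^ 4) (3 * (t - s)\<^sup>2)"
proof -
  have D: "distributed M lborel (\<lambda>\<omega>. W t \<omega> - W s \<omega>) (normal_density 0 (sqrt (t - s)))"
    using bm assms by (simp add: brownian_motion_def)
  have pos: "0 < sqrt (t - s)" using assms by simp
  have *: "has_bochner_integral M (\<lambda>\<omega>. g (W t \<omega> - W s \<omega>)) m"
    if "has_bochner_integral lborel (\<lambda>x. normal_density 0 (sqrt (t - s)) x * g x) m"
      "g \<in> borel_measurable borel" for g m
    using that distributed_integrable[OF D, of g] distributed_integral[OF D, of g]
    by (auto simp: has_bochner_integral_iff)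
  show "has_bochner_integral M (\<lambda>\<omega>. W t \<omega> - W s \<omega>) 0"
    using normal_moment_odd[OF pos, of 0 0] by (intro *) simp_all
  show "has_bochner_integral M (\<lambda>\<omega>. (W t \<omega> - W s \<omega>)\<^sup>2) (t - s)"
    using normal_moment_even[OF pos, of 0 1] assms by (intro *) (simp_all add: diff_divide_distrib)
  show "has_bochner_integral M (\<lambda>\<omega>. (W t \<omega> - W s \<omega>) ^ 4) (3 * (t - s)\<^sup>2)"
  proof -
    have "fact (2 * 2) / ((2 / (sqrt (t - s))\<^sup>2)\<^sup>2 * fact 2) = 3 * (t - s)\<^sup>2"
      using assms by (simp add: fact_numeral power_divide)
    with normal_moment_even[OF pos, of 0 2] show ?thesis by (intro *) simp_all
  qed
qed

text \<open>The indicator of a past event and the increment are independent random variables, so the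
  expectation of the product factorises. The definition of Brownian motion speaks of families of
  events, and most of the proof converts this into independence of the two variables.\<close>

lemma past_increment_expectation:
  fixes g :: "real \<Rightarrow> real"
  assumes st: "0 \<le> s" "s < t" "t \<le> T" and A: "A \<in> sigma_sets (space M) (past_events M W s)"
    and g: "g \<in> borel_measurable borel" "integrable M (\<lambda>\<omega>. g (W t \<omega> - W s \<omega>))"
  shows "(\<integral>\<omega>. indicator A \<omega> * g (W t \<omega> - W s \<omega>) \<partial>M) = measure M A * (\<integral>\<omega>. g (W t \<omega> - W s \<omega>) \<partial>M)"
proof -
  define E2 where "E2 = {(\<lambda>\<omega>. W t \<omega> - W s \<omega>) -` B \<inter> space M | B. B \<in> sets borel}"
  have ind: "M.indep_set (sigma_sets (space M) (past_events M W s)) E2"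
    using bm st unfolding brownian_motion_def E2_def by blast
  have Am: "A \<in> sets M"
    using A sets.sigma_sets_subset[OF past_events_subset[of s]] st by auto
  have [measurable]: "(\<lambda>\<omega>. W t \<omega> - W s \<omega>) \<in> borel_measurable M"
    using W_measurable[of t] W_measurable[of s] st by simp
  have st1: "Int_stable (sigma_sets (space M) (past_events M W s))"
  proof -
    interpret S: sigma_algebra "space M" "sigma_sets (space M) (past_events M W s)"
      by (rule sigma_algebra_sigma_sets[OF past_events_Pow])
    show ?thesis by (auto simp: Int_stable_def)
  qed
  have st2: "Int_stable E2"
    unfolding Int_stable_def E2_def
  proof safe
    fix B C :: "real set" assume "B \<in> sets borel" "C \<in> sets borel"
    then show "\<exists>D. ((\<lambda>\<omega>. W t \<omega> - W s \<omega>) -` B \<inter> space M) \<inter> ((\<lambda>\<omega>. W t \<omega> - W s \<omega>) -` C \<inter> space M) =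
        (\<lambda>\<omega>. W t \<omega> - W s \<omega>) -` D \<inter> space M \<and> D \<in> sets borel"
      by (intro exI[of _ "B \<inter> C"]) auto
  qed
  \<comment> \<open>Both families are stable under intersection, so independence passes to the
    generated sigma-algebras.\<close>
  have ind2: "M.indep_set (sigma_sets (space M) (past_events M W s)) (sigma_sets (space M) E2)"
    using M.indep_set_sigma_sets[OF ind st1 st2] by (simp add: sigma_sets_sigma_sets_eq[OF past_events_Pow])
  have sub: "sigma_sets (space M) {indicator A -` B \<inter> space M | B :: real set. B \<in> sets borel}
      \<subseteq> sigma_sets (space M) (past_events M W s)"
  proof (rule sigma_sets_mono, safe)
    fix B :: "real set" assume "B \<in> sets borel"
    have sp: "A \<subseteq> space M" using Am by (rule sets.sets_into_space)
    \<comment> \<open>An indicator has only the values 0 and 1, so a preimage depends only on which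
      of them lie in \<open>B\<close>, and all four outcomes are past events.\<close>
    have "indicator A -` B \<inter> space M =
       (if 0 \<in> B then if 1 \<in> B then space M else space M - A else if 1 \<in> B then A else {})"
      using sp by (auto simp: indicator_def of_bool_def split: if_splits)
    then show "indicator A -` B \<inter> space M \<in> sigma_sets (space M) (past_events M W s)"
      using A by (auto intro: sigma_sets.Empty sigma_sets.Compl sigma_sets_top)
  qed
  have "M.indep_var borel (indicator A :: 'a \<Rightarrow> real) borel (\<lambda>\<omega>. W t \<omega> - W s \<omega>)"
    unfolding M.indep_var_eq
  proof (intro conjI M.indep_setI)
    show "M.random_variable borel (indicator A :: 'a \<Rightarrow> real)" using Am by simp
    show "sigma_sets (space M) {indicator A -` B \<inter> space M | B :: real set. B \<in> sets borel} \<subseteq> M.events"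
      using sub ind2 by (auto simp: M.indep_set_def M.indep_sets_def split: bool.splits)
    show "sigma_sets (space M) {(\<lambda>\<omega>. W t \<omega> - W s \<omega>) -` A \<inter> space M |A. A \<in> sets borel} \<subseteq> M.events"
      by (rule sets.sigma_sets_subset) auto
    fix a b assume "a \<in> sigma_sets (space M) {indicator A -` B \<inter> space M | B :: real set. B \<in> sets borel}"
      "b \<in> sigma_sets (space M) {(\<lambda>\<omega>. W t \<omega> - W s \<omega>) -` A \<inter> space M |A. A \<in> sets borel}"
    with sub show "M.prob (a \<inter> b) = M.prob a * M.prob b"
      using M.indep_setD[OF ind2] by (auto simp: E2_def)
  qed simp
  then have "M.indep_var borel ((\<lambda>x. x) \<circ> (indicator A :: 'a \<Rightarrow> real)) borel (g \<circ> (\<lambda>\<omega>. W t \<omega> - W s \<omega>))"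
    by (rule M.indep_var_compose) (use g in auto)
  then have "M.indep_var borel (indicator A :: 'a \<Rightarrow> real) borel (\<lambda>\<omega>. g (W t \<omega> - W s \<omega>))"
    by (simp add: comp_def)
  then have "(\<integral>\<omega>. indicator A \<omega> * g (W t \<omega> - W s \<omega>) \<partial>M) =
      (\<integral>\<omega>. indicator A \<omega> \<partial>M) * (\<integral>\<omega>. g (W t \<omega> - W s \<omega>) \<partial>M)"
    by (rule M.indep_var_lebesgue_integral)
       (use Am g in \<open>auto intro!: integrable_real_indicator simp: M.emeasure_eq_measure\<close>)
  then show ?thesis using Am by simp
qed

text \<open>Replacing the event by an almost surely equal one from the raw past changes neither
  side.\<close>

lemma augmented_increment_expectation:
  fixes g :: "real \<Rightarrow> real"
  assumes st: "0 \<le> s" "s < t" "t \<le> T"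
    and A: "A \<in> sigma_sets (space M) (past_events M W s \<union> null_sets (completion M))"
    and g: "g \<in> borel_measurable borel" "has_bochner_integral M (\<lambda>\<omega>. g (W t \<omega> - W s \<omega>)) m"
  shows "(\<integral>\<omega>. indicator A \<omega> * g (W t \<omega> - W s \<omega>) \<partial>completion M) = m * measure (completion M) A"
proof -
  obtain A' where A': "A' \<in> sigma_sets (space M) (past_events M W s)" "AE \<omega> in M. \<omega> \<in> A \<longleftrightarrow> \<omega> \<in> A'"
    using augmented_past_AE[OF A] by blast
  have AN: "A \<in> sets (completion M)"
    using A sets.sigma_sets_subset[of "past_events M W s \<union> null_sets (completion M)" "completion M"]
      past_events_subset[of s] st by auto
  have A'M: "A' \<in> sets M"
    using A' sets.sigma_sets_subset[OF past_events_subset[of s]] st by auto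
  have [measurable]: "W t \<in> borel_measurable M" "W s \<in> borel_measurable M"
    using W_measurable st by auto
  note [measurable] = g(1) A'M
  have gm: "(\<lambda>\<omega>. g (W t \<omega> - W s \<omega>)) \<in> borel_measurable M" by measurable
  note gN = measurable_completion[OF gm]
  have AE: "AE \<omega> in completion M. \<omega> \<in> A \<longleftrightarrow> \<omega> \<in> A'"
    using A'(2) by (rule AE_completion)
  have "(\<integral>\<omega>. indicator A \<omega> * g (W t \<omega> - W s \<omega>) \<partial>completion M) =
      (\<integral>\<omega>. indicator A' \<omega> * g (W t \<omega> - W s \<omega>) \<partial>completion M)"
  proof (rule integral_cong_AE)
    show "AE \<omega> in completion M. indicator A \<omega> * g (W t \<omega> - W s \<omega>) = indicator A' \<omega> * g (W t \<omega> - W s \<omega>)"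
      using AE by eventually_elim (auto simp: indicator_def)
  qed (use gN AN A'M in \<open>auto intro!: borel_measurable_times borel_measurable_indicator\<close>)
  also have "\<dots> = (\<integral>\<omega>. indicator A' \<omega> * g (W t \<omega> - W s \<omega>) \<partial>M)"
    by (rule integral_completion) (use gm A'M in \<open>auto intro!: borel_measurable_times borel_measurable_indicator\<close>)
  also have "\<dots> = measure M A' * m"
    using past_increment_expectation[OF st A'(1) g(1)] g(2) by (simp add: has_bochner_integral_iff)
  also have "measure M A' = measure (completion M) A"
  proof -
    have "measure (completion M) A = measure (completion M) A'"
      by (rule measure_eq_AE) (use AE AN A'M in auto)
    then show ?thesis using A'M by simp
  qed
  finally show ?thesis by simp
qed

text \<open>An event of the right-continuous \<open>\<sigma>\<close>-algebra at time \<open>s\<close> is independent of \<open>W t - W u\<close> for every \<open>u\<close> in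
  \<open>{s<..<t}\<close>; let \<open>u = s + q\<^sup>2\<close> tend to \<open>s\<close>.\<close>

lemma brownian_filtration_canonical:
  "brownian_filtration (completion M) (canonical_filtration M T W) T W"
proof unfold_locales
  fix s t :: real and A assume st: "0 \<le> s" "s < t" "t \<le> T"
  let ?N = "completion M"
  have inc: "has_bochner_integral ?N (\<lambda>\<omega>. W v \<omega> - W u \<omega>) 0"
    "has_bochner_integral ?N (\<lambda>\<omega>. (W v \<omega> - W u \<omega>)\<^sup>2) (v - u)"
    "has_bochner_integral ?N (\<lambda>\<omega>. (W v \<omega> - W u \<omega>) ^ 4) (3 * (v - u)\<^sup>2)"
    if "0 \<le> u" "u < v" "v \<le> T" for u v
  proof -
    have [measurable]: "W u \<in> borel_measurable M" "W v \<in> borel_measurable M"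
      using W_measurable that by auto
    note * = W_increment_moments[OF that]
    show "has_bochner_integral ?N (\<lambda>\<omega>. W v \<omega> - W u \<omega>) 0"
      by (rule has_bochner_integral_completion[OF _ *(1)]) measurable
    show "has_bochner_integral ?N (\<lambda>\<omega>. (W v \<omega> - W u \<omega>)\<^sup>2) (v - u)"
      by (rule has_bochner_integral_completion[OF _ *(2)]) measurable
    show "has_bochner_integral ?N (\<lambda>\<omega>. (W v \<omega> - W u \<omega>) ^ 4) (3 * (v - u)\<^sup>2)"
      by (rule has_bochner_integral_completion[OF _ *(3)]) measurable
  qed
  show "has_bochner_integral ?N (\<lambda>\<omega>. (W t \<omega> - W s \<omega>) ^ 4) (3 * (t - s)\<^sup>2)"
    by (rule inc(3)[OF st])
  assume A: "A \<in> sets (canonical_filtration M T W s)"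
  then have AN: "A \<in> sets ?N"
    using subalgebra_canonical_filtration[of s] by (auto simp: subalgebra_def)
  have int: "integrable ?N (\<lambda>\<omega>. indicator A \<omega> * (W v \<omega> - W u \<omega>))"
    "integrable ?N (\<lambda>\<omega>. indicator A \<omega> * (W v \<omega> - W u \<omega>)\<^sup>2)" if "0 \<le> u" "u < v" "v \<le> T" for u v
  proof -
    have "integrable ?N (\<lambda>\<omega>. W v \<omega> - W u \<omega>)" "integrable ?N (\<lambda>\<omega>. (W v \<omega> - W u \<omega>)\<^sup>2)"
      using inc(1,2)[OF that] by (auto simp only: has_bochner_integral_iff)
    from this[THEN integrable_mult_indicator[OF AN]]
    show "integrable ?N (\<lambda>\<omega>. indicator A \<omega> * (W v \<omega> - W u \<omega>))"
      "integrable ?N (\<lambda>\<omega>. indicator A \<omega> * (W v \<omega> - W u \<omega>)\<^sup>2)" by simp_all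
  qed
  have eq: "(\<integral>\<omega>. indicator A \<omega> * (W t \<omega> - W u \<omega>) \<partial>?N) = 0"
    "(\<integral>\<omega>. indicator A \<omega> * (W t \<omega> - W u \<omega>)\<^sup>2 \<partial>?N) = (t - u) * measure ?N A"
    if "s < u" "u < t" for u
  proof -
    have "A \<in> sigma_sets (space M) (past_events M W u \<union> null_sets (completion M))"
      using sets_canonical_filtration_subset[OF that(1)] A that st by (auto simp: min_def)
    from augmented_increment_expectation[OF _ that(2) st(3) this, of "\<lambda>x. x"]
      augmented_increment_expectation[OF _ that(2) st(3) this, of "\<lambda>x. x\<^sup>2"]
    show "(\<integral>\<omega>. indicator A \<omega> * (W t \<omega> - W u \<omega>) \<partial>?N) = 0"
      "(\<integral>\<omega>. indicator A \<omega> * (W t \<omega> - W u \<omega>)\<^sup>2 \<partial>?N) = (t - u) * measure ?N A"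
      using W_increment_moments[of u t] that st by auto
  qed
  \<comment> \<open>From |w| <= q/2 + w^2/(2q), where w^2 has expectation q^2. The choice of q^2 as
    time step makes the bound linear in \<open>q\<close>.\<close>
  have small: "(\<integral>\<omega>. \<bar>W (s + q\<^sup>2) \<omega> - W s \<omega>\<bar> \<partial>?N) \<le> q" if q: "0 < q" "s + q\<^sup>2 < t" for q
  proof -
    have h: "has_bochner_integral ?N (\<lambda>\<omega>. (W (s + q\<^sup>2) \<omega> - W s \<omega>)\<^sup>2) (q\<^sup>2)"
      "integrable ?N (\<lambda>\<omega>. W (s + q\<^sup>2) \<omega> - W s \<omega>)"
      using inc(1,2)[of s "s + q\<^sup>2"] q st by (auto simp: has_bochner_integral_iff)
    have "(\<integral>\<omega>. \<bar>W (s + q\<^sup>2) \<omega> - W s \<omega>\<bar> \<partial>?N) \<le> (\<integral>\<omega>. q / 2 + (W (s + q\<^sup>2) \<omega> - W s \<omega>)\<^sup>2 / (2 * q) \<partial>?N)"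
    proof (rule integral_mono)
      fix \<omega>
      have "0 \<le> (\<bar>W (s + q\<^sup>2) \<omega> - W s \<omega>\<bar> - q)\<^sup>2" by simp
      then show "\<bar>W (s + q\<^sup>2) \<omega> - W s \<omega>\<bar> \<le> q / 2 + (W (s + q\<^sup>2) \<omega> - W s \<omega>)\<^sup>2 / (2 * q)"
        using q by (simp add: field_simps power2_eq_square)
    qed (use h in \<open>auto simp: has_bochner_integral_iff\<close>)
    also have "\<dots> = q"
      using h q N.prob_space by (simp add: has_bochner_integral_iff power2_eq_square)
    finally show ?thesis .
  qed
  \<comment> \<open>The bound by the root keeps s + q^2 below \<open>t\<close>; the bound by 1 gives
    q^2 <= q, so that all errors become multiples of \<open>q\<close>.\<close>
  define q0 where "q0 = min 1 (sqrt (t - s))"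
  have q0: "0 < q0" using st by (simp add: q0_def)
  have q0': "s + q\<^sup>2 < t" "q\<^sup>2 \<le> q" if "0 < q" "q < q0" for q
  proof -
    have "q\<^sup>2 < (sqrt (t - s))\<^sup>2" using that by (intro power_strict_mono) (auto simp: q0_def)
    then show "s + q\<^sup>2 < t" using st by simp
    show "q\<^sup>2 \<le> q" using that by (simp add: q0_def power2_eq_square mult_left_le)
  qed
  have "\<bar>\<integral>\<omega>. indicator A \<omega> * (W t \<omega> - W s \<omega>) \<partial>?N\<bar> \<le> 0"
  proof (rule nonpos_if_le_small_multiple[OF q0, of 1])
    fix q assume q: "0 < q" "q < q0"
    let ?u = "s + q\<^sup>2"
    have u: "s < ?u" "?u < t" using q0'[OF q] q by auto
    have "(\<integral>\<omega>. indicator A \<omega> * (W t \<omega> - W s \<omega>) \<partial>?N) =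
       (\<integral>\<omega>. indicator A \<omega> * (W t \<omega> - W ?u \<omega>) + indicator A \<omega> * (W ?u \<omega> - W s \<omega>) \<partial>?N)"
      by (simp add: algebra_simps)
    also have "\<dots> = (\<integral>\<omega>. indicator A \<omega> * (W ?u \<omega> - W s \<omega>) \<partial>?N)"
      using int(1)[of ?u t] int(1)[of s ?u] eq(1)[OF u] u st by simp
    finally have "\<bar>\<integral>\<omega>. indicator A \<omega> * (W t \<omega> - W s \<omega>) \<partial>?N\<bar> =
       \<bar>\<integral>\<omega>. indicator A \<omega> * (W ?u \<omega> - W s \<omega>) \<partial>?N\<bar>" by simp
    also have "\<dots> \<le> (\<integral>\<omega>. \<bar>indicator A \<omega> * (W ?u \<omega> - W s \<omega>)\<bar> \<partial>?N)"
      by (rule integral_abs_bound)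
    also have "\<dots> \<le> (\<integral>\<omega>. \<bar>W ?u \<omega> - W s \<omega>\<bar> \<partial>?N)"
      using int(1)[of s ?u] inc(1)[of s ?u] u st
      by (intro integral_mono) (auto simp: has_bochner_integral_iff indicator_def)
    also have "\<dots> \<le> q" by (rule small[OF q(1) q0'(1)[OF q]])
    finally show "\<bar>\<integral>\<omega>. indicator A \<omega> * (W t \<omega> - W s \<omega>) \<partial>?N\<bar> \<le> 1 * q" by simp
  qed simp
  then show "(\<integral>\<omega>. indicator A \<omega> * (W t \<omega> - W s \<omega>) \<partial>?N) = 0" by simp
  \<comment> \<open>The constant collects (t - s + 2) * q from replacing the increment over {s..t}
    by the one over {u..t}, and one further q^2 <= q from replacing t - u by t - s.\<close>
  have "\<bar>(\<integral>\<omega>. indicator A \<omega> * (W t \<omega> - W s \<omega>)\<^sup>2 \<partial>?N) - (t - s) * measure ?N A\<bar> \<le> 0"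
  proof (rule nonpos_if_le_small_multiple[OF q0, of "t - s + 3"])
    fix q assume q: "0 < q" "q < q0"
    let ?u = "s + q\<^sup>2"
    have u: "s < ?u" "?u < t" using q0'[OF q] q by auto
    let ?a = "\<lambda>\<omega>. W t \<omega> - W ?u \<omega>" and ?b = "\<lambda>\<omega>. W ?u \<omega> - W s \<omega>"
    have i: "integrable ?N (\<lambda>\<omega>. (?a \<omega>)\<^sup>2)" "integrable ?N (\<lambda>\<omega>. (?b \<omega>)\<^sup>2)"
      "(\<integral>\<omega>. (?a \<omega>)\<^sup>2 \<partial>?N) = t - ?u" "(\<integral>\<omega>. (?b \<omega>)\<^sup>2 \<partial>?N) = q\<^sup>2"
      using inc(2)[of ?u t] inc(2)[of s ?u] u st by (auto simp: has_bochner_integral_iff)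
    have "\<bar>(\<integral>\<omega>. indicator A \<omega> * (W t \<omega> - W s \<omega>)\<^sup>2 \<partial>?N) - (\<integral>\<omega>. indicator A \<omega> * (?a \<omega>)\<^sup>2 \<partial>?N)\<bar> =
       \<bar>\<integral>\<omega>. indicator A \<omega> * (W t \<omega> - W s \<omega>)\<^sup>2 - indicator A \<omega> * (?a \<omega>)\<^sup>2 \<partial>?N\<bar>"
      using int(2)[of s t] int(2)[of ?u t] u st by simp
    also have "\<dots> \<le> (\<integral>\<omega>. \<bar>indicator A \<omega> * (W t \<omega> - W s \<omega>)\<^sup>2 - indicator A \<omega> * (?a \<omega>)\<^sup>2\<bar> \<partial>?N)"
      by (rule integral_abs_bound)
    also have "\<dots> \<le> (\<integral>\<omega>. q * (?a \<omega>)\<^sup>2 + (1 + 1 / q) * (?b \<omega>)\<^sup>2 \<partial>?N)"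
    proof (rule integral_mono)
      fix \<omega>
      have "\<bar>indicator A \<omega> * (W t \<omega> - W s \<omega>)\<^sup>2 - indicator A \<omega> * (?a \<omega>)\<^sup>2\<bar> \<le> \<bar>(W t \<omega> - W s \<omega>)\<^sup>2 - (?a \<omega>)\<^sup>2\<bar>"
        by (auto simp: indicator_def)
      also have "(W t \<omega> - W s \<omega>)\<^sup>2 - (?a \<omega>)\<^sup>2 = 2 * (?a \<omega> * ?b \<omega>) + (?b \<omega>)\<^sup>2"
        by (simp add: power2_eq_square algebra_simps)
      also have "\<bar>\<dots>\<bar> \<le> 2 * (\<bar>?a \<omega>\<bar> * \<bar>?b \<omega>\<bar>) + (?b \<omega>)\<^sup>2"
        by (rule order_trans[OF abs_triangle_ineq]) (simp add: abs_mult)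
      \<comment> \<open>The cross term is split with weight \<open>q\<close>: E a^2 is bounded, so q
        * a^2 is small, and E b^2 = q^2, so b^2 / q is small as well.\<close>
      also have "2 * (\<bar>?a \<omega>\<bar> * \<bar>?b \<omega>\<bar>) \<le> q * (?a \<omega>)\<^sup>2 + (1 / q) * (?b \<omega>)\<^sup>2"
      proof -
        have "0 \<le> (q * \<bar>?a \<omega>\<bar> - \<bar>?b \<omega>\<bar>)\<^sup>2" by simp
        also have "\<dots> = q * q * (?a \<omega>)\<^sup>2 + (?b \<omega>)\<^sup>2 - q * (2 * (\<bar>?a \<omega>\<bar> * \<bar>?b \<omega>\<bar>))"
          by (simp only: power2_diff power_mult_distrib power2_abs) (simp add: power2_eq_square)
        finally have "q * (2 * (\<bar>?a \<omega>\<bar> * \<bar>?b \<omega>\<bar>)) \<le> q * (q * (?a \<omega>)\<^sup>2 + (1 / q) * (?b \<omega>)\<^sup>2)"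
          using q by (simp add: distrib_left)
        then show ?thesis using q by simp
      qed
      finally show "\<bar>indicator A \<omega> * (W t \<omega> - W s \<omega>)\<^sup>2 - indicator A \<omega> * (?a \<omega>)\<^sup>2\<bar> \<le>
          q * (?a \<omega>)\<^sup>2 + (1 + 1 / q) * (?b \<omega>)\<^sup>2"
        by (simp add: algebra_simps)
    qed (use int(2)[of s t] int(2)[of ?u t] u st i in auto)
    also have "\<dots> = q * (t - ?u) + (1 + 1 / q) * q\<^sup>2"
      using i by simp
    also have "\<dots> \<le> q * (t - s) + 2 * q"
    proof -
      have "q * (t - ?u) \<le> q * (t - s)" using q by (intro mult_left_mono) auto
      moreover have "(1 + 1 / q) * q\<^sup>2 = q\<^sup>2 + q" using q by (simp add: field_simps power2_eq_square)
      ultimately show ?thesis using q0'(2)[OF q] by linarith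
    qed
    finally have "\<bar>(\<integral>\<omega>. indicator A \<omega> * (W t \<omega> - W s \<omega>)\<^sup>2 \<partial>?N) - (t - ?u) * measure ?N A\<bar> \<le> q * (t - s) + 2 * q"
      unfolding eq(2)[OF u] .
    moreover have "\<bar>(t - ?u) * measure ?N A - (t - s) * measure ?N A\<bar> \<le> q"
    proof -
      have "\<bar>(t - ?u) * measure ?N A - (t - s) * measure ?N A\<bar> = q\<^sup>2 * measure ?N A"
        by (simp add: algebra_simps)
      also have "\<dots> \<le> q\<^sup>2 * 1" by (intro mult_left_mono N.prob_le_1) simp
      finally show ?thesis using q0'(2)[OF q] by simp
    qed
    ultimately have "\<bar>(\<integral>\<omega>. indicator A \<omega> * (W t \<omega> - W s \<omega>)\<^sup>2 \<partial>?N) - (t - s) * measure ?N A\<bar> \<le> (q * (t - s) + 2 * q) + q"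
      by linarith
    also have "\<dots> = (t - s + 3) * q" by (simp add: algebra_simps)
    finally show "\<bar>(\<integral>\<omega>. indicator A \<omega> * (W t \<omega> - W s \<omega>)\<^sup>2 \<partial>?N) - (t - s) * measure ?N A\<bar> \<le> (t - s + 3) * q" .
  qed (use st in simp)
  then show "(\<integral>\<omega>. indicator A \<omega> * (W t \<omega> - W s \<omega>)\<^sup>2 \<partial>?N) = (t - s) * measure ?N A" by simp
qed (use subalgebra_canonical_filtration canonical_filtration_mono W_adapted_canonical in auto)

end

section \<open>Mixed moments of increments with variables known before\<close>

context brownian_filtration
begin

lemma increment_integrable:
  assumes "0 \<le> s" "s \<le> t" "t \<le> T"
  shows "integrable N (\<lambda>\<omega>. (W t \<omega> - W s \<omega>) ^ 4)"
    "integrable N (\<lambda>\<omega>. (W t \<omega> - W s \<omega>)\<^sup>2)"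
    "integrable N (\<lambda>\<omega>. W t \<omega> - W s \<omega>)"
proof -
  have [measurable]: "W t \<in> borel_measurable N" "W s \<in> borel_measurable N"
    using measurable_from_subalg[OF subalg W_adapted] assms by auto
  show 4: "integrable N (\<lambda>\<omega>. (W t \<omega> - W s \<omega>) ^ 4)"
    using W_fourth[of s t] assms by (cases "s = t") (auto simp: has_bochner_integral_iff)
  have "x\<^sup>2 \<le> 1 + x ^ 4" "\<bar>x\<bar> \<le> 1 + x ^ 4" for x :: real
  proof -
    have "0 \<le> (x\<^sup>2 - 1)\<^sup>2" "0 \<le> (\<bar>x\<bar> - 1)\<^sup>2" by simp_all
    then have "2 * x\<^sup>2 \<le> 1 + x ^ 4" "2 * \<bar>x\<bar> \<le> 1 + x\<^sup>2"
      by (simp_all add: power2_diff flip: power_mult)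
    moreover have "0 \<le> x\<^sup>2" "0 \<le> x ^ 4" by simp_all
    ultimately show "x\<^sup>2 \<le> 1 + x ^ 4" "\<bar>x\<bar> \<le> 1 + x ^ 4" by linarith+
  qed
  note bound = this
  have i: "integrable N (\<lambda>\<omega>. 1 + (W t \<omega> - W s \<omega>) ^ 4)"
    using 4 by simp
  show "integrable N (\<lambda>\<omega>. (W t \<omega> - W s \<omega>)\<^sup>2)"
    by (rule Bochner_Integration.integrable_bound[OF i]) (use bound(1) in auto)
  show "integrable N (\<lambda>\<omega>. W t \<omega> - W s \<omega>)"
    by (rule Bochner_Integration.integrable_bound[OF i]) (use bound(2) in auto)
qed

text \<open>\<open>W_first\<close> identifies the conditional expectation of the increment given
  \<open>F s\<close> as 0, and a factor known at time \<open>s\<close> can be taken out. Going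
  through conditional expectations allows an unbounded factor, as needed for the cross terms of the
  isometry.\<close>

lemma increment_mean:
  assumes st: "0 \<le> s" "s \<le> t" "t \<le> T" and \<xi>: "\<xi> \<in> borel_measurable (F s)"
    "integrable N (\<lambda>\<omega>. \<xi> \<omega> * (W t \<omega> - W s \<omega>))"
  shows "(\<integral>\<omega>. \<xi> \<omega> * (W t \<omega> - W s \<omega>) \<partial>N) = 0"
proof (cases "s = t")
  case False
  interpret S: finite_measure_subalgebra N "F s"
    using subalg[of s] st by unfold_locales auto
  have "AE \<omega> in N. real_cond_exp N (F s) (\<lambda>\<omega>. W t \<omega> - W s \<omega>) \<omega> = 0"
  proof (rule S.real_cond_exp_charact)
    fix A assume "A \<in> sets (F s)"
    then show "(\<integral>\<omega>\<in>A. (W t \<omega> - W s \<omega>) \<partial>N) = (\<integral>\<omega>\<in>A. 0 \<partial>N)"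
      using W_first[of s t A] st False by (simp add: set_lebesgue_integral_def)
  qed (use increment_integrable[OF st] in auto)
  then have "(\<integral>\<omega>. \<xi> \<omega> * real_cond_exp N (F s) (\<lambda>\<omega>. W t \<omega> - W s \<omega>) \<omega> \<partial>N) = (\<integral>\<omega>. 0 \<partial>N)"
    using measurable_from_subalg[OF S.subalg \<xi>(1)] 
    by (intro integral_cong_AE) auto
  then show ?thesis
    using S.real_cond_exp_intg(2)[OF \<xi>(2,1)] increment_integrable[OF st] by simp
qed simp

lemma increment_second:
  assumes st: "0 \<le> s" "s \<le> t" "t \<le> T" and \<xi>: "\<xi> \<in> borel_measurable (F s)"
    "integrable N (\<lambda>\<omega>. \<xi> \<omega> * (W t \<omega> - W s \<omega>)\<^sup>2)"
  shows "(\<integral>\<omega>. \<xi> \<omega> * (W t \<omega> - W s \<omega>)\<^sup>2 \<partial>N) = (t - s) * (\<integral>\<omega>. \<xi> \<omega> \<partial>N)"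
proof (cases "s = t")
  case False
  interpret S: finite_measure_subalgebra N "F s"
    using subalg[of s] st by unfold_locales auto
  have "AE \<omega> in N. real_cond_exp N (F s) (\<lambda>\<omega>. (W t \<omega> - W s \<omega>)\<^sup>2) \<omega> = t - s"
  proof (rule S.real_cond_exp_charact)
    fix A assume A: "A \<in> sets (F s)"
    then have "A \<in> sets N" using S.subalg by (auto simp: subalgebra_def)
    then show "(\<integral>\<omega>\<in>A. (W t \<omega> - W s \<omega>)\<^sup>2 \<partial>N) = (\<integral>\<omega>\<in>A. (t - s) \<partial>N)"
      using W_second[of s t A] st False A by (simp add: set_lebesgue_integral_def)
  qed (use increment_integrable[OF st] in auto)
  then have "(\<integral>\<omega>. \<xi> \<omega> * real_cond_exp N (F s) (\<lambda>\<omega>. (W t \<omega> - W s \<omega>)\<^sup>2) \<omega> \<partial>N) = (\<integral>\<omega>. \<xi> \<omega> * (t - s) \<partial>N)"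
    using measurable_from_subalg[OF S.subalg \<xi>(1)]
    by (intro integral_cong_AE) auto
  then show ?thesis
    using S.real_cond_exp_intg(2)[OF \<xi>(2,1)] increment_integrable[OF st] by simp
qed simp

end

section \<open>Increments of Ito integrals\<close>

lemma integrable_mult_of_squares:
  fixes f g :: "'a \<Rightarrow> real"
  assumes [measurable]: "f \<in> borel_measurable M" "g \<in> borel_measurable M"
    and "integrable M (\<lambda>x. (f x)\<^sup>2)" "integrable M (\<lambda>x. (g x)\<^sup>2)"
  shows "integrable M (\<lambda>x. f x * g x)"
proof (rule Bochner_Integration.integrable_bound)
  show "integrable M (\<lambda>x. (f x)\<^sup>2 + (g x)\<^sup>2)" using assms by simp
  have "\<bar>a * b\<bar> \<le> a\<^sup>2 + b\<^sup>2" for a b :: real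
  proof -
    have "0 \<le> (\<bar>a\<bar> - \<bar>b\<bar>)\<^sup>2" by simp
    then have "2 * \<bar>a * b\<bar> \<le> a\<^sup>2 + b\<^sup>2" by (simp add: power2_diff abs_mult)
    moreover have "0 \<le> \<bar>a * b\<bar>" by simp
    ultimately show ?thesis by linarith
  qed
  then show "AE x in M. norm (f x * g x) \<le> norm ((f x)\<^sup>2 + (g x)\<^sup>2)" by simp
qed measurable

lemma integrable_bounded_mult:
  fixes f g :: "'a \<Rightarrow> real"
  assumes [measurable]: "f \<in> borel_measurable M" and g: "integrable M g"
    and c: "\<And>x. x \<in> space M \<Longrightarrow> \<bar>f x\<bar> \<le> c"
  shows "integrable M (\<lambda>x. f x * g x)"
proof (rule Bochner_Integration.integrable_bound)
  show "integrable M (\<lambda>x. c * g x)" using g by simp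
  have [measurable]: "g \<in> borel_measurable M" using g by simp
  show "(\<lambda>x. f x * g x) \<in> borel_measurable M" by measurable
  show "AE x in M. norm (f x * g x) \<le> norm (c * g x)"
  proof (rule AE_I2)
    fix x assume "x \<in> space M"
    from c[OF this] show "norm (f x * g x) \<le> norm (c * g x)"
      by (auto simp: abs_mult intro!: mult_right_mono)
  qed
qed

lemma grid_mono:
  fixes \<tau> :: "nat \<Rightarrow> real"
  assumes "\<And>i. i < n \<Longrightarrow> \<tau> i \<le> \<tau> (Suc i)" "i \<le> j" "j \<le> n"
  shows "\<tau> i \<le> \<tau> j"
  using assms(2,3)
proof (induction j rule: dec_induct)
  case (step k)
  then show ?case using assms(1)[of k] by simp
qed simp

text \<open>The half-open intervals of a grid are pairwise disjoint, also when some of them are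
  empty, so a single summand survives.\<close>

lemma step_sum:
  fixes \<tau> :: "nat \<Rightarrow> real" and f :: "nat \<Rightarrow> real"
  assumes mono: "\<And>i. i < n \<Longrightarrow> \<tau> i \<le> \<tau> (Suc i)" and i: "i < n" "\<tau> i < r" "r \<le> \<tau> (Suc i)"
  shows "(\<Sum>j<n. f j * indicator {\<tau> j<..\<tau> (Suc j)} r) = f i"
proof -
  have "r \<notin> {\<tau> j<..\<tau> (Suc j)}" if "j < n" "j \<noteq> i" for j
  proof (cases "j < i")
    case True
    then have "\<tau> (Suc j) \<le> \<tau> i" using i by (intro grid_mono[where n = n and \<tau> = \<tau>, OF mono]) auto
    then show ?thesis using i by auto
  next
    case False
    then have "\<tau> (Suc i) \<le> \<tau> j" using that by (intro grid_mono[where n = n and \<tau> = \<tau>, OF mono]) auto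
    then show ?thesis using i by auto
  qed
  then have "(\<Sum>j<n. f j * indicator {\<tau> j<..\<tau> (Suc j)} r) = (\<Sum>j<n. if j = i then f i else 0)"
    using i by (intro sum.cong) auto
  also have "\<dots> = f i" using i by simp
  finally show ?thesis .
qed

context brownian_filtration
begin

lemma F_measurable_mono:
  assumes "0 \<le> s" "s \<le> t" "t \<le> T" "f \<in> borel_measurable (F s)"
  shows "f \<in> borel_measurable (F t)"
proof (rule measurable_from_subalg[OF _ assms(4)])
  show "subalgebra (F t) (F s)"
    using F_mono[OF assms(1-3)] subalg[of s] subalg[of t] assms by (auto simp: subalgebra_def)
qed

lemma F_measurable: "0 \<le> s \<Longrightarrow> s \<le> T \<Longrightarrow> f \<in> borel_measurable (F s) \<Longrightarrow> f \<in> borel_measurable N"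
  using measurable_from_subalg[OF subalg] by blast

lemma W_measurable_N: "0 \<le> s \<Longrightarrow> s \<le> T \<Longrightarrow> W s \<in> borel_measurable N"
  using F_measurable W_adapted by blast

text \<open>The Ito isometry, together with the martingale property tested against bounded variables
  known at time \<open>\<sigma> 0\<close>. In the induction the new cross term has mean 0 because
  \<open>S n\<close> and \<open>\<zeta> n\<close> are both known at time \<open>\<sigma> n\<close>;
  this is why measurability of the partial sum is part of the statement.\<close>

lemma elementary_sum:
  fixes \<sigma> :: "nat \<Rightarrow> real" and \<zeta> :: "nat \<Rightarrow> 'a \<Rightarrow> real"
  assumes \<sigma>: "0 \<le> \<sigma> 0" "\<And>i. i < n \<Longrightarrow> \<sigma> i \<le> \<sigma> (Suc i)" "\<sigma> n \<le> T"
    and \<zeta>: "\<And>i. i < n \<Longrightarrow> \<zeta> i \<in> borel_measurable (F (\<sigma> i))"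
      "\<And>i \<omega>. i < n \<Longrightarrow> \<omega> \<in> space N \<Longrightarrow> \<bar>\<zeta> i \<omega>\<bar> \<le> c"
  defines "S \<equiv> \<lambda>n \<omega>. \<Sum>i<n. \<zeta> i \<omega> * (W (\<sigma> (Suc i)) \<omega> - W (\<sigma> i) \<omega>)"
  shows "S n \<in> borel_measurable (F (\<sigma> n)) \<and> integrable N (\<lambda>\<omega>. (S n \<omega>)\<^sup>2) \<and>
     (\<integral>\<omega>. (S n \<omega>)\<^sup>2 \<partial>N) = (\<integral>\<omega>. (\<Sum>i<n. (\<sigma> (Suc i) - \<sigma> i) * (\<zeta> i \<omega>)\<^sup>2) \<partial>N) \<and>
     integrable N (\<lambda>\<omega>. \<Sum>i<n. (\<sigma> (Suc i) - \<sigma> i) * (\<zeta> i \<omega>)\<^sup>2) \<and>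
     (\<forall>\<eta> d. \<eta> \<in> borel_measurable (F (\<sigma> 0)) \<longrightarrow> (\<forall>\<omega>\<in>space N. \<bar>\<eta> \<omega>\<bar> \<le> d) \<longrightarrow>
        integrable N (\<lambda>\<omega>. \<eta> \<omega> * S n \<omega>) \<and> (\<integral>\<omega>. \<eta> \<omega> * S n \<omega> \<partial>N) = 0)"
  using \<sigma>(2,3) \<zeta>
proof (induction n)
  case 0
  then show ?case by (simp add: S_def)
next
  case (Suc n)
  have le: "\<sigma> n \<le> \<sigma> (Suc n)" "\<sigma> (Suc n) \<le> T" "\<sigma> 0 \<le> \<sigma> n"
    using Suc.prems(1)[of n] Suc.prems(2) grid_mono[where n = "Suc n" and i = 0 and j = n and \<tau> = \<sigma>] Suc.prems(1) by auto
  note IH = Suc.IH[OF Suc.prems(1) _ Suc.prems(3,4)]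
  have IH: "S n \<in> borel_measurable (F (\<sigma> n))" "integrable N (\<lambda>\<omega>. (S n \<omega>)\<^sup>2)"
    "(\<integral>\<omega>. (S n \<omega>)\<^sup>2 \<partial>N) = (\<integral>\<omega>. (\<Sum>i<n. (\<sigma> (Suc i) - \<sigma> i) * (\<zeta> i \<omega>)\<^sup>2) \<partial>N)"
    "integrable N (\<lambda>\<omega>. \<Sum>i<n. (\<sigma> (Suc i) - \<sigma> i) * (\<zeta> i \<omega>)\<^sup>2)"
    "\<And>\<eta> d. \<eta> \<in> borel_measurable (F (\<sigma> 0)) \<Longrightarrow> (\<And>\<omega>. \<omega> \<in> space N \<Longrightarrow> \<bar>\<eta> \<omega>\<bar> \<le> d) \<Longrightarrow>
        integrable N (\<lambda>\<omega>. \<eta> \<omega> * S n \<omega>) \<and> (\<integral>\<omega>. \<eta> \<omega> * S n \<omega> \<partial>N) = 0"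
    using IH le by auto
  let ?D = "\<lambda>\<omega>. W (\<sigma> (Suc n)) \<omega> - W (\<sigma> n) \<omega>"
  have pos: "0 \<le> \<sigma> n" using \<sigma>(1) le by simp
  note st = pos le(1,2)
  note D = increment_integrable[OF st]
  have \<zeta>: "\<zeta> n \<in> borel_measurable (F (\<sigma> n))" "\<And>\<omega>. \<omega> \<in> space N \<Longrightarrow> \<bar>\<zeta> n \<omega>\<bar> \<le> c"
    using Suc.prems by auto
  have [measurable]: "\<zeta> n \<in> borel_measurable N" "S n \<in> borel_measurable N"
    "W (\<sigma> (Suc n)) \<in> borel_measurable N" "W (\<sigma> n) \<in> borel_measurable N"
    using F_measurable[OF pos _ \<zeta>(1)] F_measurable[OF pos _ IH(1)] W_measurable_N st by auto
  have \<zeta>sq: "(\<zeta> n \<omega>)\<^sup>2 \<le> c\<^sup>2" if "\<omega> \<in> space N" for \<omega>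
    using power_mono[OF \<zeta>(2)[OF that] abs_ge_zero, of 2] by simp
  have \<zeta>2: "integrable N (\<lambda>\<omega>. (\<zeta> n \<omega>)\<^sup>2)"
  proof (rule integrable_const_bound[where B = "c\<^sup>2"])
    show "AE \<omega> in N. norm ((\<zeta> n \<omega>)\<^sup>2) \<le> c\<^sup>2"
      using \<zeta>sq by (intro AE_I2) simp
  qed measurable
  have \<zeta>D2: "integrable N (\<lambda>\<omega>. (\<zeta> n \<omega>)\<^sup>2 * (?D \<omega>)\<^sup>2)"
  proof (rule integrable_bounded_mult[OF _ D(2)])
    show "\<bar>(\<zeta> n \<omega>)\<^sup>2\<bar> \<le> c\<^sup>2" if "\<omega> \<in> space N" for \<omega>
      using \<zeta>sq[OF that] by simp
  qed measurable
  have S\<zeta>D: "integrable N (\<lambda>\<omega>. S n \<omega> * (\<zeta> n \<omega> * ?D \<omega>))"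
    by (rule integrable_mult_of_squares) (use IH(2) \<zeta>D2 in \<open>auto simp: power_mult_distrib\<close>)
  have cross: "(\<integral>\<omega>. S n \<omega> * (\<zeta> n \<omega> * ?D \<omega>) \<partial>N) = 0"
    using increment_mean[OF st, of "\<lambda>\<omega>. S n \<omega> * \<zeta> n \<omega>"] IH(1) \<zeta>(1) S\<zeta>D by (simp add: mult.assoc)
  have diag: "(\<integral>\<omega>. (\<zeta> n \<omega>)\<^sup>2 * (?D \<omega>)\<^sup>2 \<partial>N) = (\<sigma> (Suc n) - \<sigma> n) * (\<integral>\<omega>. (\<zeta> n \<omega>)\<^sup>2 \<partial>N)"
    using \<zeta>(1) \<zeta>D2 by (intro increment_second[OF st]) auto
  have S_Suc: "S (Suc n) \<omega> = S n \<omega> + \<zeta> n \<omega> * ?D \<omega>" for \<omega>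
    by (simp add: S_def)
  have sq: "(S (Suc n) \<omega>)\<^sup>2 = (S n \<omega>)\<^sup>2 + 2 * (S n \<omega> * (\<zeta> n \<omega> * ?D \<omega>)) + (\<zeta> n \<omega>)\<^sup>2 * (?D \<omega>)\<^sup>2" for \<omega>
    unfolding S_Suc by (simp add: power2_eq_square algebra_simps)
  show ?case
  proof (intro conjI allI impI)
    have m: "S n \<in> borel_measurable (F (\<sigma> (Suc n)))" "\<zeta> n \<in> borel_measurable (F (\<sigma> (Suc n)))"
      "W (\<sigma> n) \<in> borel_measurable (F (\<sigma> (Suc n)))" "W (\<sigma> (Suc n)) \<in> borel_measurable (F (\<sigma> (Suc n)))"
      using F_measurable_mono[OF st IH(1)] F_measurable_mono[OF st \<zeta>(1)]
        F_measurable_mono[OF st W_adapted] W_adapted[of "\<sigma> (Suc n)"] st by auto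
    show "S (Suc n) \<in> borel_measurable (F (\<sigma> (Suc n)))"
      unfolding S_Suc[abs_def] using m by measurable
    show "integrable N (\<lambda>\<omega>. (S (Suc n) \<omega>)\<^sup>2)"
      unfolding sq using IH(2) S\<zeta>D \<zeta>D2 by simp
    show "(\<integral>\<omega>. (S (Suc n) \<omega>)\<^sup>2 \<partial>N) = (\<integral>\<omega>. (\<Sum>i<Suc n. (\<sigma> (Suc i) - \<sigma> i) * (\<zeta> i \<omega>)\<^sup>2) \<partial>N)"
      unfolding sq using IH(2,3,4) S\<zeta>D \<zeta>D2 cross diag \<zeta>2 by simp
    show "integrable N (\<lambda>\<omega>. \<Sum>i<Suc n. (\<sigma> (Suc i) - \<sigma> i) * (\<zeta> i \<omega>)\<^sup>2)"
      using IH(4) \<zeta>2 by simp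
    fix \<eta> :: "'a \<Rightarrow> real" and d
    assume \<eta>: "\<eta> \<in> borel_measurable (F (\<sigma> 0))" "\<forall>\<omega>\<in>space N. \<bar>\<eta> \<omega>\<bar> \<le> d"
    have \<eta>n: "\<eta> \<in> borel_measurable (F (\<sigma> n))"
      using F_measurable_mono[OF \<sigma>(1) le(3) _ \<eta>(1)] le by auto
    have [measurable]: "\<eta> \<in> borel_measurable N"
      using F_measurable[OF pos _ \<eta>n] le by auto
    have i: "integrable N (\<lambda>\<omega>. \<eta> \<omega> * \<zeta> n \<omega> * ?D \<omega>)"
    proof (rule integrable_bounded_mult[OF _ D(3)])
      show "\<bar>\<eta> \<omega> * \<zeta> n \<omega>\<bar> \<le> d * c" if "\<omega> \<in> space N" for \<omega>
        using \<eta>(2) \<zeta>(2)[OF that] that unfolding abs_mult by (intro mult_mono) (auto intro: order_trans[OF abs_ge_zero])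
    qed measurable
    have z: "(\<integral>\<omega>. \<eta> \<omega> * \<zeta> n \<omega> * ?D \<omega> \<partial>N) = 0"
      by (rule increment_mean[OF st _ i]) (use \<eta>n \<zeta>(1) in measurable)
    have eq: "\<eta> \<omega> * S (Suc n) \<omega> = \<eta> \<omega> * S n \<omega> + \<eta> \<omega> * \<zeta> n \<omega> * ?D \<omega>" for \<omega>
      unfolding S_Suc by (simp add: algebra_simps)
    show "integrable N (\<lambda>\<omega>. \<eta> \<omega> * S (Suc n) \<omega>)" "(\<integral>\<omega>. \<eta> \<omega> * S (Suc n) \<omega> \<partial>N) = 0"
      unfolding eq using IH(5)[OF \<eta>(1), of d] \<eta>(2) i z by auto
  qed
qed

text \<open>Since \<open>\<zeta> i\<close> is known at time \<open>\<sigma> i\<close>, so is the quadratic variation up to time \<open>\<sigma> (Suc i)\<close>; hence the sum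
  can be stopped before its quadratic variation exceeds \<open>K\<close>.\<close>

lemma stopped_sum:
  fixes \<sigma> :: "nat \<Rightarrow> real" and \<zeta> :: "nat \<Rightarrow> 'a \<Rightarrow> real"
  assumes \<sigma>: "0 \<le> \<sigma> 0" "\<And>i. i < n \<Longrightarrow> \<sigma> i \<le> \<sigma> (Suc i)" "\<sigma> n \<le> T"
    and \<zeta>: "\<And>i. i < n \<Longrightarrow> \<zeta> i \<in> borel_measurable (F (\<sigma> i))"
      "\<And>i \<omega>. i < n \<Longrightarrow> \<omega> \<in> space N \<Longrightarrow> \<bar>\<zeta> i \<omega>\<bar> \<le> c"
    and "0 \<le> K"
  defines "S \<equiv> \<lambda>\<omega>. \<Sum>i<n. \<zeta> i \<omega> * (W (\<sigma> (Suc i)) \<omega> - W (\<sigma> i) \<omega>)"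
    and "Q \<equiv> \<lambda>\<omega>. \<Sum>i<n. (\<sigma> (Suc i) - \<sigma> i) * (\<zeta> i \<omega>)\<^sup>2"
  obtains S' where "S' \<in> borel_measurable N" "integrable N (\<lambda>\<omega>. (S' \<omega>)\<^sup>2)"
    "Q \<in> borel_measurable N" "(\<integral>\<omega>. (S' \<omega>)\<^sup>2 \<partial>N) \<le> (\<integral>\<omega>. min K (Q \<omega>) \<partial>N)"
    "\<And>\<omega>. \<omega> \<in> space N \<Longrightarrow> Q \<omega> \<le> K \<Longrightarrow> S' \<omega> = S \<omega>"
    "\<And>\<eta> d. \<eta> \<in> borel_measurable (F (\<sigma> 0)) \<Longrightarrow> (\<And>\<omega>. \<omega> \<in> space N \<Longrightarrow> \<bar>\<eta> \<omega>\<bar> \<le> d) \<Longrightarrow>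
       integrable N (\<lambda>\<omega>. \<eta> \<omega> * S' \<omega>) \<and> (\<integral>\<omega>. \<eta> \<omega> * S' \<omega> \<partial>N) = 0"
proof -
  define P where "P = (\<lambda>k \<omega>. \<Sum>i<k. (\<sigma> (Suc i) - \<sigma> i) * (\<zeta> i \<omega>)\<^sup>2)"
  define \<zeta>' where "\<zeta>' = (\<lambda>i \<omega>. if P (Suc i) \<omega> \<le> K then \<zeta> i \<omega> else 0)"
  define S' where "S' = (\<lambda>\<omega>. \<Sum>i<n. \<zeta>' i \<omega> * (W (\<sigma> (Suc i)) \<omega> - W (\<sigma> i) \<omega>))"
  have nonneg: "0 \<le> (\<sigma> (Suc i) - \<sigma> i) * (\<zeta> i \<omega>)\<^sup>2" if "i < n" for i \<omega>
    using \<sigma>(2)[OF that] by simp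
  have Pmono: "P i \<omega> \<le> P j \<omega>" if "i \<le> j" "j \<le> n" for i j \<omega>
    unfolding P_def using that nonneg by (intro sum_mono2) auto
  have bound: "0 \<le> \<sigma> i" "\<sigma> i \<le> T" if "i \<le> n" for i
    using grid_mono[where n = n and \<tau> = \<sigma>, OF \<sigma>(2), of 0 i] grid_mono[where n = n and \<tau> = \<sigma>, OF \<sigma>(2), of i n] \<sigma> that by auto
  have \<zeta>F: "\<zeta> j \<in> borel_measurable (F (\<sigma> i))" if "j \<le> i" "i < n" for i j
    by (rule F_measurable_mono[OF _ _ _ \<zeta>(1)[of j]])
       (use that bound[of j] bound[of i] grid_mono[where n = n and \<tau> = \<sigma>, OF \<sigma>(2), of j i] in auto)
  have \<zeta>N: "\<zeta> j \<in> borel_measurable N" if "j < n" for j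
    using F_measurable[OF _ _ \<zeta>(1)[OF that]] bound[of j] that by auto
  have \<zeta>'F: "\<zeta>' i \<in> borel_measurable (F (\<sigma> i))" if "i < n" for i
  proof -
    have "P (Suc i) \<in> borel_measurable (F (\<sigma> i))"
      unfolding P_def using \<zeta>F[of _ i] that
      by (intro borel_measurable_sum borel_measurable_times borel_measurable_power) auto
    then show ?thesis unfolding \<zeta>'_def using \<zeta>F[of i i] that by measurable
  qed
  have \<zeta>'c: "\<bar>\<zeta>' i \<omega>\<bar> \<le> c" if "i < n" "\<omega> \<in> space N" for i \<omega>
    using \<zeta>(2)[OF that] by (auto simp: \<zeta>'_def)
  note E = elementary_sum[where \<sigma> = \<sigma> and n = n and \<zeta> = \<zeta>' and c = c, OF \<sigma> \<zeta>'F \<zeta>'c]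
  have Em: "S' \<in> borel_measurable (F (\<sigma> n))" and Ei: "integrable N (\<lambda>\<omega>. (S' \<omega>)\<^sup>2)"
    and Ee: "(\<integral>\<omega>. (S' \<omega>)\<^sup>2 \<partial>N) = (\<integral>\<omega>. (\<Sum>i<n. (\<sigma> (Suc i) - \<sigma> i) * (\<zeta>' i \<omega>)\<^sup>2) \<partial>N)"
    and Eq: "integrable N (\<lambda>\<omega>. \<Sum>i<n. (\<sigma> (Suc i) - \<sigma> i) * (\<zeta>' i \<omega>)\<^sup>2)"
    and E\<eta>: "\<And>\<eta> d. \<eta> \<in> borel_measurable (F (\<sigma> 0)) \<Longrightarrow> (\<And>\<omega>. \<omega> \<in> space N \<Longrightarrow> \<bar>\<eta> \<omega>\<bar> \<le> d) \<Longrightarrow>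
       integrable N (\<lambda>\<omega>. \<eta> \<omega> * S' \<omega>) \<and> (\<integral>\<omega>. \<eta> \<omega> * S' \<omega> \<partial>N) = 0"
    unfolding S'_def using conjunct1[OF E] conjunct1[OF conjunct2[OF E]] conjunct1[OF conjunct2[OF conjunct2[OF E]]]
      conjunct1[OF conjunct2[OF conjunct2[OF conjunct2[OF E]]]]
      conjunct2[OF conjunct2[OF conjunct2[OF conjunct2[OF E]]]] by blast+
  have Qm: "Q \<in> borel_measurable N"
    unfolding Q_def using \<zeta>N
    by (intro borel_measurable_sum borel_measurable_times borel_measurable_power) auto
  \<comment> \<open>A step with P (Suc k) > K is skipped and adds nothing, while \<open>P\<close>
    only grows; an accepted step keeps the stopped sum below the current \<open>P\<close>, which is
    at most \<open>K\<close>.\<close>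
  have le: "(\<Sum>i<k. (\<sigma> (Suc i) - \<sigma> i) * (\<zeta>' i \<omega>)\<^sup>2) \<le> min K (P k \<omega>)" if "k \<le> n" for k \<omega>
    using that
  proof (induction k)
    case 0
    then show ?case using \<open>0 \<le> K\<close> by (simp add: P_def)
  next
    case (Suc k)
    have PS: "P (Suc k) \<omega> = P k \<omega> + (\<sigma> (Suc k) - \<sigma> k) * (\<zeta> k \<omega>)\<^sup>2" by (simp add: P_def)
    show ?case
    proof (cases "P (Suc k) \<omega> \<le> K")
      case True
      then show ?thesis using Suc PS by (auto simp: \<zeta>'_def)
    next
      case False
      then show ?thesis using Suc PS nonneg[of k \<omega>] by (auto simp: \<zeta>'_def)
    qed
  qed
  have QP: "Q \<omega> = P n \<omega>" for \<omega> by (simp add: Q_def P_def)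
  have Q0: "0 \<le> Q \<omega>" for \<omega> unfolding Q_def using nonneg by (intro sum_nonneg) auto
  show thesis
  proof (rule that)
    show "S' \<in> borel_measurable N" by (rule F_measurable[OF _ _ Em]) (use bound[of n] in auto)
    show "integrable N (\<lambda>\<omega>. (S' \<omega>)\<^sup>2)" by (rule Ei)
    show "Q \<in> borel_measurable N" by (rule Qm)
    have "(\<integral>\<omega>. (\<Sum>i<n. (\<sigma> (Suc i) - \<sigma> i) * (\<zeta>' i \<omega>)\<^sup>2) \<partial>N) \<le> (\<integral>\<omega>. min K (Q \<omega>) \<partial>N)"
    proof (rule integral_mono[OF Eq])
      show "integrable N (\<lambda>\<omega>. min K (Q \<omega>))"
        by (rule integrable_const_bound[where B = K]) (use Qm Q0 \<open>0 \<le> K\<close> in auto)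
      show "(\<Sum>i<n. (\<sigma> (Suc i) - \<sigma> i) * (\<zeta>' i \<omega>)\<^sup>2) \<le> min K (Q \<omega>)" for \<omega>
        unfolding QP by (rule le) simp
    qed
    then show "(\<integral>\<omega>. (S' \<omega>)\<^sup>2 \<partial>N) \<le> (\<integral>\<omega>. min K (Q \<omega>) \<partial>N)" unfolding Ee .
    show "S' \<omega> = S \<omega>" if "Q \<omega> \<le> K" for \<omega>
    proof -
      have "P (Suc i) \<omega> \<le> K" if "i < n" for i
        using Pmono[of "Suc i" n \<omega>] that \<open>Q \<omega> \<le> K\<close> QP[of \<omega>] by simp
      then show ?thesis unfolding S'_def S_def by (intro sum.cong) (auto simp: \<zeta>'_def)
    qed
    show "integrable N (\<lambda>\<omega>. \<eta> \<omega> * S' \<omega>) \<and> (\<integral>\<omega>. \<eta> \<omega> * S' \<omega> \<partial>N) = 0"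
      if "\<eta> \<in> borel_measurable (F (\<sigma> 0))" "\<And>\<omega>. \<omega> \<in> space N \<Longrightarrow> \<bar>\<eta> \<omega>\<bar> \<le> d" for \<eta> d
      using E\<eta> that by blast
  qed
qed

text \<open>An interval with integrand 0 is added at either end. A grid that spans {0..T} is needed
  to subtract a second integrand whose increments of \<open>W\<close> have to telescope over a whole
  interval.\<close>

lemma simple_data_extend:
  assumes sd: "simple_data N F T n \<tau> \<xi>" and "0 \<le> T"
  obtains n' \<tau>' \<xi>' where "simple_data N F T n' \<tau>' \<xi>'" "\<tau>' 0 = 0" "\<tau>' n' = T"
    "simple_process n' \<tau>' \<xi>' = simple_process n \<tau> \<xi>"
    "simple_integral W n' \<tau>' \<xi>' = simple_integral W n \<tau> \<xi>"
proof
  \<comment> \<open>The old grid is shifted by one index: interval 0 is the new one from 0 to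
    \<open>\<tau> 0\<close>, and interval n + 1 the new one from \<open>\<tau> n\<close> to
    \<open>T\<close>.\<close>
  define \<tau>' where "\<tau>' = (\<lambda>i. if i = 0 then 0 else if i \<le> Suc n then \<tau> (i - 1) else T)"
  define \<xi>' where "\<xi>' = (\<lambda>i (\<omega>::'a). if i = 0 \<or> n < i then 0 else \<xi> (i - 1) \<omega>)"
  have sd': "0 \<le> \<tau> 0" "\<tau> n \<le> T" "\<And>i. i < n \<Longrightarrow> \<tau> i \<le> \<tau> (Suc i)"
    "\<And>i. i < n \<Longrightarrow> \<xi> i \<in> borel_measurable (F (\<tau> i))"
    "\<And>i. i < n \<Longrightarrow> \<exists>c. \<forall>\<omega>\<in>space N. \<bar>\<xi> i \<omega>\<bar> \<le> c"
    using sd by (auto simp: simple_data_def)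
  show "simple_data N F T (Suc (Suc n)) \<tau>' \<xi>'"
    unfolding simple_data_def
  proof (intro conjI allI impI)
    fix i assume i: "i < Suc (Suc n)"
    show "\<tau>' i \<le> \<tau>' (Suc i)"
      using sd'(1,2) sd'(3)[of "i - 1"] i by (cases i) (auto simp: \<tau>'_def less_Suc_eq)
    show "\<xi>' i \<in> borel_measurable (F (\<tau>' i))"
      using sd'(4)[of "i - 1"] i by (cases "i = 0 \<or> n < i") (auto simp: \<tau>'_def \<xi>'_def)
    show "\<exists>c. \<forall>\<omega>\<in>space N. \<bar>\<xi>' i \<omega>\<bar> \<le> c"
      using sd'(5)[of "i - 1"] i by (cases "i = 0 \<or> n < i") (auto simp: \<xi>'_def)
  qed (auto simp: \<tau>'_def)
  show "\<tau>' 0 = 0" "\<tau>' (Suc (Suc n)) = T" by (simp_all add: \<tau>'_def)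
  have *: "(\<Sum>i<Suc (Suc n). \<xi>' i \<omega> * f (\<tau>' i) (\<tau>' (Suc i))) = (\<Sum>i<n. \<xi> i \<omega> * f (\<tau> i) (\<tau> (Suc i)))" for f \<omega>
  proof -
    have "(\<Sum>i<Suc (Suc n). \<xi>' i \<omega> * f (\<tau>' i) (\<tau>' (Suc i))) =
        (\<Sum>i<n. \<xi>' (Suc i) \<omega> * f (\<tau>' (Suc i)) (\<tau>' (Suc (Suc i))))"
      unfolding sum.lessThan_Suc_shift[of _ "Suc n"] sum.lessThan_Suc[of _ n] by (simp add: \<xi>'_def)
    also have "\<dots> = (\<Sum>i<n. \<xi> i \<omega> * f (\<tau> i) (\<tau> (Suc i)))"
      by (intro sum.cong) (auto simp: \<xi>'_def \<tau>'_def)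
    finally show ?thesis .
  qed
  show "simple_process (Suc (Suc n)) \<tau>' \<xi>' = simple_process n \<tau> \<xi>"
  proof (intro ext)
    fix s \<omega> show "simple_process (Suc (Suc n)) \<tau>' \<xi>' s \<omega> = simple_process n \<tau> \<xi> s \<omega>"
      unfolding simple_process_def by (rule *)
  qed
  show "simple_integral W (Suc (Suc n)) \<tau>' \<xi>' = simple_integral W n \<tau> \<xi>"
  proof (intro ext)
    fix t \<omega> show "simple_integral W (Suc (Suc n)) \<tau>' \<xi>' t \<omega> = simple_integral W n \<tau> \<xi> t \<omega>"
      unfolding simple_integral_def by (rule *)
  qed
qed

end

section \<open>Joint measurability and modes of convergence\<close>

lemma floor_approximation_tendsto:
  "(\<lambda>n. of_int \<lfloor>x * real (Suc n)\<rfloor> / real (Suc n)) \<longlonglongrightarrow> (x::real)"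
proof (rule LIMSEQ_I)
  let ?r = "\<lambda>n. of_int \<lfloor>x * real (Suc n)\<rfloor> / real (Suc n)"
  fix e :: real assume "0 < e"
  then obtain n0 where n0: "inverse (real (Suc n0)) < e" using reals_Archimedean by blast
  show "\<exists>n0. \<forall>n\<ge>n0. norm (?r n - x) < e"
  proof (intro exI allI impI)
    fix n assume n: "n0 \<le> n"
    have "of_int \<lfloor>x * real (Suc n)\<rfloor> \<le> x * real (Suc n)" "x * real (Suc n) < of_int \<lfloor>x * real (Suc n)\<rfloor> + 1"
      by linarith+
    then have "?r n \<le> x" "x < ?r n + inverse (real (Suc n))"
      by (auto simp: field_simps)
    moreover have "inverse (real (Suc n)) \<le> inverse (real (Suc n0))" using n by simp
    ultimately show "norm (?r n - x) < e" using n0 by (simp only: real_norm_def)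
  qed
qed

text \<open>When time is rounded down to a multiple of 1/(n+1), only countably many fixed times
  occur and measurability is immediate; continuity of the paths passes it to the limit.\<close>

lemma jointly_measurable_continuous:
  fixes X :: "real \<Rightarrow> 'a \<Rightarrow> real"
  assumes X: "\<And>t. X t \<in> borel_measurable M"
    and cont: "\<And>\<omega>. \<omega> \<in> space M \<Longrightarrow> continuous_on UNIV (\<lambda>t. X t \<omega>)"
    and f [measurable]: "f \<in> borel_measurable L" and g [measurable]: "g \<in> measurable L M"
  shows "(\<lambda>x. X (f x) (g x)) \<in> borel_measurable L"
proof (rule borel_measurable_LIMSEQ_real)
  let ?r = "\<lambda>n x. of_int \<lfloor>f x * real (Suc n)\<rfloor> / real (Suc n)"
  show "(\<lambda>x. X (?r n x) (g x)) \<in> borel_measurable L" for n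
  proof (rule measurable_compose_countable[where f = "\<lambda>i x. X (of_int i / real (Suc n)) (g x)"
        and g = "\<lambda>x. \<lfloor>f x * real (Suc n)\<rfloor>"])
    show "(\<lambda>x. X (of_int i / real (Suc n)) (g x)) \<in> borel_measurable L" for i :: int
      by (rule measurable_compose[OF g X])
  qed measurable
  fix x assume x: "x \<in> space L"
  have "(\<lambda>n. ?r n x) \<longlonglongrightarrow> f x" by (rule floor_approximation_tendsto)
  then show "(\<lambda>n. X (?r n x) (g x)) \<longlonglongrightarrow> X (f x) (g x)"
    using cont[of "g x"] measurable_space[OF g x] 
    by (intro continuous_on_tendsto_compose[where f = "\<lambda>t. X t (g x)"]) auto
qed

text \<open>Since X <= 1, it is at most e/2 plus the indicator of the event X > e/2.\<close>

lemma (in prob_space) expectation_tendsto_0_if_in_probability: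
  fixes X :: "nat \<Rightarrow> 'a \<Rightarrow> real"
  assumes [measurable]: "\<And>m. X m \<in> borel_measurable M"
    and X: "\<And>m \<omega>. 0 \<le> X m \<omega>" "\<And>m \<omega>. X m \<omega> \<le> 1"
    and lim: "\<And>\<epsilon>. 0 < \<epsilon> \<Longrightarrow> (\<lambda>m. prob {\<omega>\<in>space M. \<epsilon> < X m \<omega>}) \<longlonglongrightarrow> 0"
  shows "(\<lambda>m. expectation (X m)) \<longlonglongrightarrow> 0"
proof (rule LIMSEQ_I)
  fix e :: real assume e: "0 < e"
  have le: "expectation (X m) \<le> e / 2 + prob {\<omega>\<in>space M. e / 2 < X m \<omega>}" for m
  proof -
    have "expectation (X m) \<le> expectation (\<lambda>\<omega>. e / 2 + indicator {\<omega>\<in>space M. e / 2 < X m \<omega>} \<omega>)"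
    proof (rule integral_mono)
      show "integrable M (X m)" by (rule integrable_const_bound[where B = 1]) (use X in auto)
      show "X m \<omega> \<le> e / 2 + indicator {\<omega>\<in>space M. e / 2 < X m \<omega>} \<omega>" if "\<omega> \<in> space M" for \<omega>
        using X(2)[of m \<omega>] that e by (auto simp: indicator_def)
      show "integrable M (\<lambda>\<omega>. e / 2 + indicator {\<omega>\<in>space M. e / 2 < X m \<omega>} \<omega> :: real)"
        by (rule integrable_const_bound[where B = "e / 2 + 1"]) (use e in \<open>auto simp: indicator_def\<close>)
    qed
    also have "\<dots> = e / 2 + prob {\<omega>\<in>space M. e / 2 < X m \<omega>}"
      by (subst Bochner_Integration.integral_add)
         (auto simp: prob_space emeasure_eq_measure intro!: integrable_real_indicator)
    finally show ?thesis .
  qed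
  obtain n0 where n0: "\<And>m. m \<ge> n0 \<Longrightarrow> prob {\<omega>\<in>space M. e / 2 < X m \<omega>} < e / 2"
    using order_tendstoD(2)[OF lim[of "e / 2"], of "e / 2"] e by (auto simp: eventually_sequentially)
  have "norm (expectation (X m) - 0) < e" if "n0 \<le> m" for m
    using n0[OF that] le[of m] Bochner_Integration.integral_nonneg[where M = M and f = "X m"] X(1) by simp
  then show "\<exists>n0. \<forall>m\<ge>n0. norm (expectation (X m) - 0) < e" by blast
qed

lemma (in prob_space) integrable_if_square_integrable:
  fixes f :: "'a \<Rightarrow> real"
  assumes "f \<in> borel_measurable M" "integrable M (\<lambda>x. (f x)\<^sup>2)"
  shows "integrable M f"
  using integrable_mult_of_squares[OF assms(1), of "\<lambda>_. 1"] assms by simp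

text \<open>A bound in L2 gives uniform integrability, here by hand: v <= min v L + v^2 / L. The
  truncated part converges by dominated convergence, the other one has expectation at most D /
  L.\<close>

lemma (in prob_space) L1_convergence_if_L2_bounded:
  fixes f :: "nat \<Rightarrow> 'a \<Rightarrow> real"
  assumes [measurable]: "\<And>m. f m \<in> borel_measurable M" "g \<in> borel_measurable M"
    and f: "\<And>m. integrable M (\<lambda>x. (f m x)\<^sup>2)" "\<And>m. expectation (\<lambda>x. (f m x)\<^sup>2) \<le> B"
    and g: "integrable M (\<lambda>x. (g x)\<^sup>2)"
    and lim: "AE x in M. (\<lambda>m. f m x) \<longlonglongrightarrow> g x"
  shows "(\<lambda>m. expectation (\<lambda>x. \<bar>f m x - g x\<bar>)) \<longlonglongrightarrow> 0"
proof (rule LIMSEQ_I)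
  fix e :: real assume e: "0 < e"
  define D where "D = 2 * B + 2 * expectation (\<lambda>x. (g x)\<^sup>2)"
  \<comment> \<open>This makes D / L smaller than e / 2, with the added 1 keeping \<open>L\<close>
    positive.\<close>
  define L where "L = 2 * (\<bar>D\<bar> + 1) / e"
  have L: "0 < L" using e by (simp add: L_def)
  have DL: "D / L < e / 2"
  proof -
    have "D < \<bar>D\<bar> + 1" by linarith
    then have "D * e < (\<bar>D\<bar> + 1) * e" using e by simp
    then show ?thesis using e L by (simp add: L_def field_simps)
  qed
  have i1: "integrable M (\<lambda>x. min \<bar>f m x - g x\<bar> L)" for m
    by (rule integrable_const_bound[where B = L]) (use L in auto)
  have i2: "integrable M (\<lambda>x. \<bar>f m x - g x\<bar>)" for m
    using integrable_if_square_integrable[of "f m"] integrable_if_square_integrable[of g] f g by simp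
  have le: "expectation (\<lambda>x. \<bar>f m x - g x\<bar>) \<le> expectation (\<lambda>x. min \<bar>f m x - g x\<bar> L) + D / L" for m
  proof -
    have "expectation (\<lambda>x. \<bar>f m x - g x\<bar>) \<le>
        expectation (\<lambda>x. min \<bar>f m x - g x\<bar> L + (2 * (f m x)\<^sup>2 + 2 * (g x)\<^sup>2) / L)"
    proof (rule integral_mono[OF i2])
      show "integrable M (\<lambda>x. min \<bar>f m x - g x\<bar> L + (2 * (f m x)\<^sup>2 + 2 * (g x)\<^sup>2) / L)"
        using i1 f g by simp
      fix x
      define v where "v = \<bar>f m x - g x\<bar>"
      have "v \<le> min v L + v\<^sup>2 / L"
      proof (cases "v \<le> L")
        case False
        then have "L * v \<le> v * v" by (intro mult_right_mono) (auto simp: v_def)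
        then show ?thesis using False L by (simp add: field_simps power2_eq_square add_increasing)
      qed (use L in simp)
      also have "v\<^sup>2 / L \<le> (2 * (f m x)\<^sup>2 + 2 * (g x)\<^sup>2) / L"
      proof (rule divide_right_mono)
        have "0 \<le> (f m x + g x)\<^sup>2" by simp
        then show "v\<^sup>2 \<le> 2 * (f m x)\<^sup>2 + 2 * (g x)\<^sup>2"
          by (simp add: v_def power2_eq_square algebra_simps)
      qed (use L in simp)
      finally show "\<bar>f m x - g x\<bar> \<le> min \<bar>f m x - g x\<bar> L + (2 * (f m x)\<^sup>2 + 2 * (g x)\<^sup>2) / L"
        by (simp add: v_def)
    qed
    also have "\<dots> = expectation (\<lambda>x. min \<bar>f m x - g x\<bar> L) +
        (2 * expectation (\<lambda>x. (f m x)\<^sup>2) + 2 * expectation (\<lambda>x. (g x)\<^sup>2)) / L"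
      using i1[of m] f(1)[of m] g by simp
    also have "\<dots> \<le> expectation (\<lambda>x. min \<bar>f m x - g x\<bar> L) + D / L"
      using f(2)[of m] L by (intro add_left_mono divide_right_mono) (auto simp: D_def)
    finally show ?thesis .
  qed
  have "(\<lambda>m. expectation (\<lambda>x. min \<bar>f m x - g x\<bar> L)) \<longlonglongrightarrow> expectation (\<lambda>x. 0)"
  proof (rule integral_dominated_convergence[where w = "\<lambda>_. L"])
    show "AE x in M. (\<lambda>m. min \<bar>f m x - g x\<bar> L) \<longlonglongrightarrow> 0"
      using lim
    proof eventually_elim
      case (elim x)
      have "(\<lambda>m. min \<bar>f m x - g x\<bar> L) \<longlonglongrightarrow> min \<bar>g x - g x\<bar> L"
        by (intro tendsto_intros elim)
      then show ?case using L by simp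
    qed
    show "AE x in M. norm (min \<bar>f m x - g x\<bar> L) \<le> L" for m using L by auto
  qed auto
  then have "(\<lambda>m. expectation (\<lambda>x. min \<bar>f m x - g x\<bar> L)) \<longlonglongrightarrow> 0" by simp
  then obtain n0 where n0: "\<And>m. m \<ge> n0 \<Longrightarrow> expectation (\<lambda>x. min \<bar>f m x - g x\<bar> L) < e / 2"
    using order_tendstoD(2)[of _ 0 sequentially "e / 2"] e by (auto simp: eventually_sequentially)
  have "norm (expectation (\<lambda>x. \<bar>f m x - g x\<bar>) - 0) < e" if "n0 \<le> m" for m
  proof -
    have "0 \<le> expectation (\<lambda>x. \<bar>f m x - g x\<bar>)" by simp
    then show ?thesis using n0[OF that] le[of m] DL unfolding real_norm_def by linarith
  qed
  then show "\<exists>n0. \<forall>m\<ge>n0. norm (expectation (\<lambda>x. \<bar>f m x - g x\<bar>) - 0) < e" by blast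
qed

context brownian_filtration
begin

text \<open>\<open>j\<close> is the integral process of \<open>k\<close>. The variable \<open>S\<close> is the integral of \<open>k - h\<close> over \<open>{s<..t}\<close>,
  stopped before its quadratic variation \<open>Q\<close> exceeds the constant \<open>K\<close>.\<close>

definition stopped_approximation ::
    "real \<Rightarrow> real \<Rightarrow> real \<Rightarrow> ('a \<Rightarrow> real) \<Rightarrow> (real \<Rightarrow> 'a \<Rightarrow> real) \<Rightarrow> (real \<Rightarrow> 'a \<Rightarrow> real) \<Rightarrow>
     ('a \<Rightarrow> real) \<Rightarrow> ('a \<Rightarrow> real) \<Rightarrow> bool" where
  "stopped_approximation s t K h k j Q S \<longleftrightarrow>
     Q \<in> borel_measurable N \<and> S \<in> borel_measurable N \<and> integrable N (\<lambda>\<omega>. (S \<omega>)\<^sup>2) \<and>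
     (\<integral>\<omega>. (S \<omega>)\<^sup>2 \<partial>N) \<le> (\<integral>\<omega>. min K (Q \<omega>) \<partial>N) \<and>
     (\<forall>\<omega>. 0 \<le> Q \<omega>) \<and>
     (\<forall>\<omega>. ennreal (Q \<omega>) \<le> (\<integral>\<^sup>+r. ennreal ((k r \<omega> - h \<omega>)\<^sup>2) * indicator {s<..t} r \<partial>lborel)) \<and>
     (\<forall>\<omega>\<in>space N. Q \<omega> \<le> K \<longrightarrow> S \<omega> = j t \<omega> - j s \<omega> - h \<omega> * (W t \<omega> - W s \<omega>)) \<and>
     (\<forall>\<eta> d. \<eta> \<in> borel_measurable (F s) \<longrightarrow> (\<forall>\<omega>\<in>space N. \<bar>\<eta> \<omega>\<bar> \<le> d) \<longrightarrow>
        integrable N (\<lambda>\<omega>. \<eta> \<omega> * S \<omega>) \<and> (\<integral>\<omega>. \<eta> \<omega> * S \<omega> \<partial>N) = 0)"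

text \<open>Clamping the grid points to {s..t} leaves exactly the increments of \<open>W\<close>
  inside this interval, and they telescope. Hence h * (W t - W s) is an elementary sum on the same
  grid, and the difference of the two integrals can be stopped as one sum.\<close>

lemma clamped_simple_integral_aux:
  assumes sd: "simple_data N F T n \<tau> \<xi>" and ends: "\<tau> 0 = 0" "\<tau> n = T"
    and st: "0 \<le> s" "s < t" "t \<le> T"
    and h: "h \<in> borel_measurable (F s)" "\<And>\<omega>. \<omega> \<in> space N \<Longrightarrow> \<bar>h \<omega>\<bar> \<le> C" and K: "0 \<le> K"
  shows "\<exists>Q S. stopped_approximation s t K h (simple_process n \<tau> \<xi>) (simple_integral W n \<tau> \<xi>) Q S"
proof -
  define \<sigma> where "\<sigma> = (\<lambda>i. max s (min t (\<tau> i)))"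
  \<comment> \<open>Where clamping collapses an interval the value must be 0: a grid point beyond
    \<open>t\<close> is moved back to \<open>t\<close>, and \<open>\<xi> i\<close> need not be known
    by then. On an interval of positive length clamping can only move the left end forward.\<close>
  define \<zeta> where "\<zeta> = (\<lambda>i \<omega>. if \<sigma> i < \<sigma> (Suc i) then \<xi> i \<omega> - h \<omega> else 0)"
  have sd': "\<And>i. i < n \<Longrightarrow> \<tau> i \<le> \<tau> (Suc i)" "\<And>i. i < n \<Longrightarrow> \<xi> i \<in> borel_measurable (F (\<tau> i))"
    "\<And>i. i < n \<Longrightarrow> \<exists>c. \<forall>\<omega>\<in>space N. \<bar>\<xi> i \<omega>\<bar> \<le> c"
    using sd by (auto simp: simple_data_def)
  have "\<exists>c. \<forall>i. i < n \<longrightarrow> (\<forall>\<omega>\<in>space N. \<bar>\<xi> i \<omega>\<bar> \<le> c i)"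
    using sd'(3) by (intro choice) blast
  then obtain c where c: "\<And>i \<omega>. i < n \<Longrightarrow> \<omega> \<in> space N \<Longrightarrow> \<bar>\<xi> i \<omega>\<bar> \<le> c i" by blast
  have \<tau>0: "0 \<le> \<tau> i" if "i \<le> n" for i
    using grid_mono[where n = n and \<tau> = \<tau>, OF sd'(1), of 0 i] ends that by simp
  have \<sigma>s: "\<sigma> 0 = s" "\<sigma> n = t" using st ends by (auto simp: \<sigma>_def)
  have \<sigma>m: "\<sigma> i \<le> \<sigma> (Suc i)" if "i < n" for i
    using sd'(1)[OF that] by (auto simp: \<sigma>_def)
  have \<zeta>F: "\<zeta> i \<in> borel_measurable (F (\<sigma> i))" if i: "i < n" for i
  proof (cases "\<sigma> i < \<sigma> (Suc i)")
    case True
    then have *: "\<tau> i \<le> \<sigma> i" "s \<le> \<sigma> i" "\<sigma> i \<le> T"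
      using st by (auto simp: \<sigma>_def)
    have "\<xi> i \<in> borel_measurable (F (\<sigma> i))" "h \<in> borel_measurable (F (\<sigma> i))"
      using F_measurable_mono[OF \<tau>0 *(1,3) sd'(2)] F_measurable_mono[OF st(1) *(2,3) h(1)] i by auto
    then show ?thesis using True by (simp add: \<zeta>_def)
  qed (simp add: \<zeta>_def)
  have \<zeta>c: "\<bar>\<zeta> i \<omega>\<bar> \<le> (\<Sum>j<n. \<bar>c j\<bar>) + \<bar>C\<bar>" if "i < n" "\<omega> \<in> space N" for i \<omega>
  proof -
    have "\<bar>c i\<bar> \<le> (\<Sum>j<n. \<bar>c j\<bar>)" using that by (intro member_le_sum) auto
    then show ?thesis using c[OF that] h(2)[OF that(2)] by (auto simp: \<zeta>_def)
  qed
  define S0 where "S0 = (\<lambda>\<omega>. \<Sum>i<n. \<zeta> i \<omega> * (W (\<sigma> (Suc i)) \<omega> - W (\<sigma> i) \<omega>))"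
  define Q where "Q = (\<lambda>\<omega>. \<Sum>i<n. (\<sigma> (Suc i) - \<sigma> i) * (\<zeta> i \<omega>)\<^sup>2)"
  obtain S where S: "S \<in> borel_measurable N" "integrable N (\<lambda>\<omega>. (S \<omega>)\<^sup>2)"
    "Q \<in> borel_measurable N" "(\<integral>\<omega>. (S \<omega>)\<^sup>2 \<partial>N) \<le> (\<integral>\<omega>. min K (Q \<omega>) \<partial>N)"
    "\<And>\<omega>. \<omega> \<in> space N \<Longrightarrow> Q \<omega> \<le> K \<Longrightarrow> S \<omega> = S0 \<omega>"
    "\<And>\<eta> d. \<eta> \<in> borel_measurable (F (\<sigma> 0)) \<Longrightarrow> (\<And>\<omega>. \<omega> \<in> space N \<Longrightarrow> \<bar>\<eta> \<omega>\<bar> \<le> d) \<Longrightarrow>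
       integrable N (\<lambda>\<omega>. \<eta> \<omega> * S \<omega>) \<and> (\<integral>\<omega>. \<eta> \<omega> * S \<omega> \<partial>N) = 0"
    using stopped_sum[of \<sigma> n \<zeta>, OF _ \<sigma>m _ \<zeta>F \<zeta>c K] \<sigma>s st unfolding Q_def S0_def by auto
  have S0: "S0 \<omega> = simple_integral W n \<tau> \<xi> t \<omega> - simple_integral W n \<tau> \<xi> s \<omega> - h \<omega> * (W t \<omega> - W s \<omega>)" for \<omega>
  proof -
    \<comment> \<open>Evaluation at a clamped time separates into the two stopped times that define
      the integrals up to \<open>t\<close> and up to \<open>s\<close>.\<close>
    have W\<sigma>: "W (\<sigma> i) \<omega> = W (min (\<tau> i) t) \<omega> - W (min (\<tau> i) s) \<omega> + W s \<omega>" for i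
      using st by (auto simp: \<sigma>_def max_def min_def)
    have "S0 \<omega> = (\<Sum>i<n. (\<xi> i \<omega> - h \<omega>) * (W (\<sigma> (Suc i)) \<omega> - W (\<sigma> i) \<omega>))"
      unfolding S0_def using \<sigma>m by (intro sum.cong) (force simp: \<zeta>_def)+
    also have "\<dots> = (\<Sum>i<n. \<xi> i \<omega> * (W (\<sigma> (Suc i)) \<omega> - W (\<sigma> i) \<omega>)) - h \<omega> * (\<Sum>i<n. W (\<sigma> (Suc i)) \<omega> - W (\<sigma> i) \<omega>)"
      by (simp only: left_diff_distrib sum_distrib_left
          sum_subtractf[where g = "\<lambda>i. h \<omega> * (W (\<sigma> (Suc i)) \<omega> - W (\<sigma> i) \<omega>)"])
    also have "(\<Sum>i<n. W (\<sigma> (Suc i)) \<omega> - W (\<sigma> i) \<omega>) = W t \<omega> - W s \<omega>"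
      using sum_lessThan_telescope[of "\<lambda>i. W (\<sigma> i) \<omega>" n] \<sigma>s by simp
    also have "(\<Sum>i<n. \<xi> i \<omega> * (W (\<sigma> (Suc i)) \<omega> - W (\<sigma> i) \<omega>)) =
       simple_integral W n \<tau> \<xi> t \<omega> - simple_integral W n \<tau> \<xi> s \<omega>"
      unfolding simple_integral_def sum_subtractf[symmetric] W\<sigma> by (intro sum.cong) (auto simp: algebra_simps)
    finally show ?thesis .
  qed
  have Qint: "ennreal (Q \<omega>) \<le> (\<integral>\<^sup>+r. ennreal ((simple_process n \<tau> \<xi> r \<omega> - h \<omega>)\<^sup>2) * indicator {s<..t} r \<partial>lborel)" for \<omega>
  proof -
    have "ennreal (Q \<omega>) = (\<Sum>i<n. ennreal ((\<zeta> i \<omega>)\<^sup>2) * emeasure lborel {\<sigma> i<..\<sigma> (Suc i)})"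
      unfolding Q_def using \<sigma>m by (subst sum_ennreal[symmetric]) (auto simp: ennreal_mult' mult.commute intro!: sum.cong)
    also have "\<dots> = (\<Sum>i<n. \<integral>\<^sup>+r. ennreal ((\<zeta> i \<omega>)\<^sup>2) * indicator {\<sigma> i<..\<sigma> (Suc i)} r \<partial>lborel)"
      by (intro sum.cong refl nn_integral_cmult_indicator[symmetric]) simp
    also have "\<dots> = (\<integral>\<^sup>+r. (\<Sum>i<n. ennreal ((\<zeta> i \<omega>)\<^sup>2) * indicator {\<sigma> i<..\<sigma> (Suc i)} r) \<partial>lborel)"
      by (rule nn_integral_sum[symmetric]) simp
    also have "\<dots> \<le> (\<integral>\<^sup>+r. ennreal ((simple_process n \<tau> \<xi> r \<omega> - h \<omega>)\<^sup>2) * indicator {s<..t} r \<partial>lborel)"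
    proof (rule nn_integral_mono)
      fix r
      have "(\<Sum>i<n. ennreal ((\<zeta> i \<omega>)\<^sup>2) * indicator {\<sigma> i<..\<sigma> (Suc i)} r) =
          (\<Sum>i<n. ennreal ((\<zeta> i \<omega>)\<^sup>2 * indicator {\<sigma> i<..\<sigma> (Suc i)} r))"
        by (intro sum.cong) (auto simp: indicator_def)
      also have "\<dots> = ennreal (\<Sum>i<n. (\<zeta> i \<omega>)\<^sup>2 * indicator {\<sigma> i<..\<sigma> (Suc i)} r)"
        by (rule sum_ennreal) simp
      also have "\<dots> \<le> ennreal ((simple_process n \<tau> \<xi> r \<omega> - h \<omega>)\<^sup>2 * indicator {s<..t} r)"
      \<comment> \<open>If \<open>r\<close> lies in a clamped interval, it lies in the original
        interval of the same index and between \<open>s\<close> and \<open>t\<close>; the simple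
        process then has the value \<open>\<xi> i\<close> there.\<close>
      proof (rule ennreal_leI, cases "\<exists>i<n. \<sigma> i < r \<and> r \<le> \<sigma> (Suc i)")
        case True
        then obtain i where i: "i < n" "\<sigma> i < r" "r \<le> \<sigma> (Suc i)" by blast
        then have r: "s < r" "r \<le> t" "\<tau> i < r" "r \<le> \<tau> (Suc i)"
          using st by (auto simp: \<sigma>_def)
        have "(\<Sum>i<n. (\<zeta> i \<omega>)\<^sup>2 * indicator {\<sigma> i<..\<sigma> (Suc i)} r) = (\<zeta> i \<omega>)\<^sup>2"
          by (rule step_sum[where \<tau> = \<sigma>, OF \<sigma>m i])
        moreover have "simple_process n \<tau> \<xi> r \<omega> = \<xi> i \<omega>"
          unfolding simple_process_def by (rule step_sum[where \<tau> = \<tau>, OF sd'(1) i(1) r(3,4)])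
        ultimately show "(\<Sum>i<n. (\<zeta> i \<omega>)\<^sup>2 * indicator {\<sigma> i<..\<sigma> (Suc i)} r) \<le>
            (simple_process n \<tau> \<xi> r \<omega> - h \<omega>)\<^sup>2 * indicator {s<..t} r"
          using r i by (simp add: \<zeta>_def)
      next
        case False
        then have "(\<Sum>i<n. (\<zeta> i \<omega>)\<^sup>2 * indicator {\<sigma> i<..\<sigma> (Suc i)} r) = 0"
          by (intro sum.neutral) auto
        then show "(\<Sum>i<n. (\<zeta> i \<omega>)\<^sup>2 * indicator {\<sigma> i<..\<sigma> (Suc i)} r) \<le>
            (simple_process n \<tau> \<xi> r \<omega> - h \<omega>)\<^sup>2 * indicator {s<..t} r" by simp
      qed
      also have "\<dots> = ennreal ((simple_process n \<tau> \<xi> r \<omega> - h \<omega>)\<^sup>2) * indicator {s<..t} r"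
        by (simp add: indicator_def)
      finally show "(\<Sum>i<n. ennreal ((\<zeta> i \<omega>)\<^sup>2) * indicator {\<sigma> i<..\<sigma> (Suc i)} r) \<le>
        ennreal ((simple_process n \<tau> \<xi> r \<omega> - h \<omega>)\<^sup>2) * indicator {s<..t} r" .
    qed
    finally show ?thesis .
  qed
  have Q0: "0 \<le> Q \<omega>" for \<omega>
    unfolding Q_def using \<sigma>m by (intro sum_nonneg mult_nonneg_nonneg) auto
  show ?thesis
    unfolding stopped_approximation_def
  proof (rule exI[of _ Q], rule exI[of _ S], intro conjI allI impI ballI)
    fix \<eta> :: "'a \<Rightarrow> real" and d
    assume "\<eta> \<in> borel_measurable (F s)" "\<forall>\<omega>\<in>space N. \<bar>\<eta> \<omega>\<bar> \<le> d"
    then show "integrable N (\<lambda>\<omega>. \<eta> \<omega> * S \<omega>)" "(\<integral>\<omega>. \<eta> \<omega> * S \<omega> \<partial>N) = 0"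
      using S(6)[of \<eta> d] \<sigma>s by auto
  qed (use S Qint Q0 S0 in auto)
qed

lemma clamped_simple_integral:
  assumes sd: "simple_data N F T n \<tau> \<xi>"
    and st: "0 \<le> s" "s < t" "t \<le> T"
    and h: "h \<in> borel_measurable (F s)" "\<And>\<omega>. \<omega> \<in> space N \<Longrightarrow> \<bar>h \<omega>\<bar> \<le> C" and K: "0 \<le> K"
  shows "\<exists>Q S. stopped_approximation s t K h (simple_process n \<tau> \<xi>) (simple_integral W n \<tau> \<xi>) Q S"
proof -
  have "0 \<le> T" using st by simp
  from simple_data_extend[OF sd this] obtain n' \<tau>' \<xi>' where
    e: "simple_data N F T n' \<tau>' \<xi>'" "\<tau>' 0 = 0" "\<tau>' n' = T"
      "simple_process n' \<tau>' \<xi>' = simple_process n \<tau> \<xi>" "simple_integral W n' \<tau>' \<xi>' = simple_integral W n \<tau> \<xi>" .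
  from clamped_simple_integral_aux[OF e(1-3) st h K] show ?thesis unfolding e(4,5) .
qed

end

text \<open>The approximating simple processes converge in probability only. On the event that their quadratic
  distance to \<open>H\<close> is small, which has probability tending to one, the stopped approximations agree
  with the unstopped ones, and they are bounded in \<open>L\<^sup>2\<close>.\<close>

lemma ito_increment:
  fixes M :: "'a measure" and F :: "real \<Rightarrow> 'a measure" and H I W :: "real \<Rightarrow> 'a \<Rightarrow> real"
  assumes bf: "brownian_filtration (completion M) F T W"
    and ito: "ito_integral M F T W H I"
    and Hcont: "\<And>\<omega>. \<omega> \<in> space M \<Longrightarrow> continuous_on {0..T} (\<lambda>r. H r \<omega>)"
    and HF: "\<And>r. 0 \<le> r \<Longrightarrow> r \<le> T \<Longrightarrow> H r \<in> borel_measurable (F r)"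
    and HC: "\<And>r \<omega>. 0 \<le> r \<Longrightarrow> r \<le> T \<Longrightarrow> \<omega> \<in> space M \<Longrightarrow> \<bar>H r \<omega>\<bar> \<le> C"
    and st: "0 \<le> s" "s < t" "t \<le> T"
  defines "V \<equiv> \<lambda>\<omega>. I t \<omega> - I s \<omega> - H s \<omega> * (W t \<omega> - W s \<omega>)"
  shows ito_increment_measurable: "V \<in> borel_measurable (completion M)"
    and ito_increment_square_integrable: "integrable (completion M) (\<lambda>\<omega>. (V \<omega>)\<^sup>2)"
    and ito_increment_second_moment: "\<And>e. (\<And>r. s \<le> r \<Longrightarrow> r \<le> t \<Longrightarrow> (\<integral>\<omega>. (H r \<omega> - H s \<omega>)\<^sup>2 \<partial>completion M) \<le> e) \<Longrightarrow>
       (\<integral>\<omega>. (V \<omega>)\<^sup>2 \<partial>completion M) \<le> 2 * e * (t - s)"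
    and ito_increment_orthogonal: "\<And>\<eta> d. \<eta> \<in> borel_measurable (F s) \<Longrightarrow> (\<And>\<omega>. \<omega> \<in> space M \<Longrightarrow> \<bar>\<eta> \<omega>\<bar> \<le> d) \<Longrightarrow>
       integrable (completion M) (\<lambda>\<omega>. \<eta> \<omega> * V \<omega>) \<and> (\<integral>\<omega>. \<eta> \<omega> * V \<omega> \<partial>completion M) = 0"
proof -
  define N where "N = completion M"
  have spN [simp]: "space N = space M" by (simp add: N_def)
  interpret N: brownian_filtration N F T W using bf by (simp add: N_def)
  have T: "0 \<le> T" using st by simp
  obtain n \<tau> \<xi> where sd: "\<And>m. simple_data M F T (n m) (\<tau> m) (\<xi> m)"
    and dist: "\<And>\<epsilon>. 0 < \<epsilon> \<Longrightarrow> (\<lambda>m. measure N {\<omega>\<in>space M. ennreal \<epsilon> <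
         (\<integral>\<^sup>+s\<in>{0..T}. ennreal ((simple_process (n m) (\<tau> m) (\<xi> m) s \<omega> - H s \<omega>)\<^sup>2) \<partial>lborel)}) \<longlonglongrightarrow> 0"
    and conv: "\<And>t \<epsilon>. t \<in> {0..T} \<Longrightarrow> 0 < \<epsilon> \<Longrightarrow> (\<lambda>m. measure N {\<omega>\<in>space M.
         \<epsilon> < \<bar>simple_integral W (n m) (\<tau> m) (\<xi> m) t \<omega> - I t \<omega>\<bar>}) \<longlonglongrightarrow> 0"
    using ito unfolding ito_integral_def N_def by blast
  have IF: "I r \<in> borel_measurable (F r)" if "0 \<le> r" "r \<le> T" for r
    using ito that by (auto simp: ito_integral_def adapted_process_def)
  have IN [measurable]: "I t \<in> borel_measurable N" "I s \<in> borel_measurable N"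
    using N.F_measurable[OF _ _ IF] st by auto
  define K where "K = (\<lambda>m. simple_process (n m) (\<tau> m) (\<xi> m))"
  define J where "J = (\<lambda>m. simple_integral W (n m) (\<tau> m) (\<xi> m))"
  have sdN: "simple_data N F T (n m) (\<tau> m) (\<xi> m)" for m
    using sd[of m] by (simp add: simple_data_def)
  have bnd: "0 \<le> \<tau> m i \<and> \<tau> m i \<le> T" if "i \<le> n m" for m i
  proof -
    have "\<And>i. i < n m \<Longrightarrow> \<tau> m i \<le> \<tau> m (Suc i)" "0 \<le> \<tau> m 0" "\<tau> m (n m) \<le> T"
      using sd[of m] by (auto simp: simple_data_def)
    then show ?thesis
      using grid_mono[where n = "n m" and \<tau> = "\<tau> m", of 0 i] grid_mono[where n = "n m" and \<tau> = "\<tau> m", of i "n m"] that by fastforce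
  qed
  have \<xi>N: "\<xi> m i \<in> borel_measurable N" if "i < n m" for m i
    by (rule N.F_measurable[of "\<tau> m i"]) (use sd[of m] bnd[of i m] that in \<open>auto simp: simple_data_def\<close>)
  have WN: "W r \<in> borel_measurable N" if "0 \<le> r" "r \<le> T" for r
    using N.W_measurable_N that by blast
  have JN: "J m r \<in> borel_measurable N" if "0 \<le> r" "r \<le> T" for m r
    unfolding J_def simple_integral_def[abs_def]
    using \<xi>N[of _ m] bnd[of _ m] T that
    by (intro borel_measurable_sum borel_measurable_times borel_measurable_diff WN) (auto simp: min_def)
  \<comment> \<open>Freezing \<open>H\<close> outside {0..T} gives paths continuous on the whole
    line, as joint measurability requires.\<close>
  define Hc where "Hc = (\<lambda>r. H (max 0 (min T r)))"
  have HcN: "Hc r \<in> borel_measurable N" for r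
    unfolding Hc_def by (rule N.F_measurable[of "max 0 (min T r)"]) (use HF T in auto)
  have Hccont: "continuous_on UNIV (\<lambda>r. Hc r \<omega>)" if "\<omega> \<in> space N" for \<omega>
    unfolding Hc_def
    by (rule continuous_on_compose2[OF Hcont]) (use that T in \<open>auto intro!: continuous_intros\<close>)
  have Hc_eq: "Hc r = H r" if "0 \<le> r" "r \<le> T" for r
    using that by (simp add: Hc_def)
  have HcC: "\<bar>Hc r \<omega>\<bar> \<le> C" if "\<omega> \<in> space M" for r \<omega>
    unfolding Hc_def using HC[of "max 0 (min T r)" \<omega>] T that by auto
  have Hc_joint [measurable (raw)]: "(\<lambda>x. Hc (f x) (g x)) \<in> borel_measurable L"
    if "f \<in> borel_measurable L" "g \<in> measurable L N" for f g and L :: "('a \<times> real) measure"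
    by (rule jointly_measurable_continuous[OF HcN Hccont that])
  define h where "h = H s"
  have hF: "h \<in> borel_measurable (F s)" using HF st by (simp add: h_def)
  have hN [measurable]: "h \<in> borel_measurable N" using N.F_measurable[OF _ _ hF] st by auto
  have hC: "\<bar>h \<omega>\<bar> \<le> C" if "\<omega> \<in> space M" for \<omega> using HC st that by (simp add: h_def)
  have KN: "(\<lambda>(\<omega>, r). K m r \<omega>) \<in> borel_measurable (N \<Otimes>\<^sub>M lborel)" for m
    unfolding K_def simple_process_def split_beta'
    using \<xi>N[of _ m] by (intro borel_measurable_sum borel_measurable_times)
      (auto intro!: measurable_compose[OF measurable_fst] measurable_compose[OF measurable_snd])
  have KN' [measurable]: "(\<lambda>x. K m (snd x) (fst x)) \<in> borel_measurable (N \<Otimes>\<^sub>M lborel)" for m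
    using KN[of m] by (simp add: split_beta')
  define d where "d = (\<lambda>m \<omega>. \<integral>\<^sup>+r. ennreal ((K m r \<omega> - Hc r \<omega>)\<^sup>2) * indicator {0..T} r \<partial>lborel)"
  have d_eq: "d m \<omega> = (\<integral>\<^sup>+s\<in>{0..T}. ennreal ((K m s \<omega> - H s \<omega>)\<^sup>2) \<partial>lborel)" for m \<omega>
    unfolding d_def by (intro nn_integral_cong) (auto simp: indicator_def Hc_eq)
  have dN [measurable]: "d m \<in> borel_measurable N" for m
  proof -
    have "(\<lambda>(\<omega>, r). ennreal ((K m r \<omega> - Hc r \<omega>)\<^sup>2) * indicator {0..T} r) \<in> borel_measurable (N \<Otimes>\<^sub>M lborel)"
      unfolding split_beta' by measurable
    then show ?thesis
      unfolding d_def by (rule lborel.borel_measurable_nn_integral)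
  qed
  \<comment> \<open>The truncation comes before the conversion to a real number: \<open>d\<close>
    may be infinite, and \<open>enn2real\<close> would send that to 0. Bounded by 1, the distance
    converges in mean and not only in probability.\<close>
  define x where "x = (\<lambda>m \<omega>. enn2real (min 1 (d m \<omega>)))"
  have x01: "0 \<le> x m \<omega>" "x m \<omega> \<le> 1" for m \<omega>
    unfolding x_def by (auto intro!: enn2real_leI)
  have xN [measurable]: "x m \<in> borel_measurable N" for m unfolding x_def by measurable
  have x_less: "ennreal \<epsilon> < d m \<omega>" if "\<epsilon> < x m \<omega>" "0 < \<epsilon>" for \<epsilon> m \<omega>
  proof (rule ccontr)
    assume "\<not> ennreal \<epsilon> < d m \<omega>"
    then have "min 1 (d m \<omega>) \<le> ennreal \<epsilon>" by (simp add: min.coboundedI2)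
    then have "x m \<omega> \<le> \<epsilon>" unfolding x_def using that by (intro enn2real_leI) auto
    with that show False by simp
  qed
  have d_x: "d m \<omega> = ennreal (x m \<omega>)" if "x m \<omega> < 1" for m \<omega>
  proof -
    have *: "min 1 (d m \<omega>) = ennreal (x m \<omega>)"
      unfolding x_def by (rule ennreal_enn2real[symmetric]) (simp add: min_less_iff_disj)
    also have "\<dots> < 1" using that x01(1)[of m \<omega>] by (simp add: ennreal_less_one_iff)
    finally have "d m \<omega> < 1" by (simp add: min_less_iff_disj)
    with * show ?thesis by (simp add: min_def split: if_splits)
  qed
  have x_lim: "(\<lambda>m. N.expectation (x m)) \<longlonglongrightarrow> 0"
  proof (rule N.expectation_tendsto_0_if_in_probability[OF xN x01])
    fix \<epsilon> :: real assume \<epsilon>: "0 < \<epsilon>"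
    show "(\<lambda>m. N.prob {\<omega> \<in> space N. \<epsilon> < x m \<omega>}) \<longlonglongrightarrow> 0"
    proof (rule tendsto_sandwich[OF _ _ tendsto_const])
      show "(\<lambda>m. N.prob {\<omega>\<in>space N. ennreal \<epsilon> < d m \<omega>}) \<longlonglongrightarrow> 0"
        using dist[OF \<epsilon>] by (simp add: d_eq K_def)
      show "\<forall>\<^sub>F m in sequentially. N.prob {\<omega> \<in> space N. \<epsilon> < x m \<omega>} \<le> N.prob {\<omega>\<in>space N. ennreal \<epsilon> < d m \<omega>}"
        using x_less \<epsilon> by (intro always_eventually allI N.finite_measure_mono borel_measurable_less) auto
    qed auto
  qed
  define y where "y = (\<lambda>r m \<omega>. min 1 \<bar>J m r \<omega> - I r \<omega>\<bar>)"
  have y01: "0 \<le> y r m \<omega>" "y r m \<omega> \<le> 1" for r m \<omega> by (auto simp: y_def)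
  have yN: "y r m \<in> borel_measurable N" if "0 \<le> r" "r \<le> T" for r m
    unfolding y_def using JN[OF that] N.F_measurable[OF _ _ IF] that by measurable
  have y_lim: "(\<lambda>m. N.expectation (y r m)) \<longlonglongrightarrow> 0" if r: "0 \<le> r" "r \<le> T" for r
  proof (rule N.expectation_tendsto_0_if_in_probability[OF yN[OF r] y01])
    fix \<epsilon> :: real assume \<epsilon>: "0 < \<epsilon>"
    have [measurable]: "J m r \<in> borel_measurable N" "I r \<in> borel_measurable N" for m
      using JN[OF r] N.F_measurable[OF _ _ IF] r by auto
    show "(\<lambda>m. N.prob {\<omega> \<in> space N. \<epsilon> < y r m \<omega>}) \<longlonglongrightarrow> 0"
    proof (rule tendsto_sandwich[OF _ _ tendsto_const])
      show "(\<lambda>m. N.prob {\<omega>\<in>space N. \<epsilon> < \<bar>J m r \<omega> - I r \<omega>\<bar>}) \<longlonglongrightarrow> 0"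
        using conv[OF _ \<epsilon>, of r] r by (simp add: J_def)
      show "\<forall>\<^sub>F m in sequentially. N.prob {\<omega> \<in> space N. \<epsilon> < y r m \<omega>} \<le> N.prob {\<omega>\<in>space N. \<epsilon> < \<bar>J m r \<omega> - I r \<omega>\<bar>}"
        by (intro always_eventually allI N.finite_measure_mono borel_measurable_less) (auto simp: y_def)
    qed auto
  qed
  have int_xy: "integrable N (x m)" "integrable N (y t m)" "integrable N (y s m)" for m
    using x01 y01 xN yN st by (auto intro!: N.integrable_const_bound[where B = 1])
  \<comment> \<open>The sum of the three errors yields one subsequence along which all of them
    vanish almost surely.\<close>
  define z where "z = (\<lambda>m \<omega>. y t m \<omega> + y s m \<omega> + x m \<omega>)"
  have "(\<lambda>m. N.expectation (z m)) \<longlonglongrightarrow> 0 + 0 + 0"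
    unfolding z_def using tendsto_add[OF tendsto_add[OF y_lim[of t] y_lim[of s]] x_lim] st int_xy by simp
  then have "(\<lambda>m. \<integral>\<omega>. norm (z m \<omega>) \<partial>N) \<longlonglongrightarrow> 0"
    using x01 y01 by (simp add: z_def)
  from tendsto_L1_AE_subseq[OF _ this] obtain \<rho> where
    \<rho>: "strict_mono \<rho>" "AE \<omega> in N. (\<lambda>m. z (\<rho> m) \<omega>) \<longlonglongrightarrow> 0"
    using int_xy by (auto simp: z_def)
  \<comment> \<open>The level is twice the bound 4 * C^2 * (t - s) of the quadratic variation of H -
    H s, plus 1. Once the distance \<open>x\<close> is below 1/2, the estimate Q <= 2p + 2x stays
    below it and the approximation is not stopped.\<close>
  define K0 where "K0 = 8 * C\<^sup>2 * (t - s) + 1"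
  have K0: "1 \<le> K0" using st by (simp add: K0_def)
  define good where "good = (\<lambda>m. N.stopped_approximation s t K0 h (K m) (J m))"
  have "\<exists>Q S. good m Q S" for m
    unfolding good_def K_def J_def
    by (rule N.clamped_simple_integral[OF sdN st hF]) (use hC K0 in auto)
  then obtain Q where "\<And>m. \<exists>S. good m (Q m) S" by metis
  then obtain S where good: "\<And>m. good m (Q m) (S m)" by metis
  have QS: "\<And>m. Q m \<in> borel_measurable N" "\<And>m. S m \<in> borel_measurable N"
    "\<And>m. integrable N (\<lambda>\<omega>. (S m \<omega>)\<^sup>2)"
    "\<And>m. (\<integral>\<omega>. (S m \<omega>)\<^sup>2 \<partial>N) \<le> (\<integral>\<omega>. min K0 (Q m \<omega>) \<partial>N)"
    "\<And>m \<omega>. 0 \<le> Q m \<omega>"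
    "\<And>m \<omega>. ennreal (Q m \<omega>) \<le> (\<integral>\<^sup>+r. ennreal ((K m r \<omega> - h \<omega>)\<^sup>2) * indicator {s<..t} r \<partial>lborel)"
    "\<And>m \<omega>. \<omega> \<in> space N \<Longrightarrow> Q m \<omega> \<le> K0 \<Longrightarrow> S m \<omega> = J m t \<omega> - J m s \<omega> - h \<omega> * (W t \<omega> - W s \<omega>)"
    "\<And>m \<eta> d. \<eta> \<in> borel_measurable (F s) \<Longrightarrow> (\<And>\<omega>. \<omega> \<in> space N \<Longrightarrow> \<bar>\<eta> \<omega>\<bar> \<le> d) \<Longrightarrow>
        integrable N (\<lambda>\<omega>. \<eta> \<omega> * S m \<omega>) \<and> (\<integral>\<omega>. \<eta> \<omega> * S m \<omega> \<partial>N) = 0"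
    using good unfolding good_def N.stopped_approximation_def by blast+
  note [measurable] = QS(1,2)
  define q where "q = (\<lambda>\<omega>. \<integral>\<^sup>+r. ennreal ((Hc r \<omega> - h \<omega>)\<^sup>2) * indicator {s<..t} r \<partial>lborel)"
  have q_joint: "(\<lambda>(\<omega>, r). ennreal ((Hc r \<omega> - h \<omega>)\<^sup>2) * indicator {s<..t} r) \<in> borel_measurable (N \<Otimes>\<^sub>M lborel)"
    unfolding split_beta' by measurable
  have qN [measurable]: "q \<in> borel_measurable N"
    unfolding q_def by (rule lborel.borel_measurable_nn_integral[OF q_joint])
  have sq4: "(Hc r \<omega> - h \<omega>)\<^sup>2 \<le> 4 * C\<^sup>2" if "\<omega> \<in> space M" for r \<omega>
  proof -
    have "\<bar>Hc r \<omega> - h \<omega>\<bar> \<le> 2 * C" using HcC[OF that, of r] hC[OF that] by linarith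
    from power_mono[OF this, of 2] show ?thesis by (simp add: power_mult_distrib)
  qed
  have q_le: "q \<omega> \<le> ennreal (4 * C\<^sup>2 * (t - s))" if "\<omega> \<in> space M" for \<omega>
  proof -
    have "q \<omega> \<le> (\<integral>\<^sup>+r. ennreal (4 * C\<^sup>2) * indicator {s<..t} r \<partial>lborel)"
      unfolding q_def by (intro nn_integral_mono mult_right_mono ennreal_leI sq4 that) auto
    also have "\<dots> = ennreal (4 * C\<^sup>2 * (t - s))"
      using st by (simp add: nn_integral_cmult_indicator ennreal_mult')
    finally show ?thesis .
  qed
  define p where "p = (\<lambda>\<omega>. enn2real (q \<omega>))"
  have pN [measurable]: "p \<in> borel_measurable N" unfolding p_def by measurable
  have p_q: "ennreal (p \<omega>) = q \<omega>" if "\<omega> \<in> space M" for \<omega>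
    unfolding p_def using le_less_trans[OF q_le[OF that] ennreal_less_top] by simp
  have p_le: "0 \<le> p \<omega>" "p \<omega> \<le> 4 * C\<^sup>2 * (t - s)" if "\<omega> \<in> space M" for \<omega>
    unfolding p_def using q_le[OF that] st by (auto intro!: enn2real_leI)
  have p_int: "integrable N p"
    by (rule N.integrable_const_bound[where B = "4 * C\<^sup>2 * (t - s)"]) (use p_le in auto)
  have Q_le: "ennreal (Q m \<omega>) \<le> 2 * q \<omega> + 2 * d m \<omega>" if "\<omega> \<in> space M" for m \<omega>
  proof -
    have [measurable]: "(\<lambda>r. K m r \<omega>) \<in> borel_measurable lborel" "(\<lambda>r. Hc r \<omega>) \<in> borel_measurable lborel"
      using measurable_compose[OF measurable_Pair1'[of \<omega> N lborel] KN'[of m]] that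
        borel_measurable_continuous_onI[OF Hccont[of \<omega>]] by auto
    have "ennreal (Q m \<omega>) \<le> (\<integral>\<^sup>+r. ennreal ((K m r \<omega> - h \<omega>)\<^sup>2) * indicator {s<..t} r \<partial>lborel)"
      by (rule QS(6))
    also have "\<dots> \<le> (\<integral>\<^sup>+r. 2 * (ennreal ((Hc r \<omega> - h \<omega>)\<^sup>2) * indicator {s<..t} r) +
        2 * (ennreal ((K m r \<omega> - Hc r \<omega>)\<^sup>2) * indicator {0..T} r) \<partial>lborel)"
    proof (rule nn_integral_mono)
      fix r
      have "(K m r \<omega> - h \<omega>)\<^sup>2 \<le> 2 * (Hc r \<omega> - h \<omega>)\<^sup>2 + 2 * (K m r \<omega> - Hc r \<omega>)\<^sup>2"
      proof -
        have "0 \<le> ((Hc r \<omega> - h \<omega>) - (K m r \<omega> - Hc r \<omega>))\<^sup>2" by simp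
        then show ?thesis by (simp add: power2_eq_square algebra_simps)
      qed
      then have "ennreal ((K m r \<omega> - h \<omega>)\<^sup>2) \<le> 2 * ennreal ((Hc r \<omega> - h \<omega>)\<^sup>2) + 2 * ennreal ((K m r \<omega> - Hc r \<omega>)\<^sup>2)"
        by (auto dest!: ennreal_leI simp: ennreal_mult')
      then show "ennreal ((K m r \<omega> - h \<omega>)\<^sup>2) * indicator {s<..t} r \<le>
        2 * (ennreal ((Hc r \<omega> - h \<omega>)\<^sup>2) * indicator {s<..t} r) +
        2 * (ennreal ((K m r \<omega> - Hc r \<omega>)\<^sup>2) * indicator {0..T} r)"
        using st by (auto simp: indicator_def)
    qed
    also have "\<dots> = 2 * q \<omega> + 2 * d m \<omega>"
      unfolding q_def d_def by (simp add: nn_integral_add nn_integral_cmult)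
    finally show ?thesis .
  qed
  have Q_le': "Q m \<omega> \<le> 2 * p \<omega> + 2 * x m \<omega>" if "\<omega> \<in> space M" "x m \<omega> < 1" for m \<omega>
  proof -
    have "ennreal (Q m \<omega>) \<le> ennreal (2 * p \<omega> + 2 * x m \<omega>)"
      using Q_le[OF that(1), of m] p_le[OF that(1)] x01[of m \<omega>]
      by (simp add: d_x[OF that(2)] p_q[OF that(1), symmetric] ennreal_mult')
    then show ?thesis using p_le[OF that(1)] x01[of m \<omega>] by (subst (asm) ennreal_le_iff) auto
  qed
  \<comment> \<open>If the distance was truncated, then x = 1 and the term K0 * x alone dominates;
    otherwise the estimate of \<open>Q\<close> applies. In both cases the error is a multiple of
    \<open>x\<close>, whose mean tends to 0.\<close>
  have minQ: "min K0 (Q m \<omega>) \<le> 2 * p \<omega> + (K0 + 2) * x m \<omega>" if "\<omega> \<in> space M" for m \<omega>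
  proof (cases "x m \<omega> < 1")
    case True
    have "Q m \<omega> \<le> 2 * p \<omega> + 2 * x m \<omega>" by (rule Q_le'[OF that True])
    also have "\<dots> \<le> 2 * p \<omega> + (K0 + 2) * x m \<omega>"
      using K0 x01[of m \<omega>] by (intro add_left_mono mult_right_mono) auto
    finally show ?thesis by simp
  next
    case False
    then have "x m \<omega> = 1" using x01[of m \<omega>] by simp
    then show ?thesis using p_le[OF that] by simp
  qed
  have Q_K0: "Q m \<omega> \<le> K0" if "\<omega> \<in> space M" "x m \<omega> < 1 / 2" for m \<omega>
    using Q_le'[OF that(1), of m] that(2) p_le[OF that(1)] by (simp add: K0_def)
  have V_eq: "V \<omega> = I t \<omega> - I s \<omega> - h \<omega> * (W t \<omega> - W s \<omega>)" for \<omega>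
    by (simp add: V_def h_def)
  have [measurable]: "W t \<in> borel_measurable N" "W s \<in> borel_measurable N"
    using WN st by auto
  have VN: "V \<in> borel_measurable N" unfolding V_eq[abs_def] by measurable
  have lim: "AE \<omega> in N. (\<lambda>m. S (\<rho> m) \<omega>) \<longlonglongrightarrow> V \<omega>"
    using \<rho>(2) AE_space
  proof eventually_elim
    case (elim \<omega>)
    have yx: "(\<lambda>m. y t (\<rho> m) \<omega>) \<longlonglongrightarrow> 0" "(\<lambda>m. y s (\<rho> m) \<omega>) \<longlonglongrightarrow> 0" "(\<lambda>m. x (\<rho> m) \<omega>) \<longlonglongrightarrow> 0"
    proof -
      have le: "0 \<le> f m" "f m \<le> z (\<rho> m) \<omega>"
        if "f = (\<lambda>m. y t (\<rho> m) \<omega>) \<or> f = (\<lambda>m. y s (\<rho> m) \<omega>) \<or> f = (\<lambda>m. x (\<rho> m) \<omega>)" for f m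
        using that x01(1)[of "\<rho> m" \<omega>] y01(1)[of t "\<rho> m" \<omega>] y01(1)[of s "\<rho> m" \<omega>] unfolding z_def by auto
      have "f \<longlonglongrightarrow> 0"
        if "f = (\<lambda>m. y t (\<rho> m) \<omega>) \<or> f = (\<lambda>m. y s (\<rho> m) \<omega>) \<or> f = (\<lambda>m. x (\<rho> m) \<omega>)" for f
        by (rule tendsto_sandwich[OF always_eventually always_eventually tendsto_const elim(1)])
           (use le[OF that] in blast)+
      then show "(\<lambda>m. y t (\<rho> m) \<omega>) \<longlonglongrightarrow> 0" "(\<lambda>m. y s (\<rho> m) \<omega>) \<longlonglongrightarrow> 0" "(\<lambda>m. x (\<rho> m) \<omega>) \<longlonglongrightarrow> 0"
        by blast+
    qed
    have Jlim: "(\<lambda>m. J (\<rho> m) r \<omega>) \<longlonglongrightarrow> I r \<omega>" if "(\<lambda>m. y r (\<rho> m) \<omega>) \<longlonglongrightarrow> 0" for r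
    proof -
      have "\<forall>\<^sub>F m in sequentially. y r (\<rho> m) \<omega> < 1" using order_tendstoD(2)[OF that, of 1] by simp
      then have "\<forall>\<^sub>F m in sequentially. y r (\<rho> m) \<omega> = \<bar>J (\<rho> m) r \<omega> - I r \<omega>\<bar>"
        by eventually_elim (simp add: y_def min_def split: if_splits)
      with that have "(\<lambda>m. \<bar>J (\<rho> m) r \<omega> - I r \<omega>\<bar>) \<longlonglongrightarrow> 0"
        by (rule Lim_transform_eventually)
      then show ?thesis by (rule LIM_zero_cancel[OF tendsto_rabs_zero_cancel])
    qed
    have ev: "\<forall>\<^sub>F m in sequentially. x (\<rho> m) \<omega> < 1 / 2"
      using order_tendstoD(2)[OF yx(3), of "1/2"] by simp
    have "(\<lambda>m. J (\<rho> m) t \<omega> - J (\<rho> m) s \<omega> - h \<omega> * (W t \<omega> - W s \<omega>)) \<longlonglongrightarrow> V \<omega>"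
      unfolding V_eq by (intro tendsto_intros Jlim yx)
    moreover have "\<forall>\<^sub>F m in sequentially. J (\<rho> m) t \<omega> - J (\<rho> m) s \<omega> - h \<omega> * (W t \<omega> - W s \<omega>) = S (\<rho> m) \<omega>"
      using ev by eventually_elim (use QS(7)[of \<omega>] Q_K0[of \<omega>] elim(2) in auto)
    ultimately show ?case by (rule Lim_transform_eventually)
  qed
  have ES: "(\<integral>\<omega>. (S m \<omega>)\<^sup>2 \<partial>N) \<le> 2 * N.expectation p + (K0 + 2) * N.expectation (x m)" for m
  proof -
    have "(\<integral>\<omega>. (S m \<omega>)\<^sup>2 \<partial>N) \<le> (\<integral>\<omega>. min K0 (Q m \<omega>) \<partial>N)" by (rule QS(4))
    also have "\<dots> \<le> (\<integral>\<omega>. 2 * p \<omega> + (K0 + 2) * x m \<omega> \<partial>N)"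
    proof (rule integral_mono)
      show "integrable N (\<lambda>\<omega>. min K0 (Q m \<omega>))"
        by (rule N.integrable_const_bound[where B = K0]) (use QS(5) K0 in auto)
    qed (use p_int int_xy minQ in auto)
    also have "\<dots> = 2 * N.expectation p + (K0 + 2) * N.expectation (x m)"
      using p_int int_xy by simp
    finally show ?thesis .
  qed
  have ES0: "(\<integral>\<omega>. (S m \<omega>)\<^sup>2 \<partial>N) \<le> K0" for m
  proof -
    have "(\<integral>\<omega>. (S m \<omega>)\<^sup>2 \<partial>N) \<le> (\<integral>\<omega>. min K0 (Q m \<omega>) \<partial>N)" by (rule QS(4))
    also have "\<dots> \<le> (\<integral>\<omega>. K0 \<partial>N)"
      by (rule integral_mono)
        (auto intro!: N.integrable_const_bound[where B = K0] simp: QS(5) abs_of_nonneg order_trans[OF zero_le_one K0])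
    finally show ?thesis using N.prob_space by simp
  qed
  \<comment> \<open>Along the subsequence \<open>S\<close> converges almost surely to
    \<open>V\<close>, so Fatou's lemma passes the second moment bound to the limit, where the term
    with \<open>x\<close> disappears.\<close>
  have fatou: "(\<integral>\<^sup>+\<omega>. ennreal ((V \<omega>)\<^sup>2) \<partial>N) \<le> ennreal (2 * N.expectation p)"
  proof -
    have "(\<integral>\<^sup>+\<omega>. ennreal ((V \<omega>)\<^sup>2) \<partial>N) = (\<integral>\<^sup>+\<omega>. liminf (\<lambda>m. ennreal ((S (\<rho> m) \<omega>)\<^sup>2)) \<partial>N)"
    proof (rule nn_integral_cong_AE)
      show "AE \<omega> in N. ennreal ((V \<omega>)\<^sup>2) = liminf (\<lambda>m. ennreal ((S (\<rho> m) \<omega>)\<^sup>2))"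
        using lim
      proof eventually_elim
        case (elim \<omega>)
        then have "(\<lambda>m. ennreal ((S (\<rho> m) \<omega>)\<^sup>2)) \<longlonglongrightarrow> ennreal ((V \<omega>)\<^sup>2)"
          by (intro tendsto_intros)
        from lim_imp_Liminf[OF _ this] show ?case by simp
      qed
    qed
    also have "\<dots> \<le> liminf (\<lambda>m. \<integral>\<^sup>+\<omega>. ennreal ((S (\<rho> m) \<omega>)\<^sup>2) \<partial>N)"
      by (rule nn_integral_liminf) measurable
    also have "\<dots> \<le> liminf (\<lambda>m. ennreal (2 * N.expectation p + (K0 + 2) * N.expectation (x (\<rho> m))))"
      by (intro Liminf_mono always_eventually allI)
         (auto simp: nn_integral_eq_integral[OF QS(3)] intro!: ennreal_leI ES)
    also have "\<dots> = ennreal (2 * N.expectation p + (K0 + 2) * 0)"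
    proof (rule lim_imp_Liminf)
      have "(\<lambda>m. N.expectation (x (\<rho> m))) \<longlonglongrightarrow> 0"
        using LIMSEQ_subseq_LIMSEQ[OF x_lim \<rho>(1)] by (simp add: comp_def)
      then show "(\<lambda>m. ennreal (2 * N.expectation p + (K0 + 2) * N.expectation (x (\<rho> m)))) \<longlonglongrightarrow>
          ennreal (2 * N.expectation p + (K0 + 2) * 0)"
        by (intro tendsto_intros)
    qed simp
    finally show ?thesis by simp
  qed
  have V2: "integrable N (\<lambda>\<omega>. (V \<omega>)\<^sup>2)"
    using le_less_trans[OF fatou ennreal_less_top] VN by (intro integrableI_nonneg) auto
  have p0: "0 \<le> N.expectation p" using p_le by (intro Bochner_Integration.integral_nonneg) simp
  have EV2: "(\<integral>\<omega>. (V \<omega>)\<^sup>2 \<partial>N) \<le> 2 * N.expectation p"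
  proof -
    have "ennreal (\<integral>\<omega>. (V \<omega>)\<^sup>2 \<partial>N) \<le> ennreal (2 * N.expectation p)"
      using fatou nn_integral_eq_integral[OF V2] by simp
    then show ?thesis using p0 by (subst (asm) ennreal_le_iff) auto
  qed
  show "V \<in> borel_measurable (completion M)" using VN by (simp add: N_def)
  show "integrable (completion M) (\<lambda>\<omega>. (V \<omega>)\<^sup>2)" using V2 by (simp add: N_def)
  {
    fix e assume e: "\<And>r. s \<le> r \<Longrightarrow> r \<le> t \<Longrightarrow> (\<integral>\<omega>. (H r \<omega> - H s \<omega>)\<^sup>2 \<partial>completion M) \<le> e"
    have e0: "0 \<le> e" using e[of s] st by simp
    interpret P: pair_sigma_finite N lborel ..
    have "ennreal (N.expectation p) = (\<integral>\<^sup>+\<omega>. q \<omega> \<partial>N)"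
    proof -
      have "AE \<omega> in N. 0 \<le> p \<omega>" using p_le(1) by (intro AE_I2) simp
      then have "ennreal (N.expectation p) = (\<integral>\<^sup>+\<omega>. ennreal (p \<omega>) \<partial>N)"
        by (rule nn_integral_eq_integral[OF p_int, symmetric])
      also have "\<dots> = (\<integral>\<^sup>+\<omega>. q \<omega> \<partial>N)" by (rule nn_integral_cong) (simp add: p_q)
      finally show ?thesis .
    qed
    \<comment> \<open>Interchanging the integrals reduces the mean quadratic variation to the second
      moments at fixed times, which are bounded by \<open>e\<close>.\<close>
    also have "\<dots> = (\<integral>\<^sup>+r. (\<integral>\<^sup>+\<omega>. ennreal ((Hc r \<omega> - h \<omega>)\<^sup>2) * indicator {s<..t} r \<partial>N) \<partial>lborel)"
      unfolding q_def by (rule P.Fubini'[OF q_joint, symmetric])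
    also have "\<dots> \<le> (\<integral>\<^sup>+r. ennreal e * indicator {s<..t} r \<partial>lborel)"
    proof (rule nn_integral_mono)
      fix r
      show "(\<integral>\<^sup>+\<omega>. ennreal ((Hc r \<omega> - h \<omega>)\<^sup>2) * indicator {s<..t} r \<partial>N) \<le> ennreal e * indicator {s<..t} r"
      proof (cases "r \<in> {s<..t}")
        case True
        have [measurable]: "Hc r \<in> borel_measurable N" by (rule HcN)
        have i: "integrable N (\<lambda>\<omega>. (Hc r \<omega> - h \<omega>)\<^sup>2)"
          by (rule N.integrable_const_bound[where B = "4 * C\<^sup>2"]) (use sq4 in auto)
        have "(\<integral>\<^sup>+\<omega>. ennreal ((Hc r \<omega> - h \<omega>)\<^sup>2) \<partial>N) = ennreal (\<integral>\<omega>. (Hc r \<omega> - h \<omega>)\<^sup>2 \<partial>N)"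
          by (rule nn_integral_eq_integral[OF i]) simp
        also have "\<dots> \<le> ennreal e"
          using e[of r] True st by (intro ennreal_leI) (simp add: N_def h_def Hc_eq)
        finally show ?thesis using True by simp
      qed simp
    qed
    also have "\<dots> = ennreal (e * (t - s))"
      using st e0 by (simp add: nn_integral_cmult_indicator ennreal_mult')
    finally have "N.expectation p \<le> e * (t - s)"
      using e0 st by (subst (asm) ennreal_le_iff) auto
    with EV2 show "(\<integral>\<omega>. (V \<omega>)\<^sup>2 \<partial>completion M) \<le> 2 * e * (t - s)" by (simp add: N_def)
  }
  {
    fix \<eta> :: "'a \<Rightarrow> real" and c
    assume \<eta>: "\<eta> \<in> borel_measurable (F s)" "\<And>\<omega>. \<omega> \<in> space M \<Longrightarrow> \<bar>\<eta> \<omega>\<bar> \<le> c"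
    have [measurable]: "\<eta> \<in> borel_measurable N" using N.F_measurable[OF _ _ \<eta>(1)] st by auto
    have Vi: "integrable N V" by (rule N.integrable_if_square_integrable[OF VN V2])
    have Si: "integrable N (S m)" for m by (rule N.integrable_if_square_integrable[OF QS(2,3)])
    have \<eta>V: "integrable N (\<lambda>\<omega>. \<eta> \<omega> * V \<omega>)"
      by (rule integrable_bounded_mult[where c = c]) (use Vi \<eta> in auto)
    have \<eta>S: "integrable N (\<lambda>\<omega>. \<eta> \<omega> * S m \<omega>)" "(\<integral>\<omega>. \<eta> \<omega> * S m \<omega> \<partial>N) = 0" for m
      using QS(8)[OF \<eta>(1), of c m] \<eta>(2) by auto
    have L1: "(\<lambda>m. N.expectation (\<lambda>\<omega>. \<bar>S (\<rho> m) \<omega> - V \<omega>\<bar>)) \<longlonglongrightarrow> 0"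
      by (rule N.L1_convergence_if_L2_bounded[OF QS(2) VN QS(3) ES0 V2 lim])
    \<comment> \<open>Each stopped sum is orthogonal to \<eta>, so the expectation of \<eta> * V is
      that of \<eta> * (V - S), which is controlled by the distance in L1.\<close>
    have bound: "\<bar>\<integral>\<omega>. \<eta> \<omega> * V \<omega> \<partial>N\<bar> \<le> c * N.expectation (\<lambda>\<omega>. \<bar>S (\<rho> m) \<omega> - V \<omega>\<bar>)" for m
    proof -
      have "(\<integral>\<omega>. \<eta> \<omega> * V \<omega> \<partial>N) = (\<integral>\<omega>. \<eta> \<omega> * V \<omega> - \<eta> \<omega> * S (\<rho> m) \<omega> \<partial>N)"
        using \<eta>V \<eta>S by simp
      also have "\<bar>\<dots>\<bar> \<le> (\<integral>\<omega>. \<bar>\<eta> \<omega> * V \<omega> - \<eta> \<omega> * S (\<rho> m) \<omega>\<bar> \<partial>N)"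
        by (rule integral_abs_bound)
      also have "\<dots> \<le> (\<integral>\<omega>. c * \<bar>S (\<rho> m) \<omega> - V \<omega>\<bar> \<partial>N)"
      proof (rule integral_mono)
        fix \<omega> assume \<omega>: "\<omega> \<in> space N"
        have "\<bar>\<eta> \<omega> * V \<omega> - \<eta> \<omega> * S (\<rho> m) \<omega>\<bar> = \<bar>\<eta> \<omega>\<bar> * \<bar>S (\<rho> m) \<omega> - V \<omega>\<bar>"
          by (simp add: abs_mult[symmetric] right_diff_distrib abs_minus_commute)
        also have "\<dots> \<le> c * \<bar>S (\<rho> m) \<omega> - V \<omega>\<bar>"
          using \<eta>(2)[of \<omega>] \<omega> by (intro mult_right_mono) auto
        finally show "\<bar>\<eta> \<omega> * V \<omega> - \<eta> \<omega> * S (\<rho> m) \<omega>\<bar> \<le> c * \<bar>S (\<rho> m) \<omega> - V \<omega>\<bar>" .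
      qed (use \<eta>V \<eta>S Vi Si in auto)
      finally show ?thesis by simp
    qed
    have "\<bar>\<integral>\<omega>. \<eta> \<omega> * V \<omega> \<partial>N\<bar> \<le> c * 0"
      by (rule LIMSEQ_le_const[OF tendsto_mult_left[OF L1]]) (use bound in auto)
    with \<eta>V show "integrable (completion M) (\<lambda>\<omega>. \<eta> \<omega> * V \<omega>) \<and> (\<integral>\<omega>. \<eta> \<omega> * V \<omega> \<partial>completion M) = 0"
      by (simp add: N_def)
  }
qed

section \<open>The Yamada-Watanabe function\<close>

text \<open>A smooth version of |x| log |x|, up to lower order terms: the twofold primitive,
  vanishing with its derivative at 0, of \<open>yw_fun2 k\<close>, which is the regularisation 1 /
  sqrt (x^2 + 1/k^2) of 1/|x|. That 1/|x| is not integrable at 0 is the condition of Yamada and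
  Watanabe for order 1/2.\<close>

definition yw_fun :: "real \<Rightarrow> real \<Rightarrow> real" where
  "yw_fun k x = x * arsinh (k * x) - (sqrt ((k * x)\<^sup>2 + 1) - 1) / k"

definition yw_fun2 :: "real \<Rightarrow> real \<Rightarrow> real" where
  "yw_fun2 k x = k / sqrt ((k * x)\<^sup>2 + 1)"

lemma yw_fun_deriv2:
  "((\<lambda>x. arsinh (k * x)) has_real_derivative yw_fun2 k x) (at x)"
proof -
  have "((\<lambda>x. arsinh (k * x)) has_real_derivative 1 / sqrt ((k * x)\<^sup>2 + 1) * k) (at x)"
    by (rule DERIV_chain2[where f = arsinh and g = "\<lambda>x. k * x"])
       (rule arsinh_real_has_field_derivative, rule DERIV_cmult_Id)
  then show ?thesis by (simp add: yw_fun2_def)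
qed

lemma yw_fun_deriv:
  assumes "0 < k"
  shows "(yw_fun k has_real_derivative arsinh (k * x)) (at x)"
proof -
  have pos: "0 < (k * x)\<^sup>2 + 1" by (simp add: add_nonneg_pos)
  have "((\<lambda>x. sqrt ((k * x)\<^sup>2 + 1)) has_real_derivative
      inverse (sqrt ((k * x)\<^sup>2 + 1)) / 2 * (2 * (k * x) * k)) (at x)"
    by (rule DERIV_chain2[where f = sqrt and g = "\<lambda>x. (k * x)\<^sup>2 + 1"])
       (rule DERIV_real_sqrt[OF pos], auto intro!: derivative_eq_intros)
  then have "((\<lambda>x. x * arsinh (k * x) - (sqrt ((k * x)\<^sup>2 + 1) - 1) / k) has_real_derivative
      (1 * arsinh (k * x) + yw_fun2 k x * x) -
       (inverse (sqrt ((k * x)\<^sup>2 + 1)) / 2 * (2 * (k * x) * k) - 0) / k) (at x)"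
    by (intro DERIV_diff DERIV_mult DERIV_cdivide DERIV_ident DERIV_const yw_fun_deriv2)
  also have "(1 * arsinh (k * x) + yw_fun2 k x * x) -
       (inverse (sqrt ((k * x)\<^sup>2 + 1)) / 2 * (2 * (k * x) * k) - 0) / k = arsinh (k * x)"
  proof -
    have "1 * A + k / S * x - (inverse S / 2 * (2 * (k * x) * k) - 0) / k = A" for A S :: real
    proof -
      have "inverse S / 2 * (2 * (k * x) * k) - 0 = (k / S * x) * k"
        by (cases "S = 0") (simp_all add: field_simps)
      then show ?thesis
        using assms by (simp only: nonzero_mult_div_cancel_right mult_1_left add_diff_cancel_right')
    qed
    then show ?thesis unfolding yw_fun2_def .
  qed
  finally show ?thesis by (simp add: yw_fun_def[abs_def])
qed

lemma sqrt_square_plus_one_ge: "1 \<le> sqrt (p\<^sup>2 + 1)" "\<bar>p\<bar> \<le> sqrt (p\<^sup>2 + 1)" "sqrt (p\<^sup>2 + 1) \<le> \<bar>p\<bar> + 1" for p :: real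
proof -
  show "1 \<le> sqrt (p\<^sup>2 + 1)" by simp
  show "\<bar>p\<bar> \<le> sqrt (p\<^sup>2 + 1)" by (rule real_le_rsqrt) simp
  show "sqrt (p\<^sup>2 + 1) \<le> \<bar>p\<bar> + 1" by (rule real_le_lsqrt) (auto simp: power2_sum)
qed

lemma yw_fun2_bounds:
  assumes "0 < k"
  shows "0 \<le> yw_fun2 k x" "yw_fun2 k x \<le> k" "yw_fun2 k x * \<bar>x\<bar> \<le> 1"
proof -
  have s: "1 \<le> sqrt ((k * x)\<^sup>2 + 1)" "\<bar>k * x\<bar> \<le> sqrt ((k * x)\<^sup>2 + 1)"
    by (rule sqrt_square_plus_one_ge)+
  show "0 \<le> yw_fun2 k x" using assms s(1) unfolding yw_fun2_def by (intro divide_nonneg_nonneg) linarith+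
  have "k / sqrt ((k * x)\<^sup>2 + 1) \<le> k / 1"
    using assms s(1) by (intro divide_left_mono) linarith+
  then show "yw_fun2 k x \<le> k" by (simp add: yw_fun2_def)
  show "yw_fun2 k x * \<bar>x\<bar> \<le> 1"
  proof -
    have "yw_fun2 k x * \<bar>x\<bar> = \<bar>k * x\<bar> / sqrt ((k * x)\<^sup>2 + 1)"
      using assms by (simp add: yw_fun2_def abs_mult)
    also have "\<dots> \<le> 1" using s by (subst divide_le_eq_1_pos) linarith+
    finally show ?thesis .
  qed
qed

text \<open>The root sqrt (p^2 + 1) is the length of the plane vector (p, 1), hence has Lipschitz
  constant 1 in p; as it is at least 1, so has its reciprocal. One factor \<open>k\<close> comes
  from p = k * x, the other from the numerator.\<close>

lemma yw_fun2_lipschitz: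
  assumes "0 < k"
  shows "\<bar>yw_fun2 k x - yw_fun2 k y\<bar> \<le> k\<^sup>2 * \<bar>x - y\<bar>"
proof -
  have *: "sqrt (q\<^sup>2 + 1) \<le> sqrt (p\<^sup>2 + 1) + \<bar>p - q\<bar>" for p q :: real
    using real_sqrt_sum_squares_triangle_ineq[of p "q - p" 1 0] by (simp add: abs_minus_commute)
  define u where "u = sqrt ((k * x)\<^sup>2 + 1)"
  define v where "v = sqrt ((k * y)\<^sup>2 + 1)"
  have uv: "1 \<le> u" "1 \<le> v" unfolding u_def v_def by (rule sqrt_square_plus_one_ge)+
  have "\<bar>v - u\<bar> \<le> \<bar>k * x - k * y\<bar>"
    using *[of "k * x" "k * y"] *[of "k * y" "k * x"] unfolding u_def v_def by (simp add: abs_minus_commute)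
  also have "\<dots> = k * \<bar>x - y\<bar>"
    using assms by (simp add: abs_mult flip: right_diff_distrib)
  finally have d: "\<bar>v - u\<bar> \<le> k * \<bar>x - y\<bar>" .
  have "yw_fun2 k x - yw_fun2 k y = k * ((v - u) / (u * v))"
  proof -
    have "k / u - k / v = k * ((v - u) / (u * v))" using uv by (simp add: field_simps)
    then show ?thesis unfolding yw_fun2_def u_def v_def .
  qed
  also have "\<bar>\<dots>\<bar> = k * (\<bar>v - u\<bar> / (u * v))"
    using assms uv by (simp add: abs_mult)
  also have "\<dots> \<le> k * (\<bar>v - u\<bar> / 1)"
    using assms uv mult_mono[of 1 u 1 v] by (intro mult_left_mono divide_left_mono) auto
  also have "\<dots> \<le> k * (k * \<bar>x - y\<bar>)"
    using assms d by (intro mult_left_mono) auto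
  finally show ?thesis by (simp add: power2_eq_square mult.assoc)
qed

text \<open>\<open>m\<close> is the second derivative at the intermediate point of the Lagrange
  remainder. The bound by \<open>k\<close> suffices for error terms; for the leading term
  \<open>m\<close> must be compared with the value at \<open>x\<close> itself, because the Hoelder
  condition supplies the factor |x| at this point.\<close>

lemma yw_fun_taylor:
  assumes k: "0 < k"
  obtains m where "0 \<le> m" "m \<le> k" "m \<le> yw_fun2 k x + k\<^sup>2 * \<bar>h\<bar>"
    "yw_fun k (x + h) = yw_fun k x + arsinh (k * x) * h + m * h\<^sup>2 / 2"
proof -
  have "\<exists>\<theta>. \<bar>\<theta> - x\<bar> \<le> \<bar>h\<bar> \<and> yw_fun k (x + h) = yw_fun k x + arsinh (k * x) * h + yw_fun2 k \<theta> * h\<^sup>2 / 2"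
  proof (cases "h = 0")
    case False
    define diff where "diff = (\<lambda>m::nat. if m = 0 then yw_fun k else if m = 1 then (\<lambda>x. arsinh (k * x)) else yw_fun2 k)"
    have "\<exists>\<theta>. (if x + h < x then x + h < \<theta> \<and> \<theta> < x else x < \<theta> \<and> \<theta> < x + h) \<and>
       yw_fun k (x + h) = (\<Sum>m<2. diff m x / fact m * (x + h - x) ^ m) + diff 2 \<theta> / fact 2 * (x + h - x) ^ 2"
    proof (rule Taylor[where a = "min x (x + h)" and b = "max x (x + h)"])
      show "\<forall>m t. m < 2 \<and> min x (x + h) \<le> t \<and> t \<le> max x (x + h) \<longrightarrow>
          (diff m has_real_derivative diff (Suc m) t) (at t)"
        using yw_fun_deriv[OF k] yw_fun_deriv2[of k] by (auto simp: diff_def less_2_cases_iff)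
    qed (use False in \<open>auto simp: diff_def\<close>)
    then obtain \<theta> where \<theta>: "if x + h < x then x + h < \<theta> \<and> \<theta> < x else x < \<theta> \<and> \<theta> < x + h"
      "yw_fun k (x + h) = (\<Sum>m<2. diff m x / fact m * (x + h - x) ^ m) + diff 2 \<theta> / fact 2 * (x + h - x) ^ 2"
      by blast
    have "\<bar>\<theta> - x\<bar> \<le> \<bar>h\<bar>" using \<theta>(1) by (auto split: if_splits)
    moreover have "yw_fun k (x + h) = yw_fun k x + arsinh (k * x) * h + yw_fun2 k \<theta> * h\<^sup>2 / 2"
      unfolding \<theta>(2) by (simp add: diff_def numeral_2_eq_2)
    ultimately show ?thesis by blast
  qed auto
  then obtain \<theta> where \<theta>: "\<bar>\<theta> - x\<bar> \<le> \<bar>h\<bar>"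
    "yw_fun k (x + h) = yw_fun k x + arsinh (k * x) * h + yw_fun2 k \<theta> * h\<^sup>2 / 2" by blast
  have "yw_fun2 k \<theta> \<le> yw_fun2 k x + k\<^sup>2 * \<bar>\<theta> - x\<bar>"
    using yw_fun2_lipschitz[OF k, of \<theta> x] by linarith
  also have "\<dots> \<le> yw_fun2 k x + k\<^sup>2 * \<bar>h\<bar>"
    using \<theta>(1) by (intro add_left_mono mult_left_mono) auto
  finally show thesis
    using that[of "yw_fun2 k \<theta>"] \<theta>(2) yw_fun2_bounds[OF k, of \<theta>] by blast
qed

lemma abs_mult_arsinh: "\<bar>x\<bar> * \<bar>arsinh (k * x)\<bar> = x * arsinh (k * x)" if "0 < k" for k x :: real
proof (cases "0 \<le> x")
  case True
  then have "0 \<le> arsinh (k * x)"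
    using arsinh_less_iff_real[of "k * x" 0] that by (simp del: arsinh_less_iff_real add: not_less[symmetric] mult_less_0_iff)
  with True show ?thesis by simp
next
  case False
  then have "arsinh (k * x) < 0"
    using that by (simp only: arsinh_real_neg_iff) (simp add: mult_less_0_iff)
  then have "\<bar>arsinh (k * x)\<bar> = - arsinh (k * x)" by (rule abs_of_neg)
  with False show ?thesis by simp
qed

text \<open>The gap between x * arsinh (k * x) and \<open>yw_fun k x\<close> is (sqrt ((k * x)^2 +
  1) - 1) / k, at most |x|. It makes the drift term linear in \<open>yw_fun\<close>, and at the end
  it shows that \<open>yw_fun\<close> is large away from 0.\<close>

lemma yw_fun_lower:
  assumes "0 < k"
  shows "\<bar>x\<bar> * \<bar>arsinh (k * x)\<bar> \<le> yw_fun k x + \<bar>x\<bar>"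
proof -
  have "sqrt ((k * x)\<^sup>2 + 1) - 1 \<le> \<bar>k * x\<bar>"
    using sqrt_square_plus_one_ge(3)[of "k * x"] by simp
  then have "(sqrt ((k * x)\<^sup>2 + 1) - 1) / k \<le> \<bar>x\<bar>"
    using assms by (simp add: divide_le_eq abs_mult mult.commute)
  then show ?thesis unfolding abs_mult_arsinh[OF assms] by (simp add: yw_fun_def)
qed

lemma yw_fun_0 [simp]: "yw_fun k 0 = 0"
  by (simp add: yw_fun_def)

lemma yw_fun_upper:
  assumes "0 < k" 
  shows "yw_fun k x \<le> \<bar>x\<bar> * \<bar>arsinh (k * x)\<bar>"
proof -
  have "0 \<le> (sqrt ((k * x)\<^sup>2 + 1) - 1) / k"
    using assms by simp
  then show ?thesis unfolding abs_mult_arsinh[OF assms] by (simp add: yw_fun_def)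
qed

lemma arsinh_mono_real: "x \<le> y \<Longrightarrow> arsinh x \<le> arsinh (y::real)"
  using arsinh_less_iff_real[of y x] by (simp del: arsinh_less_iff_real add: not_less[symmetric])

lemma abs_arsinh_le:
  assumes "0 < k" "\<bar>x\<bar> \<le> 1"
  shows "\<bar>arsinh (k * x)\<bar> \<le> arsinh (k::real)"
proof -
  have "\<bar>k * x\<bar> \<le> k" using assms by (simp add: abs_mult)
  then have "k * x \<le> k" "- k \<le> k * x" by auto
  from this[THEN arsinh_mono_real] show ?thesis by simp
qed

text \<open>One step of the scheme: \<open>d\<close> is the martingale part of the increment \<open>h\<close>, \<open>\<beta>\<close> its drift part,
  \<open>S * w\<close> the Euler approximation of \<open>d\<close> with error \<open>r1 - r2\<close>.\<close>

lemma yw_fun_step: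
  assumes k: "0 < k" and q: "0 < q" and h: "h = d + \<beta>" "d = S * w + r1 - r2" and S: "S\<^sup>2 \<le> c"
  shows "yw_fun k (x + h) \<le> yw_fun k x + arsinh (k * x) * d + \<bar>arsinh (k * x)\<bar> * \<bar>\<beta>\<bar> + yw_fun2 k x * S\<^sup>2 * w\<^sup>2
     + k\<^sup>2 * c * (q * h\<^sup>2 + w ^ 4 / q) / 2 + 3 * k * (r1\<^sup>2 + r2\<^sup>2 + \<beta>\<^sup>2)"
proof -
  obtain m where m: "0 \<le> m" "m \<le> k" "m \<le> yw_fun2 k x + k\<^sup>2 * \<bar>h\<bar>"
    "yw_fun k (x + h) = yw_fun k x + arsinh (k * x) * h + m * h\<^sup>2 / 2"
    using yw_fun_taylor[OF k] .
  define r where "r = r1 - r2 + \<beta>"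
  have "h\<^sup>2 \<le> 2 * (S * w)\<^sup>2 + 2 * r\<^sup>2"
  proof -
    have "0 \<le> (S * w - r)\<^sup>2" by simp
    moreover have "h = S * w + r" using h by (simp add: r_def)
    ultimately show ?thesis by (simp add: power2_sum power2_diff)
  qed
  then have "m * h\<^sup>2 \<le> m * (2 * (S * w)\<^sup>2 + 2 * r\<^sup>2)" using m(1) by (rule mult_left_mono)
  then have "m * h\<^sup>2 / 2 \<le> m * (S\<^sup>2 * w\<^sup>2) + m * r\<^sup>2"
    by (simp add: power_mult_distrib algebra_simps)
  moreover have "m * (S\<^sup>2 * w\<^sup>2) \<le> yw_fun2 k x * S\<^sup>2 * w\<^sup>2 + k\<^sup>2 * \<bar>h\<bar> * (S\<^sup>2 * w\<^sup>2)"
    using mult_right_mono[OF m(3), of "S\<^sup>2 * w\<^sup>2"] by (simp add: distrib_right mult.assoc)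
  \<comment> \<open>The third-order term |h| * w^2 is split with a free weight \<open>q\<close>,
    later the root of the step: q * h^2 and w^4 / q then both have expectation of order 3/2 in the
    step.\<close>
  moreover have "k\<^sup>2 * \<bar>h\<bar> * (S\<^sup>2 * w\<^sup>2) \<le> k\<^sup>2 * c * (q * h\<^sup>2 + w ^ 4 / q) / 2"
  proof -
    have c0: "0 \<le> c" using S zero_le_power2[of S] by linarith
    have "0 \<le> (q * \<bar>h\<bar> - w\<^sup>2)\<^sup>2" by simp
    then have "q * (2 * (\<bar>h\<bar> * w\<^sup>2)) \<le> q * (q * h\<^sup>2 + w ^ 4 / q)"
      using q by (simp add: power2_diff power_mult_distrib algebra_simps power2_eq_square[of q] flip: power_mult)
    then have "\<bar>h\<bar> * w\<^sup>2 \<le> (q * h\<^sup>2 + w ^ 4 / q) / 2" using q by simp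
    with S c0 have "S\<^sup>2 * (\<bar>h\<bar> * w\<^sup>2) \<le> c * ((q * h\<^sup>2 + w ^ 4 / q) / 2)"
      by (intro mult_mono) auto
    then have "k\<^sup>2 * (S\<^sup>2 * (\<bar>h\<bar> * w\<^sup>2)) \<le> k\<^sup>2 * (c * ((q * h\<^sup>2 + w ^ 4 / q) / 2))"
      by (rule mult_left_mono) simp
    then show ?thesis by (simp only: mult_ac times_divide_eq_right)
  qed
  moreover have "m * r\<^sup>2 \<le> k * (3 * (r1\<^sup>2 + r2\<^sup>2 + \<beta>\<^sup>2))"
  proof (rule mult_mono)
    have "0 \<le> (r1 + r2)\<^sup>2" "0 \<le> (r1 - \<beta>)\<^sup>2" "0 \<le> (r2 + \<beta>)\<^sup>2" by simp_all
    then show "r\<^sup>2 \<le> 3 * (r1\<^sup>2 + r2\<^sup>2 + \<beta>\<^sup>2)"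
      by (simp add: r_def power2_eq_square algebra_simps)
  qed (use m k in auto)
  moreover have "arsinh (k * x) * h \<le> arsinh (k * x) * d + \<bar>arsinh (k * x)\<bar> * \<bar>\<beta>\<bar>"
    unfolding h(1) distrib_left abs_mult[symmetric] by simp
  moreover have "k * (3 * (r1\<^sup>2 + r2\<^sup>2 + \<beta>\<^sup>2)) = 3 * k * (r1\<^sup>2 + r2\<^sup>2 + \<beta>\<^sup>2)" by simp
  ultimately show ?thesis unfolding m(4) by linarith
qed

section \<open>Gronwall's inequality on a grid and integrals over time\<close>

lemma discrete_gronwall:
  fixes u :: "nat \<Rightarrow> real"
  assumes "u 0 \<le> 0" and step: "\<And>i. i < n \<Longrightarrow> u (Suc i) \<le> (1 + \<alpha>) * u i + \<gamma>" and "0 \<le> \<alpha>" "0 \<le> \<gamma>"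
  shows "u n \<le> real n * \<gamma> * exp (real n * \<alpha>)"
proof -
  \<comment> \<open>Each of the i contributions \<gamma> is amplified by at most (1 + \<alpha>)^i;
    charging all of them the full factor keeps the induction hypothesis simple.\<close>
  have "u i \<le> real i * \<gamma> * (1 + \<alpha>) ^ i" if "i \<le> n" for i
    using that
  proof (induction i)
    case (Suc i)
    have "u (Suc i) \<le> (1 + \<alpha>) * u i + \<gamma>" using step Suc.prems by simp
    also have "\<dots> \<le> (1 + \<alpha>) * (real i * \<gamma> * (1 + \<alpha>) ^ i) + \<gamma> * (1 + \<alpha>) ^ Suc i"
    proof (rule add_mono)
      have "1 \<le> (1 + \<alpha>) ^ Suc i" using assms(3) by (intro one_le_power) simp
      then show "\<gamma> \<le> \<gamma> * (1 + \<alpha>) ^ Suc i" using mult_left_mono[of 1 _ \<gamma>] assms(4) by simp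
    qed (use Suc assms(3) in \<open>auto intro!: mult_left_mono\<close>)
    also have "\<dots> = real (Suc i) * \<gamma> * (1 + \<alpha>) ^ Suc i" by (simp add: algebra_simps)
    finally show ?case .
  qed (use assms(1) in simp)
  then have "u n \<le> real n * \<gamma> * (1 + \<alpha>) ^ n" by simp
  also have "\<dots> \<le> real n * \<gamma> * exp \<alpha> ^ n"
    using assms(3,4) exp_ge_add_one_self[of \<alpha>] by (intro mult_left_mono power_mono) auto
  also have "exp \<alpha> ^ n = exp (real n * \<alpha>)" by (rule exp_of_nat_mult[symmetric])
  finally show ?thesis .
qed

text \<open>Fubini's theorem, justified by the uniform bound \<open>B\<close> on an interval of
  finite length.\<close>

lemma expectation_time_integral:
  fixes Z :: "real \<Rightarrow> 'a \<Rightarrow> real"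
  assumes "prob_space N"
    and joint: "(\<lambda>(r, \<omega>). Z r \<omega>) \<in> borel_measurable (lborel \<Otimes>\<^sub>M N)"
    and Z: "\<And>r \<omega>. \<omega> \<in> space N \<Longrightarrow> \<bar>Z r \<omega>\<bar> \<le> B"
    and e: "\<And>r. s < r \<Longrightarrow> r \<le> t \<Longrightarrow> (\<integral>\<omega>. Z r \<omega> \<partial>N) \<le> e" and st: "s \<le> t"
  shows "integrable N (\<lambda>\<omega>. LINT r:{s<..t}|lborel. Z r \<omega>)"
    and "(\<integral>\<omega>. (LINT r:{s<..t}|lborel. Z r \<omega>) \<partial>N) \<le> e * (t - s)"
proof -
  interpret N: prob_space N by fact
  interpret P: pair_sigma_finite lborel N ..
  define f where "f = (\<lambda>r \<omega>. indicator {s<..t} r *\<^sub>R Z r \<omega>)"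
  have meas [measurable]: "(\<lambda>(r, \<omega>). f r \<omega>) \<in> borel_measurable (lborel \<Otimes>\<^sub>M N)"
  proof -
    have "(\<lambda>p :: real \<times> 'a. indicator {s<..t} (fst p) :: real) \<in> borel_measurable (lborel \<Otimes>\<^sub>M N)"
      by measurable
    from borel_measurable_scaleR[OF this joint[unfolded split_beta']] show ?thesis
      by (simp only: f_def split_beta')
  qed
  have "integrable (lborel \<Otimes>\<^sub>M N) (indicator ({s<..t} \<times> space N) :: _ \<Rightarrow> real)"
  proof (rule integrable_real_indicator)
    show "emeasure (lborel \<Otimes>\<^sub>M N) ({s<..t} \<times> space N) < \<infinity>"
      using st by (simp add: N.emeasure_pair_measure_Times N.emeasure_space_1)
  qed simp
  then have "integrable (lborel \<Otimes>\<^sub>M N) (\<lambda>p. B * indicator ({s<..t} \<times> space N) p :: real)"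
    by simp
  then have int: "integrable (lborel \<Otimes>\<^sub>M N) (case_prod f)"
  proof (rule Bochner_Integration.integrable_bound)
    show "AE p in lborel \<Otimes>\<^sub>M N. norm (case_prod f p) \<le> norm (B * indicator ({s<..t} \<times> space N) p :: real)"
    proof (rule AE_I2)
      fix p :: "real \<times> 'a" assume "p \<in> space (lborel \<Otimes>\<^sub>M N)"
      then have "snd p \<in> space N" by (auto simp: space_pair_measure)
      from Z[OF this, of "fst p"] this
      show "norm (case_prod f p) \<le> norm (B * indicator ({s<..t} \<times> space N) p :: real)"
        by (cases p) (auto simp: f_def indicator_def)
    qed
  qed (fact meas)
  have eq: "(LINT r:{s<..t}|lborel. Z r \<omega>) = (\<integral>r. f r \<omega> \<partial>lborel)" for \<omega>
    by (simp add: set_lebesgue_integral_def f_def)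
  show "integrable N (\<lambda>\<omega>. LINT r:{s<..t}|lborel. Z r \<omega>)"
    unfolding eq using P.integrable_snd[OF int] .
  have "(\<integral>\<omega>. (LINT r:{s<..t}|lborel. Z r \<omega>) \<partial>N) = (\<integral>r. (\<integral>\<omega>. f r \<omega> \<partial>N) \<partial>lborel)"
    unfolding eq by (rule P.Fubini_integral[OF int])
  also have "\<dots> \<le> (\<integral>r. e * indicator {s<..t} r \<partial>lborel)"
  proof (rule integral_mono)
    show "integrable lborel (\<lambda>r. \<integral>\<omega>. f r \<omega> \<partial>N)" using P.integrable_fst[OF int] .
    show "integrable lborel (\<lambda>r. e * indicator {s<..t} r :: real)"
      using st by (intro integrable_mult_right integrable_real_indicator) auto
    show "(\<integral>\<omega>. f r \<omega> \<partial>N) \<le> e * indicator {s<..t} r" for r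
      using e[of r] by (auto simp: f_def indicator_def)
  qed
  also have "\<dots> = e * (t - s)" using st by simp
  finally show "(\<integral>\<omega>. (LINT r:{s<..t}|lborel. Z r \<omega>) \<partial>N) \<le> e * (t - s)" .
qed

lemma continuous_set_integrable_Ioc:
  fixes f :: "real \<Rightarrow> real"
  assumes "continuous_on {s..t} f"
  shows "set_integrable lborel {s<..t} f"
  by (rule set_integrable_subset[OF borel_integrable_atLeastAtMost'[OF assms]]) auto

lemma set_integral_Icc_diff:
  fixes f :: "real \<Rightarrow> real"
  assumes "continuous_on {0..T} f" "0 \<le> s" "s \<le> t" "t \<le> T"
  shows "(LINT r:{0..t}|lborel. f r) - (LINT r:{0..s}|lborel. f r) = (LINT r:{s<..t}|lborel. f r)"
proof -
  have c: "continuous_on {0..s} f" "continuous_on {s..t} f"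
    using assms by (auto intro: continuous_on_subset)
  have "{0..t} = {0..s} \<union> {s<..t}" "{0..s} \<inter> {s<..t} = {}" using assms by auto
  then have "(LINT r:{0..t}|lborel. f r) = (LINT r:{0..s}|lborel. f r) + (LINT r:{s<..t}|lborel. f r)"
    using set_integral_Un[OF _ borel_integrable_atLeastAtMost'[OF c(1)] continuous_set_integrable_Ioc[OF c(2)]] by auto
  then show ?thesis by simp
qed

lemma abs_set_integral_Ioc_le:
  fixes f g :: "real \<Rightarrow> real"
  assumes "continuous_on {s..t} f" "continuous_on {s..t} g" "\<And>r. s < r \<Longrightarrow> r \<le> t \<Longrightarrow> \<bar>f r\<bar> \<le> g r"
  shows "\<bar>LINT r:{s<..t}|lborel. f r\<bar> \<le> (LINT r:{s<..t}|lborel. g r)"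
proof -
  note i = assms(1,2)[THEN continuous_set_integrable_Ioc]
  have "\<bar>LINT r:{s<..t}|lborel. f r\<bar> \<le> (LINT r:{s<..t}|lborel. \<bar>f r\<bar>)"
    using set_integral_norm_bound[OF i(1)] by simp
  also have "\<dots> \<le> (LINT r:{s<..t}|lborel. g r)"
    by (rule set_integral_mono[OF set_integrable_abs[OF i(1)] i(2)]) (use assms(3) in auto)
  finally show ?thesis .
qed

lemma set_integral_Ioc_const: "s \<le> t \<Longrightarrow> (LINT r:{s<..t}|lborel. c) = (t - s) * (c::real)"
  by (simp add: set_lebesgue_integral_def)

section \<open>Bounded stochastic differential equations\<close>

text \<open>The bounds on the coefficients are required on {0..1} only, where the process lives, and
  one constant \<open>L\<close> serves all of them. The equation is required at each fixed time,
  with a null set depending on the time.\<close>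

locale bounded_sde = brownian_filtration "completion M" F T W
  for M :: "'a measure" and F T W +
  fixes Y I :: "real \<Rightarrow> 'a \<Rightarrow> real" and b \<sigma> :: "real \<Rightarrow> real" and L :: real
  assumes L: "1 \<le> L"
    and b_cont: "continuous_on UNIV b" and \<sigma>_cont: "continuous_on UNIV \<sigma>"
    and b_bound: "\<And>x. x \<in> {0..1} \<Longrightarrow> \<bar>b x\<bar> \<le> L" and \<sigma>_bound: "\<And>x. x \<in> {0..1} \<Longrightarrow> \<bar>\<sigma> x\<bar> \<le> L"
    and b_lipschitz: "\<And>x y. x \<in> {0..1} \<Longrightarrow> y \<in> {0..1} \<Longrightarrow> \<bar>b x - b y\<bar> \<le> L * \<bar>x - y\<bar>"
    and \<sigma>_holder: "\<And>x y. x \<in> {0..1} \<Longrightarrow> y \<in> {0..1} \<Longrightarrow> (\<sigma> x - \<sigma> y)\<^sup>2 \<le> L * \<bar>x - y\<bar>"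
    and Y_range: "\<And>t \<omega>. 0 \<le> t \<Longrightarrow> t \<le> T \<Longrightarrow> \<omega> \<in> space M \<Longrightarrow> Y t \<omega> \<in> {0..1}"
    and Y_cont: "\<And>\<omega>. \<omega> \<in> space M \<Longrightarrow> continuous_on {0..T} (\<lambda>t. Y t \<omega>)"
    and Y_adapted: "\<And>t. 0 \<le> t \<Longrightarrow> t \<le> T \<Longrightarrow> Y t \<in> borel_measurable (F t)"
    and Y_ito: "ito_integral M F T W (\<lambda>s \<omega>. \<sigma> (Y s \<omega>)) I"
    and Y_sde: "\<And>t. 0 \<le> t \<Longrightarrow> t \<le> T \<Longrightarrow>
      AE \<omega> in completion M. Y t \<omega> = Y 0 \<omega> + (LINT r:{0..t}|lborel. b (Y r \<omega>)) + I t \<omega>"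
begin

abbreviation "N \<equiv> completion M"

definition R :: "real \<Rightarrow> real \<Rightarrow> 'a \<Rightarrow> real" where
  "R s t \<omega> = I t \<omega> - I s \<omega> - \<sigma> (Y s \<omega>) * (W t \<omega> - W s \<omega>)"

text \<open>\<open>L\<close> stems from the drift, 1/2 from Young's inequality, and 9 * L^2 is half
  of the constant 18 * L^2 in the second moment of the martingale increment.\<close>

definition c1 :: real where "c1 = L + 1 / 2 + 9 * L\<^sup>2"

lemma c1_nonneg: "0 \<le> c1" using L by (simp add: c1_def)

lemma \<sigma>Y_cont: "\<omega> \<in> space M \<Longrightarrow> continuous_on {0..T} (\<lambda>t. \<sigma> (Y t \<omega>))"
  by (rule continuous_on_compose2[OF \<sigma>_cont Y_cont]) auto

lemma bY_cont: "\<omega> \<in> space M \<Longrightarrow> continuous_on {0..T} (\<lambda>t. b (Y t \<omega>))"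
  by (rule continuous_on_compose2[OF b_cont Y_cont]) auto

lemma \<sigma>Y_adapted: "0 \<le> t \<Longrightarrow> t \<le> T \<Longrightarrow> (\<lambda>\<omega>. \<sigma> (Y t \<omega>)) \<in> borel_measurable (F t)"
  using measurable_compose[OF Y_adapted borel_measurable_continuous_onI[OF \<sigma>_cont]] by simp

lemma Y_measurable: "0 \<le> t \<Longrightarrow> t \<le> T \<Longrightarrow> Y t \<in> borel_measurable N"
  using F_measurable Y_adapted by blast

lemma \<sigma>Y_measurable: "0 \<le> t \<Longrightarrow> t \<le> T \<Longrightarrow> (\<lambda>\<omega>. \<sigma> (Y t \<omega>)) \<in> borel_measurable N"
  using F_measurable \<sigma>Y_adapted by blast

lemma \<sigma>Y_bound: "0 \<le> t \<Longrightarrow> t \<le> T \<Longrightarrow> \<omega> \<in> space M \<Longrightarrow> \<bar>\<sigma> (Y t \<omega>)\<bar> \<le> L"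
  using \<sigma>_bound Y_range by blast

lemma I_measurable: "0 \<le> t \<Longrightarrow> t \<le> T \<Longrightarrow> I t \<in> borel_measurable N"
proof -
  have "adapted_process F T I" using Y_ito unfolding ito_integral_def by blast
  then show "0 \<le> t \<Longrightarrow> t \<le> T \<Longrightarrow> I t \<in> borel_measurable N"
    using F_measurable[of t "I t"] by (simp add: adapted_process_def)
qed

lemma W_increment_second: "0 \<le> s \<Longrightarrow> s \<le> t \<Longrightarrow> t \<le> T \<Longrightarrow> (\<integral>\<omega>. (W t \<omega> - W s \<omega>)\<^sup>2 \<partial>N) = t - s"
  using increment_second[of s t "\<lambda>_. 1"] increment_integrable[of s t] prob_space by simp

lemmas R_square_integrable = ito_increment_square_integrable[OF brownian_filtration_axioms Y_ito \<sigma>Y_cont \<sigma>Y_adapted \<sigma>Y_bound, folded R_def]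
lemmas R_second_moment_le = ito_increment_second_moment[OF brownian_filtration_axioms Y_ito \<sigma>Y_cont \<sigma>Y_adapted \<sigma>Y_bound, folded R_def]
lemmas R_orthogonal = ito_increment_orthogonal[OF brownian_filtration_axioms Y_ito \<sigma>Y_cont \<sigma>Y_adapted \<sigma>Y_bound, folded R_def]

text \<open>The crude half of the bootstrap. Two values of \<sigma> differ by at most 2 * L, which
  gives 8 * L^2 * (t - s) for the Euler error \<open>R\<close>; adding the Euler step itself yields
  18 = 2 * 8 + 2.\<close>

lemma
  assumes st: "0 \<le> s" "s < t" "t \<le> T"
  shows I_increment_square_integrable: "integrable N (\<lambda>\<omega>. (I t \<omega> - I s \<omega>)\<^sup>2)"
    and I_increment_second_moment: "(\<integral>\<omega>. (I t \<omega> - I s \<omega>)\<^sup>2 \<partial>N) \<le> 18 * L\<^sup>2 * (t - s)"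
proof -
  have [measurable]: "I t \<in> borel_measurable N" "I s \<in> borel_measurable N"
    using I_measurable st by auto
  have int: "integrable N (\<lambda>\<omega>. 2 * (R s t \<omega>)\<^sup>2 + 2 * L\<^sup>2 * (W t \<omega> - W s \<omega>)\<^sup>2)"
    using R_square_integrable[OF _ _ _ _ _ _ st] increment_integrable(2)[of s t] st by simp
  have le: "(I t \<omega> - I s \<omega>)\<^sup>2 \<le> 2 * (R s t \<omega>)\<^sup>2 + 2 * L\<^sup>2 * (W t \<omega> - W s \<omega>)\<^sup>2" if "\<omega> \<in> space N" for \<omega>
  proof -
    let ?x = "\<sigma> (Y s \<omega>) * (W t \<omega> - W s \<omega>)"
    have "0 \<le> (R s t \<omega> - ?x)\<^sup>2" by simp
    moreover have "I t \<omega> - I s \<omega> = R s t \<omega> + ?x" by (simp add: R_def)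
    ultimately have "(I t \<omega> - I s \<omega>)\<^sup>2 \<le> 2 * (R s t \<omega>)\<^sup>2 + 2 * ?x\<^sup>2"
      by (simp only: power2_sum power2_diff)
    moreover have "(\<sigma> (Y s \<omega>))\<^sup>2 * (W t \<omega> - W s \<omega>)\<^sup>2 \<le> L\<^sup>2 * (W t \<omega> - W s \<omega>)\<^sup>2"
      using power_mono[OF \<sigma>Y_bound[of s \<omega>] abs_ge_zero, of 2] that st by (intro mult_right_mono) auto
    ultimately show ?thesis by (simp add: power_mult_distrib)
  qed
  show i: "integrable N (\<lambda>\<omega>. (I t \<omega> - I s \<omega>)\<^sup>2)"
  proof (rule Bochner_Integration.integrable_bound[OF int])
    show "AE \<omega> in N. norm ((I t \<omega> - I s \<omega>)\<^sup>2) \<le> norm (2 * (R s t \<omega>)\<^sup>2 + 2 * L\<^sup>2 * (W t \<omega> - W s \<omega>)\<^sup>2)"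
      using le by (intro AE_I2) simp
  qed measurable
  have R8: "(\<integral>\<omega>. (R s t \<omega>)\<^sup>2 \<partial>N) \<le> 2 * (4 * L\<^sup>2) * (t - s)"
  proof (rule R_second_moment_le[OF _ _ _ _ _ _ st])
    fix r assume r: "s \<le> r" "r \<le> t"
    have bd: "(\<sigma> (Y r \<omega>) - \<sigma> (Y s \<omega>))\<^sup>2 \<le> 4 * L\<^sup>2" if "\<omega> \<in> space M" for \<omega>
    proof -
      have "\<bar>\<sigma> (Y r \<omega>) - \<sigma> (Y s \<omega>)\<bar> \<le> 2 * L"
        using \<sigma>Y_bound[of r \<omega>] \<sigma>Y_bound[of s \<omega>] that r st by simp
      from power_mono[OF this abs_ge_zero, of 2] show ?thesis by (simp add: power_mult_distrib)
    qed
    have [measurable]: "(\<lambda>\<omega>. \<sigma> (Y r \<omega>)) \<in> borel_measurable N" "(\<lambda>\<omega>. \<sigma> (Y s \<omega>)) \<in> borel_measurable N"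
      using \<sigma>Y_measurable r st by auto
    have "(\<integral>\<omega>. (\<sigma> (Y r \<omega>) - \<sigma> (Y s \<omega>))\<^sup>2 \<partial>N) \<le> (\<integral>\<omega>. 4 * L\<^sup>2 \<partial>N)"
      by (rule integral_mono) (use bd in \<open>auto intro!: integrable_const_bound[where B = "4 * L\<^sup>2"]\<close>)
    then show "(\<integral>\<omega>. (\<sigma> (Y r \<omega>) - \<sigma> (Y s \<omega>))\<^sup>2 \<partial>N) \<le> 4 * L\<^sup>2"
      using prob_space by simp
  qed
  have "(\<integral>\<omega>. (I t \<omega> - I s \<omega>)\<^sup>2 \<partial>N) \<le> (\<integral>\<omega>. 2 * (R s t \<omega>)\<^sup>2 + 2 * L\<^sup>2 * (W t \<omega> - W s \<omega>)\<^sup>2 \<partial>N)"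
    by (rule integral_mono[OF i int le])
  also have "\<dots> = 2 * (\<integral>\<omega>. (R s t \<omega>)\<^sup>2 \<partial>N) + 2 * L\<^sup>2 * (t - s)"
    using R_square_integrable[OF _ _ _ _ _ _ st] increment_integrable(2)[of s t] W_increment_second[of s t] st by simp
  also have "\<dots> \<le> 18 * L\<^sup>2 * (t - s)" using R8 by (simp add: mult.commute)
  finally show "(\<integral>\<omega>. (I t \<omega> - I s \<omega>)\<^sup>2 \<partial>N) \<le> 18 * L\<^sup>2 * (t - s)" .
qed

lemma Y_increment:
  assumes st: "0 \<le> s" "s \<le> t" "t \<le> T"
  shows "AE \<omega> in N. Y t \<omega> - Y s \<omega> = (LINT r:{s<..t}|lborel. b (Y r \<omega>)) + (I t \<omega> - I s \<omega>)"
proof -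
  have "AE \<omega> in N. Y t \<omega> = Y 0 \<omega> + (LINT r:{0..t}|lborel. b (Y r \<omega>)) + I t \<omega>"
    "AE \<omega> in N. Y s \<omega> = Y 0 \<omega> + (LINT r:{0..s}|lborel. b (Y r \<omega>)) + I s \<omega>"
    using Y_sde st by auto
  then show ?thesis using AE_space
  proof eventually_elim
    case (elim \<omega>)
    then have "\<omega> \<in> space M" by simp
    from set_integral_Icc_diff[OF bY_cont[OF this] st] elim(1,2) show ?case by linarith
  qed
qed

lemma drift_integral_bound:
  assumes st: "0 \<le> s" "s \<le> t" "t \<le> T" and \<omega>: "\<omega> \<in> space M"
  shows "\<bar>LINT r:{s<..t}|lborel. b (Y r \<omega>)\<bar> \<le> L * (t - s)"
proof -
  have "\<bar>LINT r:{s<..t}|lborel. b (Y r \<omega>)\<bar> \<le> (LINT r:{s<..t}|lborel. L)"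
  proof (rule abs_set_integral_Ioc_le)
    show "continuous_on {s..t} (\<lambda>r. b (Y r \<omega>))"
      using bY_cont[OF \<omega>] st by (auto intro: continuous_on_subset)
    show "\<bar>b (Y r \<omega>)\<bar> \<le> L" if "s < r" "r \<le> t" for r
      using that st \<omega> by (intro b_bound Y_range) auto
  qed simp
  then show ?thesis using st by (simp add: set_integral_Ioc_const mult.commute)
qed

text \<open>Young's inequality with weight q = sqrt (t - s) turns the second moment of order q^2
  into a first moment of order q. The drift contributes q^2, which is at most q because t - s <=
  1.\<close>

lemma Y_increment_expectation:
  assumes st: "0 \<le> s" "s \<le> t" "t \<le> T" "t - s \<le> 1"
  shows "(\<integral>\<omega>. \<bar>Y t \<omega> - Y s \<omega>\<bar> \<partial>N) \<le> c1 * sqrt (t - s)"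
proof (cases "s = t")
  case False
  then have st': "0 \<le> s" "s < t" "t \<le> T" using st by auto
  define q where "q = sqrt (t - s)"
  have q: "0 < q" "q\<^sup>2 = t - s" using st' by (auto simp: q_def)
  have q1: "q \<le> 1" using st by (simp add: q_def)
  have [measurable]: "Y t \<in> borel_measurable N" "Y s \<in> borel_measurable N"
    using Y_measurable st by auto
  have "(\<integral>\<omega>. \<bar>Y t \<omega> - Y s \<omega>\<bar> \<partial>N) \<le> (\<integral>\<omega>. (L * (t - s) + q / 2) + (I t \<omega> - I s \<omega>)\<^sup>2 / (2 * q) \<partial>N)"
  proof (rule integral_mono_AE)
    show "integrable N (\<lambda>\<omega>. \<bar>Y t \<omega> - Y s \<omega>\<bar>)"
    proof (rule integrable_const_bound[where B = 1])
      show "AE \<omega> in N. norm \<bar>Y t \<omega> - Y s \<omega>\<bar> \<le> 1"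
        using Y_range[of t] Y_range[of s] st by (intro AE_I2) (force simp: abs_le_iff)
    qed measurable
    show "integrable N (\<lambda>\<omega>. (L * (t - s) + q / 2) + (I t \<omega> - I s \<omega>)\<^sup>2 / (2 * q))"
      using I_increment_square_integrable[OF st'] by simp
    show "AE \<omega> in N. \<bar>Y t \<omega> - Y s \<omega>\<bar> \<le> (L * (t - s) + q / 2) + (I t \<omega> - I s \<omega>)\<^sup>2 / (2 * q)"
      using Y_increment[OF st(1-3)] AE_space
    proof eventually_elim
      case (elim \<omega>)
      have "0 \<le> (q - \<bar>I t \<omega> - I s \<omega>\<bar>)\<^sup>2" by simp
      then have "\<bar>I t \<omega> - I s \<omega>\<bar> \<le> q / 2 + (I t \<omega> - I s \<omega>)\<^sup>2 / (2 * q)"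
        using q(1) by (simp add: power2_diff field_simps power2_eq_square[of q])
      moreover have "\<bar>LINT r:{s<..t}|lborel. b (Y r \<omega>)\<bar> \<le> L * (t - s)"
        using drift_integral_bound[OF st(1-3)] elim by simp
      ultimately show ?case using elim(1) by linarith
    qed
  qed
  also have "\<dots> = (L * (t - s) + q / 2) + (\<integral>\<omega>. (I t \<omega> - I s \<omega>)\<^sup>2 \<partial>N) / (2 * q)"
    using I_increment_square_integrable[OF st'] prob_space by simp
  also have "\<dots> \<le> (L * (t - s) + q / 2) + (18 * L\<^sup>2 * (t - s)) / (2 * q)"
    using I_increment_second_moment[OF st'] q by (intro add_left_mono divide_right_mono) auto
  also have "(18 * L\<^sup>2 * (t - s)) / (2 * q) = 9 * L\<^sup>2 * q"
    unfolding q(2)[symmetric] using q(1) by (simp add: power2_eq_square)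
  also have "L * (t - s) \<le> L * q"
    unfolding q(2)[symmetric] using q(1) q1 L by (simp add: power2_eq_square mult_left_le)
  finally show ?thesis unfolding c1_def q_def by (simp add: algebra_simps)
qed simp

text \<open>The refined half of the bootstrap: by the Hoelder condition the squared variation of
  \<sigma> along the path is bounded by a first moment of increments of \<open>Y\<close>. The order
  rises from 1 to 3/2, and so the sum over a grid vanishes with the mesh.\<close>

lemma R_second_moment:
  assumes st: "0 \<le> s" "s < t" "t \<le> T" and "t - s \<le> 1"
  shows "(\<integral>\<omega>. (R s t \<omega>)\<^sup>2 \<partial>N) \<le> 2 * (L * c1 * sqrt (t - s)) * (t - s)"
proof (rule R_second_moment_le[OF _ _ _ _ _ _ st])
  fix r assume r: "s \<le> r" "r \<le> t"
  have [measurable]: "(\<lambda>\<omega>. \<sigma> (Y r \<omega>)) \<in> borel_measurable N" "(\<lambda>\<omega>. \<sigma> (Y s \<omega>)) \<in> borel_measurable N"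
    "Y r \<in> borel_measurable N" "Y s \<in> borel_measurable N"
    using \<sigma>Y_measurable Y_measurable r st by auto
  have hol: "(\<sigma> (Y r \<omega>) - \<sigma> (Y s \<omega>))\<^sup>2 \<le> L * \<bar>Y r \<omega> - Y s \<omega>\<bar>" if "\<omega> \<in> space M" for \<omega>
    using r st that by (intro \<sigma>_holder Y_range) auto
  have i: "integrable N (\<lambda>\<omega>. L * \<bar>Y r \<omega> - Y s \<omega>\<bar>)"
  proof (intro integrable_mult_right integrable_const_bound[where B = 1])
    show "AE \<omega> in N. norm \<bar>Y r \<omega> - Y s \<omega>\<bar> \<le> 1"
      using Y_range[of r] Y_range[of s] st r by (intro AE_I2) (force simp: abs_le_iff)
  qed measurable
  have "(\<integral>\<omega>. (\<sigma> (Y r \<omega>) - \<sigma> (Y s \<omega>))\<^sup>2 \<partial>N) \<le> (\<integral>\<omega>. L * \<bar>Y r \<omega> - Y s \<omega>\<bar> \<partial>N)"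
  proof (rule integral_mono[OF _ i])
    show "integrable N (\<lambda>\<omega>. (\<sigma> (Y r \<omega>) - \<sigma> (Y s \<omega>))\<^sup>2)"
      by (rule Bochner_Integration.integrable_bound[OF i]) (use hol in \<open>auto intro!: order_trans[OF _ abs_ge_self]\<close>)
  qed (use hol in auto)
  also have "\<dots> = L * (\<integral>\<omega>. \<bar>Y r \<omega> - Y s \<omega>\<bar> \<partial>N)" by simp
  also have "\<dots> \<le> L * (c1 * sqrt (r - s))"
    using Y_increment_expectation[of s r] r assms L by (intro mult_left_mono) auto
  also have "\<dots> \<le> L * (c1 * sqrt (t - s))"
    using r L c1_nonneg by (intro mult_left_mono) auto
  finally show "(\<integral>\<omega>. (\<sigma> (Y r \<omega>) - \<sigma> (Y s \<omega>))\<^sup>2 \<partial>N) \<le> L * c1 * sqrt (t - s)" by simp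
qed

lemma I_increment_orthogonal:
  assumes st: "0 \<le> s" "s < t" "t \<le> T"
    and \<eta>: "\<eta> \<in> borel_measurable (F s)" "\<And>\<omega>. \<omega> \<in> space M \<Longrightarrow> \<bar>\<eta> \<omega>\<bar> \<le> d"
  shows "integrable N (\<lambda>\<omega>. \<eta> \<omega> * (I t \<omega> - I s \<omega>))" "(\<integral>\<omega>. \<eta> \<omega> * (I t \<omega> - I s \<omega>) \<partial>N) = 0"
proof -
  have R: "integrable N (\<lambda>\<omega>. \<eta> \<omega> * R s t \<omega>)" "(\<integral>\<omega>. \<eta> \<omega> * R s t \<omega> \<partial>N) = 0"
    using R_orthogonal[OF _ _ _ _ _ _ st \<eta>] by auto
  have [measurable]: "\<eta> \<in> borel_measurable N" "(\<lambda>\<omega>. \<sigma> (Y s \<omega>)) \<in> borel_measurable N"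
    using F_measurable[OF _ _ \<eta>(1)] \<sigma>Y_measurable st by auto
  have i: "integrable N (\<lambda>\<omega>. \<eta> \<omega> * \<sigma> (Y s \<omega>) * (W t \<omega> - W s \<omega>))"
  proof (rule integrable_bounded_mult)
    show "\<bar>\<eta> \<omega> * \<sigma> (Y s \<omega>)\<bar> \<le> d * L" if "\<omega> \<in> space N" for \<omega>
      using \<eta>(2)[of \<omega>] \<sigma>Y_bound[of s \<omega>] that st
      unfolding abs_mult by (intro mult_mono) (auto intro: order_trans[OF abs_ge_zero])
  qed (use increment_integrable(3) st in auto)
  have z: "(\<integral>\<omega>. \<eta> \<omega> * \<sigma> (Y s \<omega>) * (W t \<omega> - W s \<omega>) \<partial>N) = 0"
    using \<eta>(1) \<sigma>Y_adapted[of s] st by (intro increment_mean[OF _ _ _ _ i]) auto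
  have eq: "\<eta> \<omega> * (I t \<omega> - I s \<omega>) = \<eta> \<omega> * R s t \<omega> + \<eta> \<omega> * \<sigma> (Y s \<omega>) * (W t \<omega> - W s \<omega>)" for \<omega>
    by (simp add: R_def algebra_simps)
  show "integrable N (\<lambda>\<omega>. \<eta> \<omega> * (I t \<omega> - I s \<omega>))" "(\<integral>\<omega>. \<eta> \<omega> * (I t \<omega> - I s \<omega>) \<partial>N) = 0"
    unfolding eq using R i z by simp_all
qed

end

section \<open>Pathwise uniqueness\<close>

locale bounded_sde_pair =
  Y1: bounded_sde M F T W Y1 I1 b \<sigma> L + Y2: bounded_sde M F T W Y2 I2 b \<sigma> L
  for M :: "'a measure" and F T W Y1 I1 Y2 I2 b \<sigma> L +
  assumes same_start: "AE \<omega> in M. Y1 0 \<omega> = Y2 0 \<omega>"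
begin

abbreviation "N \<equiv> completion M"

definition D :: "real \<Rightarrow> 'a \<Rightarrow> real" where "D t \<omega> = Y1 t \<omega> - Y2 t \<omega>"

lemma D_bound: "0 \<le> t \<Longrightarrow> t \<le> T \<Longrightarrow> \<omega> \<in> space M \<Longrightarrow> \<bar>D t \<omega>\<bar> \<le> 1"
  using Y1.Y_range[of t \<omega>] Y2.Y_range[of t \<omega>] by (auto simp: D_def abs_le_iff)

lemma D_cont: "\<omega> \<in> space M \<Longrightarrow> continuous_on {0..T} (\<lambda>t. D t \<omega>)"
  unfolding D_def by (intro continuous_on_diff Y1.Y_cont Y2.Y_cont)

lemma D_adapted: "0 \<le> t \<Longrightarrow> t \<le> T \<Longrightarrow> D t \<in> borel_measurable (F t)"
  unfolding D_def[abs_def] by (intro borel_measurable_diff Y1.Y_adapted Y2.Y_adapted)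

lemma D_measurable: "0 \<le> t \<Longrightarrow> t \<le> T \<Longrightarrow> D t \<in> borel_measurable N"
  using Y1.F_measurable D_adapted by blast

lemma yw_D_integrable:
  assumes "0 \<le> t" "t \<le> T" "0 < k"
  shows "integrable N (\<lambda>\<omega>. yw_fun k (D t \<omega>))"
proof (rule Y1.integrable_const_bound[where B = "arsinh k + 1"])
  have "continuous_on UNIV (yw_fun k)"
    using yw_fun_deriv[OF \<open>0 < k\<close>] by (meson DERIV_isCont continuous_at_imp_continuous_on)
  then show "(\<lambda>\<omega>. yw_fun k (D t \<omega>)) \<in> borel_measurable N"
    using measurable_compose[OF D_measurable borel_measurable_continuous_onI] assms by blast
  show "AE \<omega> in N. norm (yw_fun k (D t \<omega>)) \<le> arsinh k + 1"
  proof (rule AE_I2)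
    fix \<omega> assume "\<omega> \<in> space N"
    then have D: "\<bar>D t \<omega>\<bar> \<le> 1" using D_bound assms by simp
    have "\<bar>D t \<omega>\<bar> * \<bar>arsinh (k * D t \<omega>)\<bar> \<le> 1 * arsinh k"
      using D abs_arsinh_le[OF assms(3) D] by (intro mult_mono) auto
    moreover have "0 \<le> \<bar>D t \<omega>\<bar> * \<bar>arsinh (k * D t \<omega>)\<bar>" by simp
    ultimately show "norm (yw_fun k (D t \<omega>)) \<le> arsinh k + 1"
      using yw_fun_upper[OF assms(3), of "D t \<omega>"] yw_fun_lower[OF assms(3), of "D t \<omega>"] D
      unfolding real_norm_def by linarith
  qed
qed

text \<open>It collects the coefficients of \<Delta>^(3/2) in one grid step: the variation of
  \<open>D\<close> inside the step in the drift, the third-order Taylor remainder, and the squares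
  of the two Euler errors and of the drift part.\<close>

definition \<Gamma> :: "real \<Rightarrow> real" where
  "\<Gamma> k = 2 * L * arsinh k * Y1.c1 + 2 * k\<^sup>2 * L\<^sup>2 * (120 * L\<^sup>2 + 3) + 3 * k * (4 * L * Y1.c1 + 4 * L\<^sup>2)"

text \<open>Two estimates of the same quantity: the crude one is squared in the second-order terms,
  while the Lipschitz one keeps a factor |D s| for Gronwall's inequality. Clamping the time makes
  the integrand a process defined at all real times.\<close>

lemma drift_difference:
  assumes st: "0 \<le> s" "s < t" "t \<le> T"
  shows "AE \<omega> in N.
    \<bar>D t \<omega> - D s \<omega> - ((I1 t \<omega> - I1 s \<omega>) - (I2 t \<omega> - I2 s \<omega>))\<bar> \<le> 2 * L * (t - s) \<and>
    \<bar>D t \<omega> - D s \<omega> - ((I1 t \<omega> - I1 s \<omega>) - (I2 t \<omega> - I2 s \<omega>))\<bar> \<le>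
      L * (t - s) * \<bar>D s \<omega>\<bar> + L * (LINT r:{s<..t}|lborel. \<bar>D (max 0 (min T r)) \<omega> - D s \<omega>\<bar>)"
  using Y1.Y_increment[OF st(1) less_imp_le[OF st(2)] st(3)] Y2.Y_increment[OF st(1) less_imp_le[OF st(2)] st(3)] AE_space
proof eventually_elim
  case (elim \<omega>)
  then have \<omega>: "\<omega> \<in> space M" by simp
  have c: "continuous_on {s..t} (\<lambda>r. b (Y1 r \<omega>))" "continuous_on {s..t} (\<lambda>r. b (Y2 r \<omega>))"
    "continuous_on {s..t} (\<lambda>r. D r \<omega>)"
    using Y1.bY_cont[OF \<omega>] Y2.bY_cont[OF \<omega>] D_cont[OF \<omega>] st by (auto intro: continuous_on_subset)
  have cc: "continuous_on {s..t} (\<lambda>r. D (max 0 (min T r)) \<omega>)"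
    by (rule continuous_on_compose2[OF D_cont[OF \<omega>]]) (use st in \<open>auto intro!: continuous_intros\<close>)
  have cl: "max 0 (min T r) = r" if "s < r" "r \<le> t" for r using that st by auto
  let ?g = "\<lambda>r. L * \<bar>D s \<omega>\<bar> + L * \<bar>D (max 0 (min T r)) \<omega> - D s \<omega>\<bar>"
  have gi: "set_integrable lborel {s<..t} (\<lambda>r. \<bar>D (max 0 (min T r)) \<omega> - D s \<omega>\<bar>)"
    by (intro continuous_set_integrable_Ioc continuous_intros cc)
  have eq: "D t \<omega> - D s \<omega> - ((I1 t \<omega> - I1 s \<omega>) - (I2 t \<omega> - I2 s \<omega>)) =
      (LINT r:{s<..t}|lborel. b (Y1 r \<omega>)) - (LINT r:{s<..t}|lborel. b (Y2 r \<omega>))"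
    using elim(1,2) by (simp add: D_def)
  have eq': "(LINT r:{s<..t}|lborel. b (Y1 r \<omega>)) - (LINT r:{s<..t}|lborel. b (Y2 r \<omega>)) =
      (LINT r:{s<..t}|lborel. b (Y1 r \<omega>) - b (Y2 r \<omega>))"
    by (rule set_integral_diff(2)[symmetric]) (use c in \<open>auto intro: continuous_set_integrable_Ioc\<close>)
  have "\<bar>D t \<omega> - D s \<omega> - ((I1 t \<omega> - I1 s \<omega>) - (I2 t \<omega> - I2 s \<omega>))\<bar> \<le> (LINT r:{s<..t}|lborel. ?g r)"
    unfolding eq eq'
  proof (rule abs_set_integral_Ioc_le)
    fix r assume r: "s < r" "r \<le> t"
    have "\<bar>b (Y1 r \<omega>) - b (Y2 r \<omega>)\<bar> \<le> L * \<bar>D r \<omega>\<bar>"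
      unfolding D_def using r st \<omega> by (intro Y1.b_lipschitz Y1.Y_range Y2.Y_range) auto
    also have "\<dots> \<le> L * (\<bar>D s \<omega>\<bar> + \<bar>D r \<omega> - D s \<omega>\<bar>)"
      using Y1.L by (intro mult_left_mono) auto
    finally show "\<bar>b (Y1 r \<omega>) - b (Y2 r \<omega>)\<bar> \<le> ?g r"
      using cl[OF r] by (simp add: distrib_left)
  qed (use c cc in \<open>auto intro!: continuous_intros\<close>)
  also have "\<dots> = L * (t - s) * \<bar>D s \<omega>\<bar> + L * (LINT r:{s<..t}|lborel. \<bar>D (max 0 (min T r)) \<omega> - D s \<omega>\<bar>)"
    using st gi by (subst set_integral_add(2))
      (auto simp: set_integral_Ioc_const mult_ac intro!: continuous_set_integrable_Ioc continuous_intros cc)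
  finally have 2: "\<bar>D t \<omega> - D s \<omega> - ((I1 t \<omega> - I1 s \<omega>) - (I2 t \<omega> - I2 s \<omega>))\<bar> \<le>
      L * (t - s) * \<bar>D s \<omega>\<bar> + L * (LINT r:{s<..t}|lborel. \<bar>D (max 0 (min T r)) \<omega> - D s \<omega>\<bar>)" .
  have "\<bar>D t \<omega> - D s \<omega> - ((I1 t \<omega> - I1 s \<omega>) - (I2 t \<omega> - I2 s \<omega>))\<bar> \<le> 2 * (L * (t - s))"
    unfolding eq using Y1.drift_integral_bound[of s t \<omega>] Y2.drift_integral_bound[of s t \<omega>] st \<omega> by linarith
  with 2 show ?case by simp
qed

text \<open>The price of freezing \<open>D\<close> at time \<open>s\<close> in the drift: E|D r - D
  s| is of order sqrt (t - s), and integration over the step raises this to order 3/2.\<close>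

lemma
  assumes st: "0 \<le> s" "s < t" "t \<le> T" "t - s \<le> 1"
  shows D_time_integral_integrable: "integrable N (\<lambda>\<omega>. LINT r:{s<..t}|lborel. \<bar>D (max 0 (min T r)) \<omega> - D s \<omega>\<bar>)"
    and D_time_integral_expectation: "(\<integral>\<omega>. (LINT r:{s<..t}|lborel. \<bar>D (max 0 (min T r)) \<omega> - D s \<omega>\<bar>) \<partial>N) \<le>
      2 * Y1.c1 * sqrt (t - s) * (t - s)"
proof -
  let ?Z = "\<lambda>r \<omega>. \<bar>D (max 0 (min T r)) \<omega> - D s \<omega>\<bar>"
  have "(\<lambda>p. D (max 0 (min T (fst p))) (snd p)) \<in> borel_measurable (lborel \<Otimes>\<^sub>M N)"
  proof (rule jointly_measurable_continuous[where X = "\<lambda>r. D (max 0 (min T r))" and M = N])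
    show "D (max 0 (min T r)) \<in> borel_measurable N" for r
      using st by (intro D_measurable) auto
    show "continuous_on UNIV (\<lambda>r. D (max 0 (min T r)) \<omega>)" if "\<omega> \<in> space N" for \<omega>
      by (rule continuous_on_compose2[OF D_cont[of \<omega>]]) (use st that in \<open>auto intro!: continuous_intros\<close>)
  qed auto
  moreover have "(\<lambda>p. D s (snd p)) \<in> borel_measurable (lborel \<Otimes>\<^sub>M N)"
    using st by (intro measurable_compose[OF measurable_snd] D_measurable) auto
  ultimately have joint: "(\<lambda>(r, \<omega>). ?Z r \<omega>) \<in> borel_measurable (lborel \<Otimes>\<^sub>M N)"
    unfolding split_beta' by (intro borel_measurable_abs borel_measurable_diff)
  have bound: "\<bar>?Z r \<omega>\<bar> \<le> 2" if "\<omega> \<in> space N" for r \<omega>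
    using D_bound[of "max 0 (min T r)" \<omega>] D_bound[of s \<omega>] that st by auto
  have e: "(\<integral>\<omega>. ?Z r \<omega> \<partial>N) \<le> 2 * Y1.c1 * sqrt (t - s)" if r: "s < r" "r \<le> t" for r
  proof -
    have cl: "max 0 (min T r) = r" using r st by auto
    have [measurable]: "Y1 r \<in> borel_measurable N" "Y1 s \<in> borel_measurable N"
      "Y2 r \<in> borel_measurable N" "Y2 s \<in> borel_measurable N"
      using Y1.Y_measurable Y2.Y_measurable r st by auto
    have rng: "Y1 u \<omega> \<in> {0..1}" "Y2 u \<omega> \<in> {0..1}" if "\<omega> \<in> space N" "u = r \<or> u = s" for u \<omega>
      using Y1.Y_range[of u \<omega>] Y2.Y_range[of u \<omega>] that r st by auto
    have i: "integrable N (\<lambda>\<omega>. \<bar>Y1 r \<omega> - Y1 s \<omega>\<bar>)" "integrable N (\<lambda>\<omega>. \<bar>Y2 r \<omega> - Y2 s \<omega>\<bar>)"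
    proof -
      have "\<bar>Y1 r \<omega> - Y1 s \<omega>\<bar> \<le> 1" "\<bar>Y2 r \<omega> - Y2 s \<omega>\<bar> \<le> 1" if "\<omega> \<in> space N" for \<omega>
        using rng[OF that, of r] rng[OF that, of s] by (simp_all add: abs_le_iff)
      then have "AE \<omega> in N. norm \<bar>Y1 r \<omega> - Y1 s \<omega>\<bar> \<le> 1" "AE \<omega> in N. norm \<bar>Y2 r \<omega> - Y2 s \<omega>\<bar> \<le> 1"
        by (auto intro!: AE_I2)
      then show "integrable N (\<lambda>\<omega>. \<bar>Y1 r \<omega> - Y1 s \<omega>\<bar>)" "integrable N (\<lambda>\<omega>. \<bar>Y2 r \<omega> - Y2 s \<omega>\<bar>)"
        by (auto intro!: Y1.integrable_const_bound)
    qed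
    have "(\<integral>\<omega>. ?Z r \<omega> \<partial>N) \<le> (\<integral>\<omega>. \<bar>Y1 r \<omega> - Y1 s \<omega>\<bar> + \<bar>Y2 r \<omega> - Y2 s \<omega>\<bar> \<partial>N)"
    proof (rule integral_mono)
      show "integrable N (?Z r)"
        by (rule Y1.integrable_const_bound[where B = 2])
           (use bound st in \<open>auto intro!: borel_measurable_diff D_measurable borel_measurable_abs\<close>)
    qed (use i cl in \<open>auto simp: D_def\<close>)
    also have "\<dots> = (\<integral>\<omega>. \<bar>Y1 r \<omega> - Y1 s \<omega>\<bar> \<partial>N) + (\<integral>\<omega>. \<bar>Y2 r \<omega> - Y2 s \<omega>\<bar> \<partial>N)"
      using i by simp
    also have "\<dots> \<le> Y1.c1 * sqrt (r - s) + Y1.c1 * sqrt (r - s)"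
      using Y1.Y_increment_expectation[of s r] Y2.Y_increment_expectation[of s r] r st
      by (intro add_mono) auto
    also have "\<dots> \<le> 2 * (Y1.c1 * sqrt (t - s))"
      using r mult_left_mono[OF _ Y1.c1_nonneg, of "sqrt (r - s)" "sqrt (t - s)"] by simp
    finally show ?thesis by simp
  qed
  note * = expectation_time_integral[OF Y1.prob_space_axioms joint bound e]
  show "integrable N (\<lambda>\<omega>. LINT r:{s<..t}|lborel. ?Z r \<omega>)" by (rule *(1)) (use st in auto)
  show "(\<integral>\<omega>. (LINT r:{s<..t}|lborel. ?Z r \<omega>) \<partial>N) \<le> 2 * Y1.c1 * sqrt (t - s) * (t - s)"
    by (rule *(2)) (use st in auto)
qed

text \<open>The substitute for Ito's formula. The first-order martingale term has mean 0 since its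
  factor is known at time \<open>s\<close>. One L * (t - s) comes from the drift, the other from the
  diffusion, where the Hoelder condition cancels the singularity of the second derivative;
  everything else is of order 3/2.\<close>

lemma yw_expectation_step:
  assumes st: "0 \<le> s" "s < t" "t \<le> T" "t - s \<le> 1" and k: "0 < k"
  shows "(\<integral>\<omega>. yw_fun k (D t \<omega>) \<partial>N) \<le> (1 + L * (t - s)) * (\<integral>\<omega>. yw_fun k (D s \<omega>) \<partial>N)
     + (2 * L * (t - s) + \<Gamma> k * (t - s) * sqrt (t - s))"
proof -
  define \<Delta> where "\<Delta> = t - s"
  define q where "q = sqrt \<Delta>"
  have q: "0 < q" "q * q = \<Delta>" "q \<le> 1" using st by (auto simp: q_def \<Delta>_def)
  have \<Delta>: "0 < \<Delta>" "\<Delta> \<le> 1" using st by (auto simp: \<Delta>_def)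
  define P where "P = arsinh k"
  have P: "0 \<le> P" using k by (simp add: P_def less_imp_le)
  define w where "w = (\<lambda>\<omega>. W t \<omega> - W s \<omega>)"
  define d1 where "d1 = (\<lambda>\<omega>. I1 t \<omega> - I1 s \<omega>)"
  define d2 where "d2 = (\<lambda>\<omega>. I2 t \<omega> - I2 s \<omega>)"
  define R1 where "R1 = Y1.R s t"
  define R2 where "R2 = Y2.R s t"
  define G where "G = (\<lambda>\<omega>. LINT r:{s<..t}|lborel. \<bar>D (max 0 (min T r)) \<omega> - D s \<omega>\<bar>)"
  define \<eta> where "\<eta> = (\<lambda>\<omega>. arsinh (k * D s \<omega>))"
  define f where "f = (\<lambda>\<omega>. (1 + L * \<Delta>) * yw_fun k (D s \<omega>) + L * \<Delta> + \<eta> \<omega> * d1 \<omega> - \<eta> \<omega> * d2 \<omega>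
     + L * P * G \<omega> + L * (w \<omega>)\<^sup>2
     + 2 * k\<^sup>2 * L\<^sup>2 * (q * (12 * L\<^sup>2 * \<Delta>\<^sup>2 + 3 * (d1 \<omega>)\<^sup>2 + 3 * (d2 \<omega>)\<^sup>2) + 1 / q * w \<omega> ^ 4)
     + 3 * k * ((R1 \<omega>)\<^sup>2 + (R2 \<omega>)\<^sup>2 + 4 * L\<^sup>2 * \<Delta>\<^sup>2))"
  have st3: "0 \<le> s" "s < t" "t \<le> T" using st by auto
  have L0: "0 \<le> L" using Y1.L by simp
  have le: "AE \<omega> in N. yw_fun k (D t \<omega>) \<le> f \<omega>"
    using drift_difference[OF st3] AE_space
  proof eventually_elim
    case (elim \<omega>)
    then have \<omega>: "\<omega> \<in> space M" by simp
    define \<beta> where "\<beta> = D t \<omega> - D s \<omega> - (d1 \<omega> - d2 \<omega>)"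
    define S where "S = \<sigma> (Y1 s \<omega>) - \<sigma> (Y2 s \<omega>)"
    define x where "x = D s \<omega>"
    define h where "h = D t \<omega> - D s \<omega>"
    have \<beta>: "\<bar>\<beta>\<bar> \<le> 2 * L * \<Delta>" "\<bar>\<beta>\<bar> \<le> L * \<Delta> * \<bar>x\<bar> + L * G \<omega>"
      using elim(1) unfolding \<beta>_def d1_def d2_def G_def \<Delta>_def x_def by auto
    have x1: "\<bar>x\<bar> \<le> 1" using D_bound[of s \<omega>] \<omega> st by (simp add: x_def)
    have h_eq: "h = (d1 \<omega> - d2 \<omega>) + \<beta>" by (simp add: h_def \<beta>_def)
    have d_eq: "d1 \<omega> - d2 \<omega> = S * w \<omega> + R1 \<omega> - R2 \<omega>"
      by (simp add: d1_def d2_def S_def R1_def R2_def w_def Y1.R_def Y2.R_def algebra_simps)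
    have SL: "S\<^sup>2 \<le> L * \<bar>x\<bar>"
      unfolding S_def x_def D_def using \<omega> st by (intro Y1.\<sigma>_holder Y1.Y_range Y2.Y_range) auto
    have "\<bar>S\<bar> \<le> 2 * L"
      using Y1.\<sigma>Y_bound[of s \<omega>] Y2.\<sigma>Y_bound[of s \<omega>] \<omega> st unfolding S_def by simp
    from power_mono[OF this abs_ge_zero, of 2] have S4: "S\<^sup>2 \<le> 4 * L\<^sup>2"
      by (simp add: power_mult_distrib)
    have step: "yw_fun k (x + h) \<le> yw_fun k x + arsinh (k * x) * (d1 \<omega> - d2 \<omega>) + \<bar>arsinh (k * x)\<bar> * \<bar>\<beta>\<bar>
        + yw_fun2 k x * S\<^sup>2 * (w \<omega>)\<^sup>2
        + k\<^sup>2 * (4 * L\<^sup>2) * (q * h\<^sup>2 + w \<omega> ^ 4 / q) / 2 + 3 * k * ((R1 \<omega>)\<^sup>2 + (R2 \<omega>)\<^sup>2 + \<beta>\<^sup>2)"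
      by (rule yw_fun_step[OF k q(1) h_eq d_eq S4])
    \<comment> \<open>The derivative is weighted with |x|, so it is at most
      \<open>yw_fun k x + 1\<close> independently of \<open>k\<close>; only the variation inside the
      step meets the large bound P = arsinh k.\<close>
    have 1: "\<bar>arsinh (k * x)\<bar> * \<bar>\<beta>\<bar> \<le> L * \<Delta> * (yw_fun k x + 1) + L * P * G \<omega>"
    proof -
      have aP: "\<bar>arsinh (k * x)\<bar> \<le> P" using abs_arsinh_le[OF k x1] by (simp add: P_def)
      have G0: "0 \<le> G \<omega>" unfolding G_def set_lebesgue_integral_def
        by (intro Bochner_Integration.integral_nonneg) simp
      have "\<bar>arsinh (k * x)\<bar> * \<bar>\<beta>\<bar> \<le> \<bar>arsinh (k * x)\<bar> * (L * \<Delta> * \<bar>x\<bar> + L * G \<omega>)"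
        using \<beta>(2) by (intro mult_left_mono) auto
      also have "\<dots> = L * \<Delta> * (\<bar>x\<bar> * \<bar>arsinh (k * x)\<bar>) + L * (\<bar>arsinh (k * x)\<bar> * G \<omega>)"
        by (simp add: algebra_simps)
      also have "\<dots> \<le> L * \<Delta> * (yw_fun k x + 1) + L * (P * G \<omega>)"
        using yw_fun_lower[OF k, of x] x1 L0 \<Delta> aP G0
        by (intro add_mono mult_left_mono mult_right_mono) auto
      finally show ?thesis by (simp add: mult.assoc)
    qed
    \<comment> \<open>The decisive cancellation: S^2 <= L * |x| and |x| * yw_fun2 k x <= 1, with no
      dependence on \<open>k\<close>.\<close>
    have 2: "yw_fun2 k x * S\<^sup>2 * (w \<omega>)\<^sup>2 \<le> L * (w \<omega>)\<^sup>2"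
    proof (rule mult_right_mono)
      have "yw_fun2 k x * S\<^sup>2 \<le> yw_fun2 k x * (L * \<bar>x\<bar>)"
        using SL yw_fun2_bounds(1)[OF k] by (rule mult_left_mono)
      also have "\<dots> = L * (yw_fun2 k x * \<bar>x\<bar>)" by simp
      also have "\<dots> \<le> L * 1" using yw_fun2_bounds(3)[OF k] L0 by (rule mult_left_mono)
      finally show "yw_fun2 k x * S\<^sup>2 \<le> L" by simp
    qed simp
    have \<beta>2: "\<beta>\<^sup>2 \<le> 4 * L\<^sup>2 * \<Delta>\<^sup>2"
      using power_mono[OF \<beta>(1) abs_ge_zero, of 2] by (simp add: power_mult_distrib)
    have h2: "h\<^sup>2 \<le> 12 * L\<^sup>2 * \<Delta>\<^sup>2 + 3 * (d1 \<omega>)\<^sup>2 + 3 * (d2 \<omega>)\<^sup>2"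
    proof -
      have "0 \<le> (d1 \<omega> + d2 \<omega>)\<^sup>2" "0 \<le> (d1 \<omega> - \<beta>)\<^sup>2" "0 \<le> (d2 \<omega> + \<beta>)\<^sup>2" by simp_all
      then have "h\<^sup>2 \<le> 3 * (d1 \<omega>)\<^sup>2 + 3 * (d2 \<omega>)\<^sup>2 + 3 * \<beta>\<^sup>2"
        unfolding h_eq by (simp add: power2_eq_square algebra_simps)
      with \<beta>2 show ?thesis by linarith
    qed
    have 3: "k\<^sup>2 * (4 * L\<^sup>2) * (q * h\<^sup>2 + w \<omega> ^ 4 / q) / 2 \<le>
        2 * k\<^sup>2 * L\<^sup>2 * (q * (12 * L\<^sup>2 * \<Delta>\<^sup>2 + 3 * (d1 \<omega>)\<^sup>2 + 3 * (d2 \<omega>)\<^sup>2) + 1 / q * w \<omega> ^ 4)"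
    proof -
      have "k\<^sup>2 * (4 * L\<^sup>2) * (q * h\<^sup>2 + w \<omega> ^ 4 / q) / 2 = 2 * k\<^sup>2 * L\<^sup>2 * (q * h\<^sup>2 + 1 / q * w \<omega> ^ 4)"
        by simp
      also have "\<dots> \<le> 2 * k\<^sup>2 * L\<^sup>2 * (q * (12 * L\<^sup>2 * \<Delta>\<^sup>2 + 3 * (d1 \<omega>)\<^sup>2 + 3 * (d2 \<omega>)\<^sup>2) + 1 / q * w \<omega> ^ 4)"
        using h2 q(1) by (intro mult_left_mono add_right_mono) auto
      finally show ?thesis .
    qed
    have 4: "3 * k * ((R1 \<omega>)\<^sup>2 + (R2 \<omega>)\<^sup>2 + \<beta>\<^sup>2) \<le> 3 * k * ((R1 \<omega>)\<^sup>2 + (R2 \<omega>)\<^sup>2 + 4 * L\<^sup>2 * \<Delta>\<^sup>2)"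
      using \<beta>2 k by (intro mult_left_mono add_left_mono) auto
    have "yw_fun k (D t \<omega>) = yw_fun k (x + h)" by (simp add: x_def h_def)
    also note step
    also have "yw_fun k x + arsinh (k * x) * (d1 \<omega> - d2 \<omega>) + \<bar>arsinh (k * x)\<bar> * \<bar>\<beta>\<bar>
        + yw_fun2 k x * S\<^sup>2 * (w \<omega>)\<^sup>2
        + k\<^sup>2 * (4 * L\<^sup>2) * (q * h\<^sup>2 + w \<omega> ^ 4 / q) / 2 + 3 * k * ((R1 \<omega>)\<^sup>2 + (R2 \<omega>)\<^sup>2 + \<beta>\<^sup>2)
      \<le> yw_fun k x + (\<eta> \<omega> * d1 \<omega> - \<eta> \<omega> * d2 \<omega>) + (L * \<Delta> * (yw_fun k x + 1) + L * P * G \<omega>) + L * (w \<omega>)\<^sup>2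
        + 2 * k\<^sup>2 * L\<^sup>2 * (q * (12 * L\<^sup>2 * \<Delta>\<^sup>2 + 3 * (d1 \<omega>)\<^sup>2 + 3 * (d2 \<omega>)\<^sup>2) + 1 / q * w \<omega> ^ 4)
        + 3 * k * ((R1 \<omega>)\<^sup>2 + (R2 \<omega>)\<^sup>2 + 4 * L\<^sup>2 * \<Delta>\<^sup>2)"
      by (intro add_mono 1 2 3 4) (simp_all add: \<eta>_def x_def right_diff_distrib)
    also have "\<dots> = f \<omega>"
      unfolding f_def x_def[symmetric] by (simp only: distrib_left distrib_right mult_1_left mult_1_right)
    finally show ?case .
  qed
  have "(\<lambda>x. arsinh (k * x)) \<in> borel_measurable borel"
    by (intro borel_measurable_continuous_onI continuous_intros)
  then have \<eta>F: "\<eta> \<in> borel_measurable (F s)"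
    unfolding \<eta>_def using st by (intro measurable_compose[OF D_adapted]) auto
  have \<eta>P: "\<bar>\<eta> \<omega>\<bar> \<le> P" if "\<omega> \<in> space M" for \<omega>
    unfolding \<eta>_def P_def using D_bound[of s \<omega>] that st by (intro abs_arsinh_le[OF k]) auto
  note orth = Y1.I_increment_orthogonal[OF st3 \<eta>F \<eta>P] Y2.I_increment_orthogonal[OF st3 \<eta>F \<eta>P]
  have W4: "has_bochner_integral N (\<lambda>\<omega>. w \<omega> ^ 4) (3 * \<Delta>\<^sup>2)"
    unfolding w_def \<Delta>_def by (rule Y1.W_fourth[OF st3])
  have W2: "has_bochner_integral N (\<lambda>\<omega>. (w \<omega>)\<^sup>2) \<Delta>"
    using Y1.increment_integrable(2)[of s t] Y1.W_increment_second[of s t] st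
    by (auto simp: w_def \<Delta>_def has_bochner_integral_iff)
  have const: "has_bochner_integral N (\<lambda>_. c) c" for c :: real
    using Y1.prob_space by (simp add: has_bochner_integral_iff)
  define eG where "eG = (\<integral>\<omega>. G \<omega> \<partial>N)"
  define e1 where "e1 = (\<integral>\<omega>. (d1 \<omega>)\<^sup>2 \<partial>N)"
  define e2 where "e2 = (\<integral>\<omega>. (d2 \<omega>)\<^sup>2 \<partial>N)"
  define r1 where "r1 = (\<integral>\<omega>. (R1 \<omega>)\<^sup>2 \<partial>N)"
  define r2 where "r2 = (\<integral>\<omega>. (R2 \<omega>)\<^sup>2 \<partial>N)"
  define u where "u = (\<integral>\<omega>. yw_fun k (D s \<omega>) \<partial>N)"
  have hU: "has_bochner_integral N (\<lambda>\<omega>. yw_fun k (D s \<omega>)) u"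
    unfolding u_def using yw_D_integrable[of s k] st k by (intro has_bochner_integral_integrable) auto
  have hG: "has_bochner_integral N G eG"
    unfolding eG_def G_def by (rule has_bochner_integral_integrable[OF D_time_integral_integrable[OF st]])
  have hd: "has_bochner_integral N (\<lambda>\<omega>. (d1 \<omega>)\<^sup>2) e1" "has_bochner_integral N (\<lambda>\<omega>. (d2 \<omega>)\<^sup>2) e2"
    unfolding e1_def e2_def d1_def d2_def
    by (rule has_bochner_integral_integrable[OF Y1.I_increment_square_integrable[OF st3]],
        rule has_bochner_integral_integrable[OF Y2.I_increment_square_integrable[OF st3]])
  have hR: "has_bochner_integral N (\<lambda>\<omega>. (R1 \<omega>)\<^sup>2) r1" "has_bochner_integral N (\<lambda>\<omega>. (R2 \<omega>)\<^sup>2) r2"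
    unfolding r1_def r2_def R1_def R2_def
    by (rule has_bochner_integral_integrable, rule Y1.R_square_integrable; (rule st3 | assumption))
       (rule has_bochner_integral_integrable, rule Y2.R_square_integrable; (rule st3 | assumption))
  have ho: "has_bochner_integral N (\<lambda>\<omega>. \<eta> \<omega> * d1 \<omega>) 0" "has_bochner_integral N (\<lambda>\<omega>. \<eta> \<omega> * d2 \<omega>) 0"
    using orth by (auto simp: has_bochner_integral_iff d1_def d2_def)
  \<comment> \<open>\<open>E\<close> repeats \<open>f\<close> summand by summand with expectations
    inserted; the two zeros are those of the martingale terms.\<close>
  define E where "E = (1 + L * \<Delta>) * u + L * \<Delta> + 0 - 0 + L * P * eG + L * \<Delta>
     + 2 * k\<^sup>2 * L\<^sup>2 * (q * (12 * L\<^sup>2 * \<Delta>\<^sup>2 + 3 * e1 + 3 * e2) + 1 / q * (3 * \<Delta>\<^sup>2))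
     + 3 * k * (r1 + r2 + 4 * L\<^sup>2 * \<Delta>\<^sup>2)"
  have f: "has_bochner_integral N f E"
    unfolding f_def E_def
    by (intro has_bochner_integral_add has_bochner_integral_diff has_bochner_integral_mult_right
        const hU hG hd hR ho W2 W4)
  have "(\<integral>\<omega>. yw_fun k (D t \<omega>) \<partial>N) \<le> (\<integral>\<omega>. f \<omega> \<partial>N)"
    by (rule integral_mono_AE[OF _ _ le]) (use yw_D_integrable[of t k] st k f in \<open>auto simp: has_bochner_integral_iff\<close>)
  also have "\<dots> = E" using f by (simp add: has_bochner_integral_iff)
  also have "E \<le> (1 + L * \<Delta>) * u + (2 * L * \<Delta> + \<Gamma> k * \<Delta> * q)"
  proof -
    have \<Delta>2: "\<Delta>\<^sup>2 \<le> q * \<Delta>" "\<Delta>\<^sup>2 \<le> \<Delta>"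
    proof -
      have "\<Delta> \<le> q" using q mult_left_le[of q q] by simp
      then show "\<Delta>\<^sup>2 \<le> q * \<Delta>" using \<Delta> by (simp add: power2_eq_square)
      show "\<Delta>\<^sup>2 \<le> \<Delta>" using \<Delta> by (simp add: power2_eq_square mult_left_le)
    qed
    have c: "0 \<le> Y1.c1" by (rule Y1.c1_nonneg)
    have "eG \<le> 2 * Y1.c1 * q * \<Delta>"
      using D_time_integral_expectation[OF st] by (simp add: eG_def G_def q_def \<Delta>_def)
    then have 1: "L * P * eG \<le> L * P * (2 * Y1.c1 * q * \<Delta>)"
      using L0 P by (intro mult_left_mono) auto
    have e: "e1 \<le> 18 * L\<^sup>2 * \<Delta>" "e2 \<le> 18 * L\<^sup>2 * \<Delta>"
      using Y1.I_increment_second_moment[OF st3] Y2.I_increment_second_moment[OF st3]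
      by (auto simp: e1_def e2_def d1_def d2_def \<Delta>_def)
    have "12 * L\<^sup>2 * \<Delta>\<^sup>2 \<le> 12 * L\<^sup>2 * \<Delta>" using \<Delta>2 by (intro mult_left_mono) auto
    \<comment> \<open>120 = 12 + 3 * 18 + 3 * 18.\<close>
    with e have "12 * L\<^sup>2 * \<Delta>\<^sup>2 + 3 * e1 + 3 * e2 \<le> 120 * L\<^sup>2 * \<Delta>" by linarith
    then have "q * (12 * L\<^sup>2 * \<Delta>\<^sup>2 + 3 * e1 + 3 * e2) \<le> q * (120 * L\<^sup>2 * \<Delta>)"
      using q by (intro mult_left_mono) auto
    moreover have "1 / q * (3 * \<Delta>\<^sup>2) = 3 * (q * \<Delta>)"
      unfolding q(2)[symmetric] using q(1) by (simp add: power2_eq_square)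
    ultimately have "q * (12 * L\<^sup>2 * \<Delta>\<^sup>2 + 3 * e1 + 3 * e2) + 1 / q * (3 * \<Delta>\<^sup>2) \<le> (120 * L\<^sup>2 + 3) * (q * \<Delta>)"
      by (simp add: algebra_simps)
    then have 2: "2 * k\<^sup>2 * L\<^sup>2 * (q * (12 * L\<^sup>2 * \<Delta>\<^sup>2 + 3 * e1 + 3 * e2) + 1 / q * (3 * \<Delta>\<^sup>2)) \<le>
        2 * k\<^sup>2 * L\<^sup>2 * ((120 * L\<^sup>2 + 3) * (q * \<Delta>))"
      by (rule mult_left_mono) simp
    have r: "r1 \<le> 2 * (L * Y1.c1 * q) * \<Delta>" "r2 \<le> 2 * (L * Y1.c1 * q) * \<Delta>"
      using Y1.R_second_moment[OF st] Y2.R_second_moment[OF st]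
      by (auto simp: r1_def r2_def R1_def R2_def q_def \<Delta>_def)
    have "4 * L\<^sup>2 * \<Delta>\<^sup>2 \<le> 4 * L\<^sup>2 * (q * \<Delta>)" using \<Delta>2 by (intro mult_left_mono) auto
    with r have "r1 + r2 + 4 * L\<^sup>2 * \<Delta>\<^sup>2 \<le> (4 * L * Y1.c1 + 4 * L\<^sup>2) * (q * \<Delta>)"
      by (simp add: algebra_simps)
    then have 3: "3 * k * (r1 + r2 + 4 * L\<^sup>2 * \<Delta>\<^sup>2) \<le> 3 * k * ((4 * L * Y1.c1 + 4 * L\<^sup>2) * (q * \<Delta>))"
      using k by (intro mult_left_mono) auto
    have "\<Gamma> k * \<Delta> * q = L * P * (2 * Y1.c1 * q * \<Delta>) + 2 * k\<^sup>2 * L\<^sup>2 * ((120 * L\<^sup>2 + 3) * (q * \<Delta>))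
        + 3 * k * ((4 * L * Y1.c1 + 4 * L\<^sup>2) * (q * \<Delta>))"
      unfolding \<Gamma>_def P_def by (simp add: algebra_simps)
    with 1 2 3 show ?thesis unfolding E_def by linarith
  qed
  finally show ?thesis unfolding u_def q_def \<Delta>_def .
qed

text \<open>With n + 1 equal steps the errors of order 3/2 add up to \<Gamma> k * t * sqrt (t / (n +
  1)) before the exponential factor. For fixed \<open>k\<close> this tends to 0, and with it all
  dependence on \<open>k\<close> disappears.\<close>

lemma yw_expectation_bound:
  assumes t: "0 \<le> t" "t \<le> T" and k: "0 < k"
  shows "(\<integral>\<omega>. yw_fun k (D t \<omega>) \<partial>N) \<le> 2 * L * t * exp (L * t)"
proof -
  have D0: "AE \<omega> in N. D 0 \<omega> = 0"
    using AE_completion[OF same_start] by (simp add: D_def)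
  have u0: "(\<integral>\<omega>. yw_fun k (D 0 \<omega>) \<partial>N) = 0"
  proof -
    have "AE \<omega> in N. yw_fun k (D 0 \<omega>) = 0" using D0 by eventually_elim simp
    then show ?thesis using yw_D_integrable[of 0 k] t k by (subst integral_cong_AE[of _ _ "\<lambda>_. 0"]) auto
  qed
  have \<Gamma>0: "0 \<le> \<Gamma> k"
  proof -
    have "0 \<le> arsinh k" using k by (simp add: less_imp_le)
    then show ?thesis unfolding \<Gamma>_def using k Y1.L Y1.c1_nonneg
      by (intro add_nonneg_nonneg mult_nonneg_nonneg) auto
  qed
  have le: "(\<integral>\<omega>. yw_fun k (D t \<omega>) \<partial>N) \<le> (2 * L * t + \<Gamma> k * t * sqrt (t * inverse (real (Suc n)))) * exp (L * t)"
    if n: "t \<le> real (Suc n)" "0 < t" for n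
  proof -
    \<comment> \<open>The assumption t <= Suc n makes the step at most 1, as the one-step estimate
      demands.\<close>
    define \<Delta> where "\<Delta> = t / real (Suc n)"
    have \<Delta>: "0 < \<Delta>" "\<Delta> \<le> 1" "real (Suc n) * \<Delta> = t"
      using n by (auto simp: \<Delta>_def)
    define \<gamma> where "\<gamma> = 2 * L * \<Delta> + \<Gamma> k * \<Delta> * sqrt \<Delta>"
    define u where "u = (\<lambda>i. \<integral>\<omega>. yw_fun k (D (real i * \<Delta>) \<omega>) \<partial>N)"
    have "u (Suc n) \<le> real (Suc n) * \<gamma> * exp (real (Suc n) * (L * \<Delta>))"
    proof (rule discrete_gronwall)
      show "u 0 \<le> 0" using u0 by (simp add: u_def)
      show "0 \<le> L * \<Delta>" "0 \<le> \<gamma>" using \<Delta> Y1.L \<Gamma>0 by (auto simp: \<gamma>_def)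
      fix i assume i: "i < Suc n"
      have "real (Suc i) * \<Delta> \<le> real (Suc n) * \<Delta>"
        using i \<Delta> by (intro mult_right_mono) auto
      then have T: "real (Suc i) * \<Delta> \<le> T" using \<Delta>(3) t by simp
      have eq: "real (Suc i) * \<Delta> - real i * \<Delta> = \<Delta>" by (simp add: algebra_simps)
      show "u (Suc i) \<le> (1 + L * \<Delta>) * u i + \<gamma>"
        using yw_expectation_step[of "real i * \<Delta>" "real (Suc i) * \<Delta>" k] \<Delta> T k
        unfolding eq u_def \<gamma>_def by simp
    qed
    moreover have "u (Suc n) = (\<integral>\<omega>. yw_fun k (D t \<omega>) \<partial>N)" unfolding u_def \<Delta>(3) ..
    moreover have "real (Suc n) * \<gamma> = 2 * L * (real (Suc n) * \<Delta>) + \<Gamma> k * (real (Suc n) * \<Delta>) * sqrt \<Delta>"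
      unfolding \<gamma>_def by (simp only: distrib_left mult_ac)
    moreover have "real (Suc n) * (L * \<Delta>) = L * (real (Suc n) * \<Delta>)" by (simp only: mult_ac)
    moreover have "\<Delta> = t * inverse (real (Suc n))" by (simp add: \<Delta>_def divide_inverse)
    ultimately show ?thesis unfolding \<Delta>(3) by metis
  qed
  show ?thesis
  proof (cases "t = 0")
    case False
    then have "0 < t" using t by simp
    have "(\<lambda>n. (2 * L * t + \<Gamma> k * t * sqrt (t * inverse (real (Suc n)))) * exp (L * t)) \<longlonglongrightarrow>
        (2 * L * t + \<Gamma> k * t * sqrt (t * 0)) * exp (L * t)"
      by (intro tendsto_intros LIMSEQ_inverse_real_of_nat)
    moreover obtain n0 where n0: "t \<le> real n0" using real_arch_simple by blast
    then have "\<forall>n\<ge>n0. (\<integral>\<omega>. yw_fun k (D t \<omega>) \<partial>N) \<le>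
        (2 * L * t + \<Gamma> k * t * sqrt (t * inverse (real (Suc n)))) * exp (L * t)"
      using le \<open>0 < t\<close> by (auto intro: order_trans)
    ultimately have "(\<integral>\<omega>. yw_fun k (D t \<omega>) \<partial>N) \<le> (2 * L * t + \<Gamma> k * t * sqrt (t * 0)) * exp (L * t)"
      by (blast intro: LIMSEQ_le_const)
    then show ?thesis by simp
  qed (use u0 in simp)
qed

text \<open>If |x| > c, then |x| * arsinh (k * c) is at most yw_fun k x + 1. Hence E|D t| is at most
  c plus a bounded quantity divided by arsinh (k * c); \<open>k\<close> tends to infinity for fixed
  \<open>c\<close>, and \<open>c\<close> is arbitrary.\<close>

lemma D_AE_zero:
  assumes t: "0 \<le> t" "t \<le> T"
  shows "AE \<omega> in N. D t \<omega> = 0"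
proof -
  define U where "U = 2 * L * t * exp (L * t)"
  have int: "integrable N (\<lambda>\<omega>. \<bar>D t \<omega>\<bar>)"
    by (rule Y1.integrable_const_bound[where B = 1])
       (use D_bound t D_measurable in \<open>auto intro!: borel_measurable_abs\<close>)
  have le: "(\<integral>\<omega>. \<bar>D t \<omega>\<bar> \<partial>N) \<le> c + (U + 1) * inverse (arsinh (k * c))" if "0 < c" "0 < k" for c k
  proof -
    have a: "0 < arsinh (k * c)" using that by simp
    have "(\<integral>\<omega>. \<bar>D t \<omega>\<bar> \<partial>N) \<le> (\<integral>\<omega>. c + (yw_fun k (D t \<omega>) + 1) * inverse (arsinh (k * c)) \<partial>N)"
    proof (rule integral_mono[OF int])
      show "integrable N (\<lambda>\<omega>. c + (yw_fun k (D t \<omega>) + 1) * inverse (arsinh (k * c)))"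
        using yw_D_integrable[OF t that(2)] by simp
      fix \<omega> assume "\<omega> \<in> space N"
      then have D: "\<bar>D t \<omega>\<bar> \<le> 1" using D_bound t by simp
      note low = yw_fun_lower[OF that(2), of "D t \<omega>"]
      \<comment> \<open>Below level \<open>c\<close> only the sign of the second summand matters; it
        is nonnegative since yw_fun k x + |x| >= 0 and |x| <= 1.\<close>
      show "\<bar>D t \<omega>\<bar> \<le> c + (yw_fun k (D t \<omega>) + 1) * inverse (arsinh (k * c))"
      proof (cases "\<bar>D t \<omega>\<bar> \<le> c")
        case True
        have "0 \<le> \<bar>D t \<omega>\<bar> * \<bar>arsinh (k * D t \<omega>)\<bar>" by simp
        then have "0 \<le> yw_fun k (D t \<omega>) + 1" using low D by linarith
        moreover have "0 \<le> inverse (arsinh (k * c))"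
          using less_imp_le[OF a] by (rule inverse_nonnegative_iff_nonnegative[THEN iffD2])
        ultimately have "0 \<le> (yw_fun k (D t \<omega>) + 1) * inverse (arsinh (k * c))"
          by (rule mult_nonneg_nonneg)
        with True show ?thesis by linarith
      next
        case False
        have "arsinh (k * c) \<le> \<bar>arsinh (k * D t \<omega>)\<bar>"
        proof (cases "0 \<le> D t \<omega>")
          case True
          then have "arsinh (k * c) \<le> arsinh (k * D t \<omega>)"
            using False that by (intro arsinh_mono_real mult_left_mono) auto
          then show ?thesis by linarith
        next
          case neg: False
          then have "arsinh (k * c) \<le> arsinh (k * (- D t \<omega>))"
            using False that by (intro arsinh_mono_real mult_left_mono) auto
          then show ?thesis by simp
        qed
        then have "\<bar>D t \<omega>\<bar> * arsinh (k * c) \<le> \<bar>D t \<omega>\<bar> * \<bar>arsinh (k * D t \<omega>)\<bar>"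
          by (rule mult_left_mono) simp
        with low D have "\<bar>D t \<omega>\<bar> * arsinh (k * c) \<le> yw_fun k (D t \<omega>) + 1" by linarith
        then have "\<bar>D t \<omega>\<bar> \<le> (yw_fun k (D t \<omega>) + 1) * inverse (arsinh (k * c))"
          using a by (simp add: pos_le_divide_eq flip: divide_inverse)
        with that show ?thesis by linarith
      qed
    qed
    also have "\<dots> = c + ((\<integral>\<omega>. yw_fun k (D t \<omega>) \<partial>N) + 1) * inverse (arsinh (k * c))"
      using yw_D_integrable[OF t that(2)] Y1.prob_space by simp
    also have "\<dots> \<le> c + (U + 1) * inverse (arsinh (k * c))"
      using yw_expectation_bound[OF t that(2)] inverse_nonnegative_iff_nonnegative[THEN iffD2, OF less_imp_le[OF a]]
      unfolding U_def by (intro add_left_mono mult_right_mono add_right_mono)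
    finally show ?thesis .
  qed
  have "(\<integral>\<omega>. \<bar>D t \<omega>\<bar> \<partial>N) \<le> 0 + c" if c: "0 < c" for c
  proof (rule tendsto_lowerbound)
    have "filterlim (\<lambda>k. k * c) at_top at_top"
      using c by (intro filterlim_at_top_mult_tendsto_pos[OF tendsto_const]) (auto intro: filterlim_ident)
    then have "filterlim (\<lambda>k. arsinh (k * c)) at_top at_top"
      by (rule filterlim_compose[OF arsinh_real_at_top])
    then have "((\<lambda>k. inverse (arsinh (k * c))) \<longlongrightarrow> 0) at_top"
      by (rule tendsto_inverse_0_at_top)
    then have "((\<lambda>k. c + (U + 1) * inverse (arsinh (k * c))) \<longlongrightarrow> c + (U + 1) * 0) at_top"
      by (intro tendsto_intros)
    then show "((\<lambda>k. c + (U + 1) * inverse (arsinh (k * c))) \<longlongrightarrow> 0 + c) at_top" by simp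
    show "\<forall>\<^sub>F k in at_top. (\<integral>\<omega>. \<bar>D t \<omega>\<bar> \<partial>N) \<le> c + (U + 1) * inverse (arsinh (k * c))"
      using eventually_gt_at_top[of 0] by eventually_elim (use le c in auto)
  qed simp
  then have "(\<integral>\<omega>. \<bar>D t \<omega>\<bar> \<partial>N) \<le> 0" by (rule field_le_epsilon)
  moreover have "0 \<le> (\<integral>\<omega>. \<bar>D t \<omega>\<bar> \<partial>N)" by simp
  ultimately have "(\<integral>\<omega>. \<bar>D t \<omega>\<bar> \<partial>N) = 0" by linarith
  then have "AE \<omega> in N. \<bar>D t \<omega>\<bar> = 0"
    by (subst (asm) integral_nonneg_eq_0_iff_AE[OF int]) auto
  then show ?thesis by simp
qed

text \<open>The exceptional null set depends on the time. It is made common to the rational times,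
  and continuity of the paths extends the equality to all times.\<close>

theorem pathwise_unique: "AE \<omega> in M. \<forall>t\<in>{0..T}. Y1 t \<omega> = Y2 t \<omega>"
proof -
  have "AE \<omega> in N. \<forall>r\<in>\<rat> \<inter> {0..T}. D r \<omega> = 0"
    by (subst AE_ball_countable) (auto intro: D_AE_zero countable_rat)
  then have "AE \<omega> in N. \<forall>t\<in>{0..T}. Y1 t \<omega> = Y2 t \<omega>"
    using AE_space
  proof eventually_elim
    case (elim \<omega>)
    show ?case
    proof
      fix t assume t: "t \<in> {0..T}"
      \<comment> \<open>Rounding down keeps the rational approximations inside {0..T}, even at t =
        T.\<close>
      let ?r = "\<lambda>n. of_int \<lfloor>t * real (Suc n)\<rfloor> / real (Suc n)"
      have r: "?r n \<in> \<rat> \<inter> {0..T}" for n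
      proof -
        have "of_int \<lfloor>t * real (Suc n)\<rfloor> \<le> t * real (Suc n)" by linarith
        then have "?r n \<le> t" by (simp add: pos_divide_le_eq del: of_nat_Suc)
        moreover have "0 \<le> ?r n" using t by simp
        ultimately show ?thesis using t by (auto simp del: of_nat_Suc)
      qed
      have "(\<lambda>n. D (?r n) \<omega>) \<longlonglongrightarrow> D t \<omega>"
        by (rule continuous_on_tendsto_compose[OF D_cont floor_approximation_tendsto])
           (use elim(2) t r in auto)
      moreover have "D (?r n) \<omega> = 0" for n using elim(1) r by blast
      ultimately have "D t \<omega> = 0" by (simp add: LIMSEQ_const_iff)
      then show "Y1 t \<omega> = Y2 t \<omega>" by (simp add: D_def)
    qed
  qed
  then show ?thesis by (simp add: AE_completion_iff)
qed

end

section \<open>From the martingale problem to the bounded equation\<close>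

lemma ito_integral_cong:
  assumes ito: "ito_integral M F T W H I"
    and eq: "\<And>s \<omega>. 0 \<le> s \<Longrightarrow> s \<le> T \<Longrightarrow> \<omega> \<in> space M \<Longrightarrow> H s \<omega> = H' s \<omega>"
    and sp: "\<And>t. space (F t) = space M"
  shows "ito_integral M F T W H' I"
proof -
  have progr: "progressive_process F T H'"
    unfolding progressive_process_def
  proof
    fix t assume t: "t \<in> {0..T}"
    have "(\<lambda>(s, \<omega>). H s \<omega>) \<in> borel_measurable (restrict_space borel {0..t} \<Otimes>\<^sub>M F t)"
      using ito t unfolding ito_integral_def progressive_process_def by blast
    then show "(\<lambda>(s, \<omega>). H' s \<omega>) \<in> borel_measurable (restrict_space borel {0..t} \<Otimes>\<^sub>M F t)"
      by (rule measurable_cong[THEN iffD1, rotated])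
         (use t in \<open>auto simp: space_pair_measure space_restrict_space sp intro!: eq\<close>)
  qed
  have sq: "(\<integral>\<^sup>+s\<in>{0..T}. ennreal ((H' s \<omega>)\<^sup>2) \<partial>lborel) = (\<integral>\<^sup>+s\<in>{0..T}. ennreal ((H s \<omega>)\<^sup>2) \<partial>lborel)"
    if "\<omega> \<in> space M" for \<omega>
    by (intro nn_integral_cong) (auto simp: indicator_def eq[OF _ _ that])
  have dist: "(\<integral>\<^sup>+s\<in>{0..T}. ennreal ((K s \<omega> - H' s \<omega>)\<^sup>2) \<partial>lborel) =
      (\<integral>\<^sup>+s\<in>{0..T}. ennreal ((K s \<omega> - H s \<omega>)\<^sup>2) \<partial>lborel)"
    if "\<omega> \<in> space M" for \<omega> and K :: "real \<Rightarrow> 'a \<Rightarrow> real"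
    by (intro nn_integral_cong) (auto simp: indicator_def eq[OF _ _ that])
  have set_eq: "{\<omega>\<in>space M. c < (\<integral>\<^sup>+s\<in>{0..T}. ennreal ((K s \<omega> - H' s \<omega>)\<^sup>2) \<partial>lborel)} =
      {\<omega>\<in>space M. c < (\<integral>\<^sup>+s\<in>{0..T}. ennreal ((K s \<omega> - H s \<omega>)\<^sup>2) \<partial>lborel)}"
    for c and K :: "real \<Rightarrow> 'a \<Rightarrow> real"
    using dist by (intro Collect_cong conj_cong) simp_all
  have "AE \<omega> in M. (\<integral>\<^sup>+s\<in>{0..T}. ennreal ((H s \<omega>)\<^sup>2) \<partial>lborel) < \<infinity>"
    using ito unfolding ito_integral_def by blast
  then have fin: "AE \<omega> in M. (\<integral>\<^sup>+s\<in>{0..T}. ennreal ((H' s \<omega>)\<^sup>2) \<partial>lborel) < \<infinity>"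
    using AE_space by eventually_elim (simp add: sq)
  show ?thesis
    using ito progr fin unfolding ito_integral_def set_eq by blast
qed

lemma comp_fun_continuous: "continuous_on A comp_fun"
  unfolding comp_fun_def[abs_def] by (intro continuous_intros) simp

text \<open>The martingale problem is used for the single test function
  \<open>comp_ext \<delta>\<close> restricted to the half-line; its identity is the equation for
  \<open>comp_fun (X t \<omega>)\<close>.\<close>

lemma bounded_sde_if_strong_martingale_solution:
  assumes \<delta>: "0 \<le> \<delta>" "\<delta> < 1" and bm: "brownian_motion M T W"
    and sol: "strong_martingale_solution M T W \<delta> X"
  obtains I where "bounded_sde M (canonical_filtration M T W) T W (\<lambda>t \<omega>. comp_fun (X t \<omega>)) I (drift \<delta>) diffusion 16"
proof -
  let ?F = "canonical_filtration M T W"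
  let ?f = "restrict (comp_ext \<delta>) {0..}"
  interpret B: brownian_filtration "completion M" ?F T W
    by (rule brownian_filtration_canonical[OF bm])
  have "?f \<in> D_L_half \<delta>" using comp_ext_in_D_L[OF \<delta>(1)] by (auto simp: D_L_half_def)
  then obtain I where ito: "ito_integral M ?F T W (\<lambda>s \<omega>. deriv_half ?f (X s \<omega>)) I"
    and sde: "\<And>t. t \<in> {0..T} \<Longrightarrow> AE \<omega> in M. ?f (X t \<omega>) - ?f (X 0 \<omega>) -
        (LINT s:{0..t}|lborel. L_half \<delta> ?f (X s \<omega>)) = I t \<omega>"
    using sol unfolding strong_martingale_solution_def by blast
  have X: "\<And>\<omega>. \<omega> \<in> space M \<Longrightarrow> continuous_on {0..T} (\<lambda>t. X t \<omega>)"
    "\<And>t \<omega>. 0 \<le> t \<Longrightarrow> t \<le> T \<Longrightarrow> \<omega> \<in> space M \<Longrightarrow> 0 \<le> X t \<omega>"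
    "\<And>t. 0 \<le> t \<Longrightarrow> t \<le> T \<Longrightarrow> X t \<in> borel_measurable (?F t)"
    using sol by (auto simp: strong_martingale_solution_def continuous_process_def adapted_process_def)
  have f_eq: "?f x = comp_fun x" if "0 \<le> x" for x
    using that by (auto simp: comp_ext_def comp_fun_def sgn_if)
  \<comment> \<open>16 is the Hoelder constant of the diffusion coefficient; the Lipschitz constant
    14 of the drift and the bounds of both coefficients are smaller.\<close>
  have "bounded_sde M ?F T W (\<lambda>t \<omega>. comp_fun (X t \<omega>)) I (drift \<delta>) diffusion 16"
  proof unfold_locales
    show "continuous_on UNIV (drift \<delta>)" "continuous_on UNIV diffusion"
      unfolding drift_def[abs_def] diffusion_def[abs_def] by (intro continuous_intros)+
    fix x y :: real assume x: "x \<in> {0..1}"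
    have "0 \<le> (1 - x)\<^sup>2" "(1 - x)\<^sup>2 \<le> 1" using x by (auto intro!: power_le_one)
    then have "0 \<le> \<delta> * (1 - x)\<^sup>2" "\<delta> * (1 - x)\<^sup>2 \<le> 1" "0 \<le> x * (1 - x)\<^sup>2" "x * (1 - x)\<^sup>2 \<le> 1"
      using \<delta> x by (auto intro: mult_le_one)
    then show "\<bar>drift \<delta> x\<bar> \<le> 16" unfolding drift_def by linarith
    have "x * (1 - x) ^ 3 \<le> 1 * 1" using x by (intro mult_mono power_le_one) auto
    moreover have "0 \<le> x * (1 - x) ^ 3" using x by simp
    ultimately have "0 \<le> sqrt (x * (1 - x) ^ 3)" "sqrt (x * (1 - x) ^ 3) \<le> 1" by simp_all
    then show "\<bar>diffusion x\<bar> \<le> 16" unfolding diffusion_def by linarith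
    assume y: "y \<in> {0..1}"
    show "\<bar>drift \<delta> x - drift \<delta> y\<bar> \<le> 16 * \<bar>x - y\<bar>"
      using drift_lipschitz[OF x y, of \<delta>] \<delta> abs_ge_zero[of "x - y"] by linarith
    show "(diffusion x - diffusion y)\<^sup>2 \<le> 16 * \<bar>x - y\<bar>" by (rule diffusion_holder[OF x y])
  next
    fix t \<omega> assume "0 \<le> t" "t \<le> T" "\<omega> \<in> space M"
    then show "comp_fun (X t \<omega>) \<in> {0..1}"
      using comp_fun_bounds[of "X t \<omega>"] by simp
  next
    fix \<omega> assume "\<omega> \<in> space M"
    then show "continuous_on {0..T} (\<lambda>t. comp_fun (X t \<omega>))"
      by (intro continuous_on_compose2[OF comp_fun_continuous X(1)]) auto
  next
    fix t assume t: "0 \<le> t" "t \<le> T"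
    then show "(\<lambda>\<omega>. comp_fun (X t \<omega>)) \<in> borel_measurable (?F t)"
      by (intro measurable_compose[OF X(3)] borel_measurable_continuous_onI comp_fun_continuous)
    have "AE \<omega> in M. comp_fun (X t \<omega>) = comp_fun (X 0 \<omega>) +
        (LINT r:{0..t}|lborel. drift \<delta> (comp_fun (X r \<omega>))) + I t \<omega>"
      using sde[OF atLeastAtMost_iff[THEN iffD2, OF conjI[OF t]]] AE_space
    proof eventually_elim
      case (elim \<omega>)
      have "(LINT s:{0..t}|lborel. L_half \<delta> ?f (X s \<omega>)) = (LINT r:{0..t}|lborel. drift \<delta> (comp_fun (X r \<omega>)))"
        using X(2)[of _ \<omega>] elim t \<delta> by (intro set_lebesgue_integral_cong) (auto simp: L_half_comp_ext)
      moreover have "?f (X t \<omega>) = comp_fun (X t \<omega>)" "?f (X 0 \<omega>) = comp_fun (X 0 \<omega>)"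
        using X(2)[of t \<omega>] X(2)[of 0 \<omega>] t elim by (auto intro!: f_eq simp del: restrict_apply)
      ultimately show ?case using elim(1) by linarith
    qed
    then show "AE \<omega> in completion M. comp_fun (X t \<omega>) = comp_fun (X 0 \<omega>) +
        (LINT r:{0..t}|lborel. drift \<delta> (comp_fun (X r \<omega>))) + I t \<omega>"
      by (rule AE_completion)
  next
    \<comment> \<open>The two integrands agree only where \<open>X\<close> is nonnegative, that is
      for times in {0..T} and points of the space, so a congruence on this region is needed.\<close>
    show "ito_integral M ?F T W (\<lambda>s \<omega>. diffusion (comp_fun (X s \<omega>))) I"
      by (rule ito_integral_cong[OF ito])
         (use X(2) in \<open>auto simp: deriv_half_comp_ext space_canonical_filtration[OF bm]\<close>)
  qed simp
  then show thesis by (rule that)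
qed

theorem proposition3p15:
  fixes M :: "'a measure"
    and T \<delta> :: real
    and W X1 X2 :: "real \<Rightarrow> 'a \<Rightarrow> real"
  assumes "T > 0"
    and "0 \<le> \<delta>" "\<delta> < 1"
    and "prob_space M"
    and "brownian_motion M T W"
    and "strong_martingale_solution M T W \<delta> X1"
    and "strong_martingale_solution M T W \<delta> X2"
    and "AE \<omega> in M. X1 0 \<omega> = X2 0 \<omega>"
  shows "indistinguishable M T X1 X2"
proof -
  let ?F = "canonical_filtration M T W"
  obtain I1 where "bounded_sde M ?F T W (\<lambda>t \<omega>. comp_fun (X1 t \<omega>)) I1 (drift \<delta>) diffusion 16"
    using bounded_sde_if_strong_martingale_solution assms by blast
  then interpret Y1: bounded_sde M ?F T W "\<lambda>t \<omega>. comp_fun (X1 t \<omega>)" I1 "drift \<delta>" diffusion 16 .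
  obtain I2 where "bounded_sde M ?F T W (\<lambda>t \<omega>. comp_fun (X2 t \<omega>)) I2 (drift \<delta>) diffusion 16"
    using bounded_sde_if_strong_martingale_solution assms by blast
  then interpret Y2: bounded_sde M ?F T W "\<lambda>t \<omega>. comp_fun (X2 t \<omega>)" I2 "drift \<delta>" diffusion 16 .
  interpret bounded_sde_pair M ?F T W "\<lambda>t \<omega>. comp_fun (X1 t \<omega>)" I1 "\<lambda>t \<omega>. comp_fun (X2 t \<omega>)" I2
    "drift \<delta>" diffusion 16
  proof
    show "AE \<omega> in M. comp_fun (X1 0 \<omega>) = comp_fun (X2 0 \<omega>)"
      using assms(8) by eventually_elim simp
  qed
  \<comment> \<open>Nonnegativity is what lets \<open>comp_fun\<close>, an even function, be
    inverted at the end.\<close>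
  have nonneg: "0 \<le> X1 t \<omega>" "0 \<le> X2 t \<omega>" if "t \<in> {0..T}" "\<omega> \<in> space M" for t \<omega>
    using assms(6,7) that by (auto simp: strong_martingale_solution_def)
  show ?thesis
    unfolding indistinguishable_def
    using pathwise_unique AE_space
    by eventually_elim (use nonneg comp_fun_inj in blast)
qed

end
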